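(* Let $T:V\to\mathfrak G$ be a relative Rota-Baxter operator on a Leibniz algebra $(\mathfrak G,[-,-]_{\mathfrak G})$ with respect to an antisymmetric representation $(V;\rho^L,\rho^R=0)$, and let $\bar T=\mathrm{pr}\circ T:V\to\mathfrak G_{\mathrm{Lie}}$ be the induced relative averaging operator on the canonical Lie algebra $\mathfrak G_{\mathrm{Lie}}$ with respect to $(V;\theta)$. Then there is a long exact sequence of cohomology groups $$\cdots\to\mathcal{HL}^n(V,\mathrm{Leib}(\mathfrak G))\xrightarrow{\mathcal H^n(\alpha_V)}\mathcal H^n_{RB}(T)\xrightarrow{\mathcal H^n(\beta_V)}\mathcal H^n_{AO}(\bar T)\xrightarrow{c^n}\mathcal{HL}^{n+1}(V,\mathrm{Leib}(\mathfrak G))\to\cdots,$$ where $\alpha_V:\mathrm{Hom}(\otimes^nV,\mathrm{Leib}(\mathfrak G))\to\mathrm{Hom}(\otimes^nV,\mathfrak G)$ is composition with the inclusion $\mathrm{Leib}(\mathfrak G)\hookrightarrow\mathfrak G$, $\beta_V:\mathrm{Hom}(\otimes^nV,\mathfrak G)\to\mathrm{Hom}(\otimes^nV,\mathfrak G_{\mathrm{Lie}})$ is $\beta_V(f)=\mathrm{pr}\circ f$, and $c^n$ is the connecting map.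
   Context: All vector spaces are finite-dimensional over an algebraically closed field $\mathbb K$ of characteristic $0$. A (left) Leibniz algebra is a vector space $\mathfrak G$ with a bilinear operation $[-,-]_{\mathfrak G}$ such that $[x,[y,z]_{\mathfrak G}]_{\mathfrak G}=[[x,y]_{\mathfrak G},z]_{\mathfrak G}+[y,[x,z]_{\mathfrak G}]_{\mathfrak G}$. A representation of $\mathfrak G$ is a triple $(V;\rho^L,\rho^R)$ with $\rho^L,\rho^R:\mathfrak G\to\mathfrak{gl}(V)$ linear such that for all $x,y\in\mathfrak G$: $\rho^L([x,y]_{\mathfrak G})=[\rho^L(x),\rho^L(y)]$, $\rho^R([x,y]_{\mathfrak G})=[\rho^L(x),\rho^R(y)]$, $\rho^R(y)\circ\rho^L(x)=-\rho^R(y)\circ\rho^R(x)$. It is antisymmetric if $\rho^R=0$. A relative Rota-Baxter operator on $\mathfrak G$ with respect to $(V;\rho^L,\rho^R)$ is a linear map $T:V\to\mathfrak G$ with $[Tu,Tv]_{\mathfrak G}=T(\rho^L(Tu)v+\rho^R(Tv)u)$ for all $u,v\in V$. A relative averaging operator on a Lie algebra $\mathfrak g$ with respect to a representation $(V;\rho)$ is a linear map $T:V\to\mathfrak g$ with $[Tu,Tv]_{\mathfrak g}=T(\rho(Tu)v)$; equivalently, a relative Rota-Baxter operator on $\mathfrak g$ viewed as a Leibniz algebra with respect to $(V;\rho,0)$. $\mathrm{Leib}(\mathfrak G)$ is the span of all $[x,x]_{\mathfrak G}$, an ideal; $\mathfrak G_{\mathrm{Lie}}=\mathfrak G/\mathrm{Leib}(\mathfrak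 G)$ is the canonical Lie algebra, $\mathrm{pr}:\mathfrak G\to\mathfrak G_{\mathrm{Lie}}$, $x\mapsto\bar x$, the projection, and $\theta:\mathfrak G_{\mathrm{Lie}}\to\mathfrak{gl}(V)$, $\theta(\bar x)=\rho^L(x)$, the induced Lie algebra representation. When $T$ is a relative Rota-Baxter operator with respect to an antisymmetric representation, $\bar T=\mathrm{pr}\circ T$ is a relative averaging operator on $\mathfrak G_{\mathrm{Lie}}$ with respect to $(V;\theta)$. Loday-Pirashvili cohomology: for a representation $(M;\rho^L,\rho^R)$ of a Leibniz algebra $\mathfrak G$, the complex is $C^k(\mathfrak G,M)=\mathrm{Hom}(\otimes^k\mathfrak G,M)$, $k\ge0$, with $$(\partial f)(x_1,\dots,x_{k+1})=\sum_{i=1}^k(-1)^{i+1}\rho^L(x_i)f(x_1,\dots,\hat{x_i},\dots,x_{k+1})+(-1)^{k+1}\rho^R(x_{k+1})f(x_1,\dots,x_k)+\sum_{1\le i<j\le k+1}(-1)^if(x_1,\dots,\hat{x_i},\dots,x_{j-1},[x_i,x_j]_{\mathfrak G},x_{j+1},\dots,x_{k+1}).$$ Its cohomology is denoted $\mathcal{HL}^*(\mathfrak G,M)$. For a relative Rota-Baxter operator $T:V\to\mathfrak G$ with respect to $(V;\rho^L,\rho^R)$, $[u,v]_T=\rho^L(Tu)v+\rho^R(Tv)u$ is a Leibniz bracket on $V$, and $\varrho^L(u)x=[Tu,x]_{\mathfrak G}-T\rho^R(x)u$, $\varrho^R(u)x=[x,Tu]_{\mathfrak G}-T\rho^L(x)u$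 ($u\in V$, $x\in\mathfrak G$) define a representation $(\mathfrak G;\varrho^L,\varrho^R)$ of $(V,[-,-]_T)$. $\partial_T$ denotes the Loday-Pirashvili coboundary operator of $(V,[-,-]_T)$ with coefficients in $(\mathfrak G;\varrho^L,\varrho^R)$, and $\mathcal H^n_{RB}(T)$ is the cohomology of $(\oplus_{n\ge0}\mathrm{Hom}(\otimes^nV,\mathfrak G),\partial_T)$. For a relative averaging operator on a Lie algebra with respect to $(V;\rho)$, the cohomology $\mathcal H^n_{AO}$ is defined in the same way, by viewing the Lie algebra as a Leibniz algebra and $(V;\rho)$ as the antisymmetric representation $(V;\rho,0)$ (so $[u,v]_T=\rho(Tu)v$, $\varrho^L(u)x=[Tu,x]$, $\varrho^R(u)x=[x,Tu]-T\rho(x)u$). For $T$ as in the statement, $(\mathrm{Leib}(\mathfrak G);\varrho^L,\varrho^R)$ is a subrepresentation of $(\mathfrak G;\varrho^L,\varrho^R)$; $\mathcal{HL}^n(V,\mathrm{Leib}(\mathfrak G))$ is the Loday-Pirashvili cohomology of $(V,[-,-]_T)$ with coefficients in this subrepresentation. The connecting map is $c^n([h])=[\alpha_V^{-1}(\partial_T(\beta_V^{-1}(h)))]$, with $\beta_V^{-1}(h)$ any preimage of the cocycle $h$. *)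

theory Defs
  imports "HOL-Algebra.Algebraic_Closure" "Jordan_Normal_Form.Missing_VectorSpace"
begin

section \<open>Leibniz algebras, representations, relative Rota-Baxter operators\<close>

definition char_zero :: "('k, 'x) ring_scheme \<Rightarrow> bool" where
  "char_zero K \<longleftrightarrow> (\<forall>n::nat. n > 0 \<longrightarrow> [n] \<cdot>\<^bsub>K\<^esub> \<one>\<^bsub>K\<^esub> \<noteq> \<zero>\<^bsub>K\<^esub>)"

definition bilinear_map ::
  "('k, 'x) ring_scheme \<Rightarrow> ('k, 'a, 'p) module_scheme \<Rightarrow> ('k, 'b, 'q) module_scheme
    \<Rightarrow> ('k, 'c, 'r) module_scheme \<Rightarrow> ('a \<Rightarrow> 'b \<Rightarrow> 'c) \<Rightarrow> bool" where
  "bilinear_map K A B C f \<longleftrightarrow>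
     (\<forall>x\<in>carrier A. f x \<in> LinearCombinations.module_hom K B C) \<and>
     (\<forall>y\<in>carrier B. (\<lambda>x. f x y) \<in> LinearCombinations.module_hom K A C)"

text \<open>All Leibniz algebras are left Leibniz algebras, and all spaces are finite-dimensional.\<close>

locale leibniz_algebra = vectorspace K G for K and G +
  fixes br
  assumes fin_dim_algebra: "vectorspace.fin_dim K G"
    and br_bilinear: "bilinear_map K G G G br"
    and leibniz: "\<lbrakk>x \<in> carrier G; y \<in> carrier G; z \<in> carrier G\<rbrakk>
      \<Longrightarrow> br x (br y z) = br (br x y) z \<oplus>\<^bsub>G\<^esub> br y (br x z)"

text \<open>A linear map from \<open>G\<close> to \<open>gl(V)\<close> is given in curried form, as a bilinear map
  \<open>rL\<close> with \<open>rL x v\<close> standing for the value of the endomorphism of \<open>x\<close> at \<open>v\<close>.\<close>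

locale leibniz_representation = leibniz_algebra K G br + V: vectorspace K V
  for K and G and br and V +
  fixes rL rR
  assumes fin_dim_space: "vectorspace.fin_dim K V"
    and rL_bilinear: "bilinear_map K G V V rL"
    and rR_bilinear: "bilinear_map K G V V rR"
    and rL_bracket: "\<lbrakk>x \<in> carrier G; y \<in> carrier G; v \<in> carrier V\<rbrakk>
      \<Longrightarrow> rL (br x y) v = rL x (rL y v) \<ominus>\<^bsub>V\<^esub> rL y (rL x v)"
    and rR_bracket: "\<lbrakk>x \<in> carrier G; y \<in> carrier G; v \<in> carrier V\<rbrakk>
      \<Longrightarrow> rR (br x y) v = rL x (rR y v) \<ominus>\<^bsub>V\<^esub> rR y (rL x v)"
    and rR_rL: "\<lbrakk>x \<in> carrier G; y \<in> carrier G; v \<in> carrier V\<rbrakk>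
      \<Longrightarrow> rR y (rL x v) = \<ominus>\<^bsub>V\<^esub> (rR y (rR x v))"

definition antisymmetric_rep ::
  "('k, 'g, 'p) module_scheme \<Rightarrow> ('k, 'v, 'q) module_scheme \<Rightarrow> ('g \<Rightarrow> 'v \<Rightarrow> 'v) \<Rightarrow> bool" where
  "antisymmetric_rep G V rR \<longleftrightarrow> (\<forall>x\<in>carrier G. \<forall>v\<in>carrier V. rR x v = \<zero>\<^bsub>V\<^esub>)"

locale relative_rota_baxter =
  leibniz_representation K G br V rL rR + T: linear_map K V G T
  for K and G and br and V and rL and rR and T +
  assumes rota_baxter: "\<lbrakk>u \<in> carrier V; v \<in> carrier V\<rbrakk>
    \<Longrightarrow> br (T u) (T v) = T (rL (T u) v \<oplus>\<^bsub>V\<^esub> rR (T v) u)"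

section \<open>Quotient spaces and the canonical Lie algebra\<close>

text \<open>The elements of the quotient space are the cosets of \<open>N\<close>. The ring multiplication and unit,
  which the record type provides, play no role and are set to dummy values.\<close>

definition quotient_space ::
  "('k, 'a, 'p) module_scheme \<Rightarrow> 'a set \<Rightarrow> ('k, 'a set) module" where
  "quotient_space M N =
     \<lparr>carrier = a_rcosets\<^bsub>M\<^esub> N, monoid.mult = (\<lambda>_ _. N), one = N, zero = N, add = set_add M,
      smult = (\<lambda>a P. \<Union>x\<in>P. N +>\<^bsub>M\<^esub> (a \<odot>\<^bsub>M\<^esub> x))\<rparr>"

definition Leib ::
  "('k, 'x) ring_scheme \<Rightarrow> ('k, 'g, 'p) module_scheme \<Rightarrow> ('g \<Rightarrow> 'g \<Rightarrow> 'g) \<Rightarrow> 'g set" where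
  "Leib K G br = module.span K G {br x x | x. x \<in> carrier G}"

definition Lie_space ::
  "('k, 'x) ring_scheme \<Rightarrow> ('k, 'g, 'p) module_scheme \<Rightarrow> ('g \<Rightarrow> 'g \<Rightarrow> 'g)
    \<Rightarrow> ('k, 'g set) module" where
  "Lie_space K G br = quotient_space G (Leib K G br)"

definition Lie_proj ::
  "('k, 'x) ring_scheme \<Rightarrow> ('k, 'g, 'p) module_scheme \<Rightarrow> ('g \<Rightarrow> 'g \<Rightarrow> 'g) \<Rightarrow> 'g \<Rightarrow> 'g set" where
  "Lie_proj K G br x = Leib K G br +>\<^bsub>G\<^esub> x"

definition Lie_bracket ::
  "('k, 'x) ring_scheme \<Rightarrow> ('k, 'g, 'p) module_scheme \<Rightarrow> ('g \<Rightarrow> 'g \<Rightarrow> 'g)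
    \<Rightarrow> 'g set \<Rightarrow> 'g set \<Rightarrow> 'g set" where
  "Lie_bracket K G br P Q = (\<Union>x\<in>P. \<Union>y\<in>Q. Lie_proj K G br (br x y))"

text \<open>The induced representation: the value of \<open>rL x v\<close> is the same for all
  representatives \<open>x\<close> of the coset \<open>P\<close>.\<close>

definition Lie_action :: "('g \<Rightarrow> 'v \<Rightarrow> 'v) \<Rightarrow> 'g set \<Rightarrow> 'v \<Rightarrow> 'v" where
  "Lie_action rL P v = the_elem ((\<lambda>x. rL x v) ` P)"

section \<open>Cochain complexes and their cohomology\<close>

record ('k, 'c) cochain_complex =
  cochains :: "nat \<Rightarrow> ('k, 'c) module"
  cobd :: "nat \<Rightarrow> 'c \<Rightarrow> 'c"

definition cocycles :: "('k, 'c) cochain_complex \<Rightarrow> nat \<Rightarrow> 'c set" where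
  "cocycles C n =
     {f \<in> carrier (cochains C n). cobd C n f = \<zero>\<^bsub>cochains C (Suc n)\<^esub>}"

text \<open>There are no cochains in negative degrees.\<close>

fun coboundaries :: "('k, 'c) cochain_complex \<Rightarrow> nat \<Rightarrow> 'c set" where
  "coboundaries C 0 = {\<zero>\<^bsub>cochains C 0\<^esub>}"
| "coboundaries C (Suc n) = cobd C n ` carrier (cochains C n)"

definition cohomology :: "('k, 'c) cochain_complex \<Rightarrow> nat \<Rightarrow> ('k, 'c set) module" where
  "cohomology C n =
     quotient_space ((cochains C n)\<lparr>carrier := cocycles C n\<rparr>) (coboundaries C n)"

definition cohomology_class :: "('k, 'c) cochain_complex \<Rightarrow> nat \<Rightarrow> 'c \<Rightarrow> 'c set" where
  "cohomology_class C n f = coboundaries C n +>\<^bsub>cochains C n\<^esub> f"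

text \<open>The next two maps are defined as the union of the classes obtained from all choices (of a
  representative; of a representative and its preimages). As distinct classes are disjoint, such a
  union is again a class only if a choice exists and all choices give the same class.\<close>

definition cohomology_map ::
  "('k, 'd) cochain_complex \<Rightarrow> nat \<Rightarrow> ('c \<Rightarrow> 'd) \<Rightarrow> 'c set \<Rightarrow> 'd set" where
  "cohomology_map D n \<phi> P = (\<Union>f\<in>P. cohomology_class D n (\<phi> f))"

definition connecting_map ::
  "('k, 'a) cochain_complex \<Rightarrow> ('k, 'b) cochain_complex \<Rightarrow> (nat \<Rightarrow> 'a \<Rightarrow> 'b) \<Rightarrow> (nat \<Rightarrow> 'b \<Rightarrow> 'c)
    \<Rightarrow> nat \<Rightarrow> 'c set \<Rightarrow> 'a set" where
  "connecting_map A B \<alpha> \<beta> n P =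
     \<Union>{cohomology_class A (Suc n) g | g f h.
         h \<in> P \<and> f \<in> carrier (cochains B n) \<and> \<beta> n f = h \<and>
         g \<in> carrier (cochains A (Suc n)) \<and> \<alpha> (Suc n) g = cobd B n f}"

text \<open>Exactness at \<open>B\<close> of a sequence \<open>A \<rightarrow> B \<rightarrow> C\<close> of vector spaces and linear maps.\<close>

definition exact_at ::
  "('k, 'x) ring_scheme \<Rightarrow> ('k, 'a, 'p) module_scheme \<Rightarrow> ('a \<Rightarrow> 'b) \<Rightarrow> ('k, 'b, 'q) module_scheme
    \<Rightarrow> ('b \<Rightarrow> 'c) \<Rightarrow> ('k, 'c, 'r) module_scheme \<Rightarrow> bool" where
  "exact_at K A f B g C \<longleftrightarrow>
     linear_map K A B f \<and> linear_map K B C g \<and>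
     f ` carrier A = {y \<in> carrier B. g y = \<zero>\<^bsub>C\<^esub>}"

section \<open>The Loday-Pirashvili complex\<close>

text \<open>The space \<open>Hom(\<otimes>\<^sup>n A, M)\<close> is rendered as the space of \<open>n\<close>-linear maps. Arguments are lists of
  length \<open>n\<close>, and the maps are extensional, i.e. undefined outside their domain.\<close>

definition tuples :: "('k, 'a, 'p) module_scheme \<Rightarrow> nat \<Rightarrow> 'a list set" where
  "tuples A n = {xs. length xs = n \<and> set xs \<subseteq> carrier A}"

definition multilinear_maps ::
  "('k, 'x) ring_scheme \<Rightarrow> ('k, 'a, 'p) module_scheme \<Rightarrow> ('k, 'm, 'q) module_scheme
    \<Rightarrow> nat \<Rightarrow> ('a list \<Rightarrow> 'm) set" where
  "multilinear_maps K A M n =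
     {f \<in> tuples A n \<rightarrow>\<^sub>E carrier M.
       \<forall>xs\<in>tuples A n. \<forall>i<n. (\<lambda>v. f (xs[i := v])) \<in> LinearCombinations.module_hom K A M}"

definition multilinear_space ::
  "('k, 'x) ring_scheme \<Rightarrow> ('k, 'a, 'p) module_scheme \<Rightarrow> ('k, 'm, 'q) module_scheme
    \<Rightarrow> nat \<Rightarrow> ('k, 'a list \<Rightarrow> 'm) module" where
  "multilinear_space K A M n =
     \<lparr>carrier = multilinear_maps K A M n,
      monoid.mult = (\<lambda>_ _. \<lambda>xs\<in>tuples A n. \<zero>\<^bsub>M\<^esub>), one = (\<lambda>xs\<in>tuples A n. \<zero>\<^bsub>M\<^esub>),
      zero = (\<lambda>xs\<in>tuples A n. \<zero>\<^bsub>M\<^esub>),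
      add = (\<lambda>f g. \<lambda>xs\<in>tuples A n. f xs \<oplus>\<^bsub>M\<^esub> g xs),
      smult = (\<lambda>a f. \<lambda>xs\<in>tuples A n. a \<odot>\<^bsub>M\<^esub> f xs)\<rparr>"

definition pushforward ::
  "('k, 'a, 'p) module_scheme \<Rightarrow> ('m \<Rightarrow> 'l) \<Rightarrow> nat \<Rightarrow> ('a list \<Rightarrow> 'm) \<Rightarrow> 'a list \<Rightarrow> 'l" where
  "pushforward A \<phi> n f = (\<lambda>xs\<in>tuples A n. \<phi> (f xs))"

definition signed :: "('k, 'm, 'q) module_scheme \<Rightarrow> nat \<Rightarrow> 'm \<Rightarrow> 'm" where
  "signed M i x = (if even i then x else \<ominus>\<^bsub>M\<^esub> x)"

definition omit :: "nat \<Rightarrow> 'a list \<Rightarrow> 'a list" where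
  "omit i xs = take i xs @ drop (Suc i) xs"

text \<open>List positions start at \<open>0\<close>: the index \<open>i\<close> below is the usual one minus \<open>1\<close>, so that the signs
  of the two sums are \<open>(-1)^i\<close> and \<open>(-1)^(i+1)\<close> here.\<close>

definition lp_coboundary ::
  "('k, 'a, 'p) module_scheme \<Rightarrow> ('a \<Rightarrow> 'a \<Rightarrow> 'a) \<Rightarrow> ('k, 'm, 'q) module_scheme
    \<Rightarrow> ('a \<Rightarrow> 'm \<Rightarrow> 'm) \<Rightarrow> ('a \<Rightarrow> 'm \<Rightarrow> 'm) \<Rightarrow> nat \<Rightarrow> ('a list \<Rightarrow> 'm) \<Rightarrow> 'a list \<Rightarrow> 'm" where
  "lp_coboundary A br M rL rR k f = (\<lambda>xs\<in>tuples A (Suc k).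
     (\<Oplus>\<^bsub>M\<^esub>i\<in>{..<k}. signed M i (rL (xs ! i) (f (omit i xs))))
     \<oplus>\<^bsub>M\<^esub> signed M (k + 1) (rR (xs ! k) (f (take k xs)))
     \<oplus>\<^bsub>M\<^esub> (\<Oplus>\<^bsub>M\<^esub>i\<in>{..k}. \<Oplus>\<^bsub>M\<^esub>j\<in>{i<..k}.
           signed M (i + 1) (f (omit i (xs[j := br (xs ! i) (xs ! j)])))))"

definition lp_complex ::
  "('k, 'x) ring_scheme \<Rightarrow> ('k, 'a, 'p) module_scheme \<Rightarrow> ('a \<Rightarrow> 'a \<Rightarrow> 'a)
    \<Rightarrow> ('k, 'm, 'q) module_scheme \<Rightarrow> ('a \<Rightarrow> 'm \<Rightarrow> 'm) \<Rightarrow> ('a \<Rightarrow> 'm \<Rightarrow> 'm)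
    \<Rightarrow> ('k, 'a list \<Rightarrow> 'm) cochain_complex" where
  "lp_complex K A br M rL rR =
     \<lparr>cochains = multilinear_space K A M, cobd = lp_coboundary A br M rL rR\<rparr>"

section \<open>The complexes attached to a relative Rota-Baxter operator\<close>

definition induced_bracket ::
  "('k, 'v, 'q) module_scheme \<Rightarrow> ('g \<Rightarrow> 'v \<Rightarrow> 'v) \<Rightarrow> ('g \<Rightarrow> 'v \<Rightarrow> 'v) \<Rightarrow> ('v \<Rightarrow> 'g)
    \<Rightarrow> 'v \<Rightarrow> 'v \<Rightarrow> 'v" where
  "induced_bracket V rL rR T u v = rL (T u) v \<oplus>\<^bsub>V\<^esub> rR (T v) u"

definition induced_left ::
  "('k, 'g, 'p) module_scheme \<Rightarrow> ('g \<Rightarrow> 'g \<Rightarrow> 'g) \<Rightarrow> ('g \<Rightarrow> 'v \<Rightarrow> 'v) \<Rightarrow> ('v \<Rightarrow> 'g)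
    \<Rightarrow> 'v \<Rightarrow> 'g \<Rightarrow> 'g" where
  "induced_left G br rR T u x = br (T u) x \<ominus>\<^bsub>G\<^esub> T (rR x u)"

definition induced_right ::
  "('k, 'g, 'p) module_scheme \<Rightarrow> ('g \<Rightarrow> 'g \<Rightarrow> 'g) \<Rightarrow> ('g \<Rightarrow> 'v \<Rightarrow> 'v) \<Rightarrow> ('v \<Rightarrow> 'g)
    \<Rightarrow> 'v \<Rightarrow> 'g \<Rightarrow> 'g" where
  "induced_right G br rL T u x = br x (T u) \<ominus>\<^bsub>G\<^esub> T (rL x u)"

definition rb_complex ::
  "('k, 'x) ring_scheme \<Rightarrow> ('k, 'g, 'p) module_scheme \<Rightarrow> ('g \<Rightarrow> 'g \<Rightarrow> 'g)
    \<Rightarrow> ('k, 'v, 'q) module_scheme \<Rightarrow> ('g \<Rightarrow> 'v \<Rightarrow> 'v) \<Rightarrow> ('g \<Rightarrow> 'v \<Rightarrow> 'v) \<Rightarrow> ('v \<Rightarrow> 'g)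
    \<Rightarrow> ('k, 'v list \<Rightarrow> 'g) cochain_complex" where
  "rb_complex K G br V rL rR T =
     lp_complex K V (induced_bracket V rL rR T) G (induced_left G br rR T) (induced_right G br rL T)"

definition rb_Leib_complex ::
  "('k, 'x) ring_scheme \<Rightarrow> ('k, 'g, 'p) module_scheme \<Rightarrow> ('g \<Rightarrow> 'g \<Rightarrow> 'g)
    \<Rightarrow> ('k, 'v, 'q) module_scheme \<Rightarrow> ('g \<Rightarrow> 'v \<Rightarrow> 'v) \<Rightarrow> ('g \<Rightarrow> 'v \<Rightarrow> 'v) \<Rightarrow> ('v \<Rightarrow> 'g)
    \<Rightarrow> ('k, 'v list \<Rightarrow> 'g) cochain_complex" where
  "rb_Leib_complex K G br V rL rR T =
     lp_complex K V (induced_bracket V rL rR T) (G\<lparr>carrier := Leib K G br\<rparr>)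
       (induced_left G br rR T) (induced_right G br rL T)"

text \<open>The complex of a relative averaging operator \<open>T\<close> on a Lie algebra \<open>L\<close> with respect to a
  representation \<open>\<rho>\<close>: the latter is viewed as the antisymmetric representation \<open>(V; \<rho>, 0)\<close>.\<close>

definition ao_complex ::
  "('k, 'x) ring_scheme \<Rightarrow> ('k, 'l, 'p) module_scheme \<Rightarrow> ('l \<Rightarrow> 'l \<Rightarrow> 'l)
    \<Rightarrow> ('k, 'v, 'q) module_scheme \<Rightarrow> ('l \<Rightarrow> 'v \<Rightarrow> 'v) \<Rightarrow> ('v \<Rightarrow> 'l)
    \<Rightarrow> ('k, 'v list \<Rightarrow> 'l) cochain_complex" where
  "ao_complex K L br V \<rho> T = rb_complex K L br V \<rho> (\<lambda>_ _. \<zero>\<^bsub>V\<^esub>) T"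

end

theory Submission
  imports Defs
begin

text \<open>Composition with the inclusion \<open>Leib(G) \<rightarrow> G\<close> and with \<open>pr\<close> gives a short exact sequence of
  cochain complexes, whose long exact sequence is the one claimed. Surjectivity of \<open>\<beta>\<^sub>V\<close> comes from a
  linear section of \<open>pr\<close>; compatibility with the coboundaries comes from the fact that elements of
  \<open>Leib(G)\<close> bracket to zero from the left and act by zero through \<open>\<rho>\<^sup>L\<close>. That \<open>\<partial>\<^sub>T\<close> squares to zero
  is proved through the Cartan identities \<open>\<iota>\<^sub>x \<partial> = L\<^sub>x - \<partial> \<iota>\<^sub>x\<close> and \<open>L\<^sub>x \<partial> = \<partial> L\<^sub>x\<close>; the complexes with
  coefficients in \<open>Leib(G)\<close> and \<open>G\<^sub>L\<^sub>i\<^sub>e\<close> inherit it by injectivity and surjectivity.\<close>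

section \<open>Linear maps and quotients\<close>

lemma module_homI:
  assumes "\<And>x. x \<in> carrier M \<Longrightarrow> f x \<in> carrier N"
    and "\<And>x y. x \<in> carrier M \<Longrightarrow> y \<in> carrier M \<Longrightarrow> f (x \<oplus>\<^bsub>M\<^esub> y) = f x \<oplus>\<^bsub>N\<^esub> f y"
    and "\<And>a x. a \<in> carrier K \<Longrightarrow> x \<in> carrier M \<Longrightarrow> f (a \<odot>\<^bsub>M\<^esub> x) = a \<odot>\<^bsub>N\<^esub> f x"
  shows "f \<in> LinearCombinations.module_hom K M N"
  using assms by (auto simp: LinearCombinations.module_hom_def)

lemma module_hom_carrier:
  "f \<in> LinearCombinations.module_hom K M N \<Longrightarrow> x \<in> carrier M \<Longrightarrow> f x \<in> carrier N"
  by (auto simp: LinearCombinations.module_hom_def)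

lemma module_hom_comp:
  assumes "f \<in> LinearCombinations.module_hom K A B" "g \<in> LinearCombinations.module_hom K B C"
  shows "(\<lambda>x. g (f x)) \<in> LinearCombinations.module_hom K A C"
  using assms by (auto simp: LinearCombinations.module_hom_def Pi_iff)

lemma module_hom_cong:
  assumes "f \<in> LinearCombinations.module_hom K M N" "module K M"
    and "\<And>x. x \<in> carrier M \<Longrightarrow> g x = f x"
  shows "g \<in> LinearCombinations.module_hom K M N"
proof -
  interpret module K M by fact
  show ?thesis
    using assms(1,3) by (auto intro!: module_homI simp: LinearCombinations.module_hom_def)
qed

lemma linear_mapI:
  assumes "vectorspace K M" "vectorspace K N" "f \<in> LinearCombinations.module_hom K M N"
  shows "linear_map K M N f"
  using assms by (simp add: linear_map_def mod_hom_def mod_hom_axioms_def vectorspace_def)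

lemma vectorspace_surj_image:
  assumes "vectorspace K M" and img: "p ` carrier M = carrier Q"
    and add: "\<And>x y. x \<in> carrier M \<Longrightarrow> y \<in> carrier M \<Longrightarrow> p (x \<oplus>\<^bsub>M\<^esub> y) = p x \<oplus>\<^bsub>Q\<^esub> p y"
    and smult: "\<And>a x. a \<in> carrier K \<Longrightarrow> x \<in> carrier M \<Longrightarrow> p (a \<odot>\<^bsub>M\<^esub> x) = a \<odot>\<^bsub>Q\<^esub> p x"
    and zero: "p \<zero>\<^bsub>M\<^esub> = \<zero>\<^bsub>Q\<^esub>"
  shows "vectorspace K Q"
proof -
  interpret M: vectorspace K M by fact
  note [simp] = add[symmetric] smult[symmetric] zero[symmetric]
  show ?thesis
  proof (rule vs_criteria, unfold img[symmetric], safe)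
    fix x assume x: "x \<in> carrier M"
    show "\<exists>y\<in>p ` carrier M. p x \<oplus>\<^bsub>Q\<^esub> y = \<zero>\<^bsub>Q\<^esub>"
      using x by (intro bexI[of _ "p (\<ominus>\<^bsub>M\<^esub> x)"]) (auto simp: M.M.r_neg)
  qed (auto simp: M.field_axioms M.M.a_ac M.smult_l_distr M.smult_r_distr M.smult_assoc1)
qed

context
  fixes K :: "('k, 'x) ring_scheme" and M :: "('k, 'm, 'p) module_scheme" and N
  assumes sub: "subspace K N M"
begin

interpretation M: vectorspace K M
  using sub by (simp add: subspace_def)

interpretation N: LinearCombinations.submodule K N M
  using sub by (simp add: subspace_def)

lemma subspace_a_inv: "x \<in> N \<Longrightarrow> \<ominus>\<^bsub>M\<^esub> x \<in> N"
  using N.smult_closed[of "\<ominus>\<^bsub>K\<^esub> \<one>\<^bsub>K\<^esub>" x] subsetD[OF N.subset, of x]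
    M.smult_l_minus[of "\<one>\<^bsub>K\<^esub>" x] by simp

lemma subspace_abelian_subgroup: "abelian_subgroup N M"
proof (intro abelian_subgroupI3 additive_subgroup.intro M.M.add.subgroupI)
  show "N \<subseteq> carrier M" by (rule N.subset)
  show "abelian_group M" ..
qed (use subspace_a_inv in \<open>auto simp: a_inv_def intro: N.zero_closed\<close>)

interpretation N: abelian_subgroup N M
  by (rule subspace_abelian_subgroup)

lemma coset_eq_iff:
  assumes "x \<in> carrier M" "y \<in> carrier M"
  shows "N +>\<^bsub>M\<^esub> x = N +>\<^bsub>M\<^esub> y \<longleftrightarrow> x \<ominus>\<^bsub>M\<^esub> y \<in> N"
  using assms N.a_rcos_module[of y x] N.a_rcos_self[of x] N.a_repr_independence'[of x y]
  by (auto simp: a_minus_def)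

lemma mem_coset_iff:
  assumes "x \<in> carrier M"
  shows "y \<in> N +>\<^bsub>M\<^esub> x \<longleftrightarrow> y \<in> carrier M \<and> N +>\<^bsub>M\<^esub> y = N +>\<^bsub>M\<^esub> x"
  using assms N.a_rcos_self[of y] N.a_repr_independence'[of y x]
    M.M.a_r_coset_subset_G[OF N.subset assms] by auto

lemma quotient_carrier: "carrier (quotient_space M N) = (\<lambda>x. N +>\<^bsub>M\<^esub> x) ` carrier M"
  by (auto simp: quotient_space_def A_RCOSETS_def')

lemma quotient_zero: "N +>\<^bsub>M\<^esub> \<zero>\<^bsub>M\<^esub> = \<zero>\<^bsub>quotient_space M N\<^esub>"
  using M.M.a_coset_add_zero[OF N.subset] by (simp add: quotient_space_def)

lemma quotient_smult:
  assumes a: "a \<in> carrier K" and x: "x \<in> carrier M"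
  shows "N +>\<^bsub>M\<^esub> (a \<odot>\<^bsub>M\<^esub> x) = a \<odot>\<^bsub>quotient_space M N\<^esub> (N +>\<^bsub>M\<^esub> x)"
proof -
  have "N +>\<^bsub>M\<^esub> (a \<odot>\<^bsub>M\<^esub> y) = N +>\<^bsub>M\<^esub> (a \<odot>\<^bsub>M\<^esub> x)" if "y \<in> N +>\<^bsub>M\<^esub> x" for y
  proof -
    have y: "y \<in> carrier M" "y \<ominus>\<^bsub>M\<^esub> x \<in> N"
      using that x by (auto simp: mem_coset_iff coset_eq_iff)
    have "a \<odot>\<^bsub>M\<^esub> y \<ominus>\<^bsub>M\<^esub> a \<odot>\<^bsub>M\<^esub> x = a \<odot>\<^bsub>M\<^esub> (y \<ominus>\<^bsub>M\<^esub> x)"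
      using a x y by (simp add: a_minus_def M.smult_r_distr M.smult_r_minus)
    then show ?thesis
      using a x y by (simp add: coset_eq_iff)
  qed
  then have "(\<Union>y\<in>N +>\<^bsub>M\<^esub> x. N +>\<^bsub>M\<^esub> (a \<odot>\<^bsub>M\<^esub> y)) = N +>\<^bsub>M\<^esub> (a \<odot>\<^bsub>M\<^esub> x)"
    using N.a_rcos_self[OF x] by (intro SUP_eq_const) blast+
  then show ?thesis
    by (simp add: quotient_space_def)
qed

lemma quotient_add:
  assumes "x \<in> carrier M" "y \<in> carrier M"
  shows "N +>\<^bsub>M\<^esub> (x \<oplus>\<^bsub>M\<^esub> y) = (N +>\<^bsub>M\<^esub> x) \<oplus>\<^bsub>quotient_space M N\<^esub> (N +>\<^bsub>M\<^esub> y)"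
  using assms by (simp add: quotient_space_def N.a_rcos_sum)

lemma quotient_vectorspace: "vectorspace K (quotient_space M N)"
  by (rule vectorspace_surj_image[OF M.vectorspace_axioms, where p = "\<lambda>x. N +>\<^bsub>M\<^esub> x"])
    (auto simp: quotient_carrier quotient_add quotient_smult quotient_zero)

lemma quotient_proj_hom:
  "(\<lambda>x. N +>\<^bsub>M\<^esub> x) \<in> LinearCombinations.module_hom K M (quotient_space M N)"
  by (rule module_homI) (auto simp: quotient_carrier quotient_add quotient_smult)

text \<open>The induction adjoins the elements of a finite generating set one at a time to a subspace
  that meets \<open>N\<close> trivially.\<close>

lemma subspace_complement:
  assumes "M.fin_dim"
  obtains W where "subspace K W M" "W \<inter> N = {\<zero>\<^bsub>M\<^esub>}"
    "\<And>x. x \<in> carrier M \<Longrightarrow> \<exists>w\<in>W. \<exists>y\<in>N. x = w \<oplus>\<^bsub>M\<^esub> y"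
proof -
  obtain S where S: "finite S" "S \<subseteq> carrier M" "M.span S = carrier M"
    using assms by (auto simp: M.fin_dim_def)
  have "\<exists>W. subspace K W M \<and> W \<inter> N = {\<zero>\<^bsub>M\<^esub>} \<and> (\<forall>x\<in>S. \<exists>w\<in>W. \<exists>y\<in>N. x = w \<oplus>\<^bsub>M\<^esub> y)"
    using S(1,2)
  proof (induction S)
    case empty
    have "subspace K {\<zero>\<^bsub>M\<^esub>} M"
      by (simp add: subspace_def M.vectorspace_axioms LinearCombinations.submodule_def M.module_axioms)
    then show ?case
      by (intro exI[of _ "{\<zero>\<^bsub>M\<^esub>}"]) auto
  next
    case (insert s S)
    then obtain W where W: "subspace K W M" "W \<inter> N = {\<zero>\<^bsub>M\<^esub>}"
      and S: "\<And>x. x \<in> S \<Longrightarrow> \<exists>w\<in>W. \<exists>y\<in>N. x = w \<oplus>\<^bsub>M\<^esub> y"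
      by auto
    have s: "s \<in> carrier M" using insert by auto
    interpret W: LinearCombinations.submodule K W M
      using W(1) by (simp add: subspace_def)
    show ?case
    proof (cases "\<exists>w\<in>W. \<exists>y\<in>N. s = w \<oplus>\<^bsub>M\<^esub> y")
      case True
      then show ?thesis using W S by (intro exI[of _ W]) auto
    next
      case False
      define U where "U = {w \<oplus>\<^bsub>M\<^esub> a \<odot>\<^bsub>M\<^esub> s | w a. w \<in> W \<and> a \<in> carrier K}"
      have UI: "w \<oplus>\<^bsub>M\<^esub> a \<odot>\<^bsub>M\<^esub> s \<in> U" if "w \<in> W" "a \<in> carrier K" for w a
        using that by (auto simp: U_def)
      note Wc = subsetD[OF W.subset] and Nc = subsetD[OF N.subset]
      have WU: "W \<subseteq> U"
      proof
        fix w assume "w \<in> W"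
        then show "w \<in> U" using UI[of w "\<zero>\<^bsub>K\<^esub>"] s Wc by simp
      qed
      have "subspace K U M"
        unfolding subspace_def
      proof (intro conjI LinearCombinations.submodule.intro)
        show "vectorspace K M" "module K M" by unfold_locales
        show "U \<subseteq> carrier M" using Wc s by (auto simp: U_def)
        show "\<zero>\<^bsub>M\<^esub> \<in> U" using WU W.zero_closed by auto
      next
        fix u v assume "u \<in> U" "v \<in> U"
        then obtain w a w' a' where uv: "w \<in> W" "a \<in> carrier K" "u = w \<oplus>\<^bsub>M\<^esub> a \<odot>\<^bsub>M\<^esub> s"
          "w' \<in> W" "a' \<in> carrier K" "v = w' \<oplus>\<^bsub>M\<^esub> a' \<odot>\<^bsub>M\<^esub> s" by (auto simp: U_def)
        then have "u \<oplus>\<^bsub>M\<^esub> v = (w \<oplus>\<^bsub>M\<^esub> w') \<oplus>\<^bsub>M\<^esub> (a \<oplus>\<^bsub>K\<^esub> a') \<odot>\<^bsub>M\<^esub> s"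
          using s Wc by (simp add: M.smult_l_distr M.M.a_ac)
        then show "u \<oplus>\<^bsub>M\<^esub> v \<in> U" using uv by (auto intro!: UI)
      next
        fix c u assume "c \<in> carrier K" "u \<in> U"
        then obtain w a where uv: "w \<in> W" "a \<in> carrier K" "u = w \<oplus>\<^bsub>M\<^esub> a \<odot>\<^bsub>M\<^esub> s"
          "c \<in> carrier K" by (auto simp: U_def)
        then have "c \<odot>\<^bsub>M\<^esub> u = c \<odot>\<^bsub>M\<^esub> w \<oplus>\<^bsub>M\<^esub> (c \<otimes>\<^bsub>K\<^esub> a) \<odot>\<^bsub>M\<^esub> s"
          using s Wc by (simp add: M.smult_r_distr M.smult_assoc1)
        then show "c \<odot>\<^bsub>M\<^esub> u \<in> U" using uv by (auto intro!: UI)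
      qed
      moreover have trivial: "u = \<zero>\<^bsub>M\<^esub>" if u: "u \<in> U" "u \<in> N" for u
      proof -
        obtain w a where wa: "w \<in> W" "a \<in> carrier K" "u = w \<oplus>\<^bsub>M\<^esub> a \<odot>\<^bsub>M\<^esub> s"
          using u by (auto simp: U_def)
        show ?thesis
        proof (cases "a = \<zero>\<^bsub>K\<^esub>")
          case True
          then have "u \<in> W" using wa Wc s by simp
          then show ?thesis using W(2) u by auto
        next
          case F: False
          define b where "b = inv\<^bsub>K\<^esub> a"
          have b: "b \<in> carrier K" "b \<otimes>\<^bsub>K\<^esub> a = \<one>\<^bsub>K\<^esub>"
            using F wa M.field_Units by (auto simp: b_def)
          have "b \<odot>\<^bsub>M\<^esub> u = b \<odot>\<^bsub>M\<^esub> w \<oplus>\<^bsub>M\<^esub> s"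
            using wa b s Wc by (simp add: M.smult_r_distr M.smult_assoc1[symmetric])
          then have "s = (\<ominus>\<^bsub>M\<^esub> (b \<odot>\<^bsub>M\<^esub> w)) \<oplus>\<^bsub>M\<^esub> b \<odot>\<^bsub>M\<^esub> u"
            using wa b s Wc by (simp add: M.M.r_neg1)
          moreover have "\<ominus>\<^bsub>M\<^esub> (b \<odot>\<^bsub>M\<^esub> w) = (\<ominus>\<^bsub>K\<^esub> b) \<odot>\<^bsub>M\<^esub> w"
            using wa b Wc by (simp add: M.smult_l_minus)
          then have "\<ominus>\<^bsub>M\<^esub> (b \<odot>\<^bsub>M\<^esub> w) \<in> W" using wa b by simp
          moreover have "b \<odot>\<^bsub>M\<^esub> u \<in> N" using b u by simp
          ultimately show ?thesis using False by blast
        qed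
      qed
      moreover have zero: "\<zero>\<^bsub>M\<^esub> \<in> U" using WU W.zero_closed by auto
      moreover have "\<forall>x\<in>insert s S. \<exists>w\<in>U. \<exists>y\<in>N. x = w \<oplus>\<^bsub>M\<^esub> y"
      proof
        fix x assume "x \<in> insert s S"
        then consider "x \<in> S" | "x = s" by blast
        then show "\<exists>w\<in>U. \<exists>y\<in>N. x = w \<oplus>\<^bsub>M\<^esub> y"
        proof cases
          case 1
          then obtain w y where "w \<in> W" "y \<in> N" "x = w \<oplus>\<^bsub>M\<^esub> y" using S by blast
          then show ?thesis using subsetD[OF WU] by metis
        next
          case 2
          have "(\<zero>\<^bsub>M\<^esub> \<oplus>\<^bsub>M\<^esub> \<one>\<^bsub>K\<^esub> \<odot>\<^bsub>M\<^esub> s) \<oplus>\<^bsub>M\<^esub> \<zero>\<^bsub>M\<^esub> = s" using s by simp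
          then show ?thesis
            using UI[OF W.zero_closed M.R.one_closed] N.zero_closed 2 by metis
        qed
      qed
      moreover have "U \<inter> N = {\<zero>\<^bsub>M\<^esub>}"
        using trivial zero N.zero_closed by blast
      ultimately show ?thesis
        by (intro exI[of _ U] conjI)
    qed
  qed
  then obtain W where W: "subspace K W M" "W \<inter> N = {\<zero>\<^bsub>M\<^esub>}"
    and sW: "\<And>x. x \<in> S \<Longrightarrow> \<exists>w\<in>W. \<exists>y\<in>N. x = w \<oplus>\<^bsub>M\<^esub> y" by blast
  have "subspace K (M.subspace_sum W N) M"
    by (rule M.sum_is_subspace[OF W(1) sub])
  then have "M.span S \<subseteq> M.subspace_sum W N"
    using sW by (intro M.span_is_subset) (force simp: subspace_def M.submodule_sum_def)+
  then have "\<exists>w\<in>W. \<exists>y\<in>N. x = w \<oplus>\<^bsub>M\<^esub> y" if "x \<in> carrier M" for x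
    using that unfolding S(3) by (force simp: M.submodule_sum_def)
  then show ?thesis
    using W by (rule that[rotated 2])
qed

lemma quotient_section:
  assumes "M.fin_dim"
  obtains s where "s \<in> LinearCombinations.module_hom K (quotient_space M N) M"
    "\<And>P. P \<in> carrier (quotient_space M N) \<Longrightarrow> N +>\<^bsub>M\<^esub> s P = P"
proof -
  let ?Q = "quotient_space M N"
  obtain W where W: "subspace K W M" "W \<inter> N = {\<zero>\<^bsub>M\<^esub>}"
    "\<And>x. x \<in> carrier M \<Longrightarrow> \<exists>w\<in>W. \<exists>y\<in>N. x = w \<oplus>\<^bsub>M\<^esub> y"
    using subspace_complement[OF assms] by blast
  interpret W: LinearCombinations.submodule K W M
    using W(1) by (simp add: subspace_def)
  note Wc = subsetD[OF W.subset] and Nc = subsetD[OF N.subset]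
  define s where "s P = (SOME w. w \<in> W \<and> N +>\<^bsub>M\<^esub> w = P)" for P
  have s: "s P \<in> W \<and> N +>\<^bsub>M\<^esub> s P = P" if P: "P \<in> carrier ?Q" for P
  proof -
    obtain x where x: "x \<in> carrier M" "P = N +>\<^bsub>M\<^esub> x" using P by (auto simp: quotient_carrier)
    obtain w y where wy: "w \<in> W" "y \<in> N" "x = w \<oplus>\<^bsub>M\<^esub> y" using W(3)[OF x(1)] by blast
    then have "x \<ominus>\<^bsub>M\<^esub> w = y"
      using Wc[OF wy(1)] Nc[OF wy(2)] by (simp add: a_minus_def M.M.a_comm M.M.r_neg1)
    then have "N +>\<^bsub>M\<^esub> x = N +>\<^bsub>M\<^esub> w"
      using wy(2) coset_eq_iff[OF x(1) Wc[OF wy(1)]] by simp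
    then have "N +>\<^bsub>M\<^esub> w = P" using x(2) by simp
    then show ?thesis
      unfolding s_def using someI[of "\<lambda>w. w \<in> W \<and> N +>\<^bsub>M\<^esub> w = P" w] wy by blast
  qed
  have uniq: "v = w" if "v \<in> W" "w \<in> W" "N +>\<^bsub>M\<^esub> v = N +>\<^bsub>M\<^esub> w" for v w
  proof -
    have "v \<ominus>\<^bsub>M\<^esub> w \<in> N" using that Wc by (simp add: coset_eq_iff)
    moreover have "v \<ominus>\<^bsub>M\<^esub> w \<in> W"
      using that Wc W.smult_closed[of "\<ominus>\<^bsub>K\<^esub> \<one>\<^bsub>K\<^esub>" w] M.smult_l_minus[of "\<one>\<^bsub>K\<^esub>" w]
      by (simp add: a_minus_def)
    ultimately have "v \<ominus>\<^bsub>M\<^esub> w = \<zero>\<^bsub>M\<^esub>" using W(2) by auto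
    moreover have "(v \<ominus>\<^bsub>M\<^esub> w) \<oplus>\<^bsub>M\<^esub> w = v"
      using that Wc by (simp add: a_minus_def M.M.a_assoc M.M.l_neg)
    ultimately show ?thesis using that Wc by simp
  qed
  interpret Q: vectorspace K ?Q by (rule quotient_vectorspace)
  have "s \<in> LinearCombinations.module_hom K ?Q M"
  proof (rule module_homI)
    fix P R assume PR: "P \<in> carrier ?Q" "R \<in> carrier ?Q"
    show "s (P \<oplus>\<^bsub>?Q\<^esub> R) = s P \<oplus>\<^bsub>M\<^esub> s R"
      using s[OF PR(1)] s[OF PR(2)] s[of "P \<oplus>\<^bsub>?Q\<^esub> R"] PR Wc by (intro uniq) (auto simp: quotient_add)
  next
    fix a P assume aP: "a \<in> carrier K" "P \<in> carrier ?Q"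
    show "s (a \<odot>\<^bsub>?Q\<^esub> P) = a \<odot>\<^bsub>M\<^esub> s P"
      using s[OF aP(2)] s[of "a \<odot>\<^bsub>?Q\<^esub> P"] aP Wc by (intro uniq) (auto simp: quotient_smult)
  qed (use s Wc in blast)
  then show ?thesis using s by (intro that[of s]) auto
qed

end

section \<open>The long exact sequence of a short exact sequence of complexes\<close>

lemma module_hom_zero:
  assumes "vectorspace K M" "vectorspace K N" "f \<in> LinearCombinations.module_hom K M N"
  shows "f \<zero>\<^bsub>M\<^esub> = \<zero>\<^bsub>N\<^esub>"
proof -
  interpret linear_map K M N f by (rule linear_mapI) fact+
  show ?thesis by simp
qed

lemma module_hom_minus:
  assumes "vectorspace K M" "vectorspace K N" "f \<in> LinearCombinations.module_hom K M N"
    and "x \<in> carrier M" "y \<in> carrier M"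
  shows "f (x \<ominus>\<^bsub>M\<^esub> y) = f x \<ominus>\<^bsub>N\<^esub> f y"
proof -
  interpret linear_map K M N f by (rule linear_mapI) fact+
  show ?thesis using assms(4,5) by simp
qed

lemma (in abelian_group) minus_zero [simp]: "x \<in> carrier G \<Longrightarrow> x \<ominus> \<zero> = x"
  by (simp add: a_minus_def)

lemma (in abelian_group) minus_self [simp]: "x \<in> carrier G \<Longrightarrow> x \<ominus> x = \<zero>"
  by (simp add: a_minus_def r_neg)

lemma (in abelian_group) minus_minus_cancel [simp]:
  "x \<in> carrier G \<Longrightarrow> y \<in> carrier G \<Longrightarrow> x \<ominus> (x \<ominus> y) = y"
  by (simp add: a_minus_def minus_add r_neg2)

lemma (in abelian_group) minus_eq_zero_iff:
  "x \<in> carrier G \<Longrightarrow> y \<in> carrier G \<Longrightarrow> x \<ominus> y = \<zero> \<longleftrightarrow> x = y"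
  by (metis minus_self minus_minus_cancel minus_zero)

lemma subspace_restrict:
  assumes "subspace K N M" "subspace K Z M" "N \<subseteq> Z"
  shows "subspace K N (M\<lparr>carrier := Z\<rparr>)"
proof -
  interpret Z: vectorspace K "M\<lparr>carrier := Z\<rparr>"
    using assms(2) vectorspace.subspace_is_vs by (auto simp: subspace_def)
  show ?thesis
    using assms Z.vectorspace_axioms Z.module_axioms
    by (auto simp: subspace_def LinearCombinations.submodule_def)
qed

locale cochain_complex_over =
  fixes K :: "('k, 'x) ring_scheme" and C :: "('k, 'c) cochain_complex"
  assumes cochains_vectorspace: "vectorspace K (cochains C n)"
    and cobd_hom: "cobd C n \<in> LinearCombinations.module_hom K (cochains C n) (cochains C (Suc n))"
    and cobd_cobd: "f \<in> carrier (cochains C n) \<Longrightarrow>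
      cobd C (Suc n) (cobd C n f) = \<zero>\<^bsub>cochains C (Suc (Suc n))\<^esub>"
begin

sublocale cochains: vectorspace K "cochains C n" for n
  by (rule cochains_vectorspace)

lemma cobd_linear: "linear_map K (cochains C n) (cochains C (Suc n)) (cobd C n)"
  by (intro linear_mapI cochains_vectorspace cobd_hom)

lemma cobd_closed: "f \<in> carrier (cochains C n) \<Longrightarrow> cobd C n f \<in> carrier (cochains C (Suc n))"
  using cobd_hom by (rule module_hom_carrier)

lemma cobd_minus:
  "f \<in> carrier (cochains C n) \<Longrightarrow> g \<in> carrier (cochains C n) \<Longrightarrow>
    cobd C n (f \<ominus>\<^bsub>cochains C n\<^esub> g) = cobd C n f \<ominus>\<^bsub>cochains C (Suc n)\<^esub> cobd C n g"
  by (rule module_hom_minus[OF cochains_vectorspace cochains_vectorspace cobd_hom])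

lemma cobd_zero: "cobd C n \<zero>\<^bsub>cochains C n\<^esub> = \<zero>\<^bsub>cochains C (Suc n)\<^esub>"
  by (rule module_hom_zero[OF cochains_vectorspace cochains_vectorspace cobd_hom])

lemma cocycles_subspace: "subspace K (cocycles C n) (cochains C n)"
proof -
  interpret d: linear_map K "cochains C n" "cochains C (Suc n)" "cobd C n" by (rule cobd_linear)
  show ?thesis using d.kerT_is_subspace by (simp add: d.ker_def cocycles_def)
qed

lemma coboundaries_subspace: "subspace K (coboundaries C n) (cochains C n)"
proof (cases n)
  case 0
  then show ?thesis
    by (simp add: subspace_def cochains_vectorspace LinearCombinations.submodule_def
        cochains.module_axioms)
next
  case (Suc m)
  interpret d: linear_map K "cochains C m" "cochains C (Suc m)" "cobd C m" by (rule cobd_linear)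
  show ?thesis using d.imT_is_subspace by (simp add: d.im_def Suc)
qed

lemma cocycles_carrier: "f \<in> cocycles C n \<Longrightarrow> f \<in> carrier (cochains C n)"
  by (simp add: cocycles_def)

lemma coboundaries_cocycles: "coboundaries C n \<subseteq> cocycles C n"
  by (cases n) (auto simp: cocycles_def cobd_cobd cobd_closed cobd_zero)

abbreviation "cocycle_space n \<equiv> (cochains C n)\<lparr>carrier := cocycles C n\<rparr>"

lemma cocycle_vectorspace: "vectorspace K (cocycle_space n)"
  using cocycles_subspace by (rule cochains.subspace_is_vs)

lemma coboundaries_cocycle_subspace: "subspace K (coboundaries C n) (cocycle_space n)"
  by (intro subspace_restrict coboundaries_subspace cocycles_subspace coboundaries_cocycles)

lemma cohomology_class_alt:
  "cohomology_class C n f = coboundaries C n +>\<^bsub>cocycle_space n\<^esub> f"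
  by (simp add: cohomology_class_def a_r_coset_def')

lemma cohomology_vectorspace: "vectorspace K (cohomology C n)"
  unfolding cohomology_def using coboundaries_cocycle_subspace by (rule quotient_vectorspace)

lemma cohomology_carrier: "carrier (cohomology C n) = cohomology_class C n ` cocycles C n"
  using quotient_carrier[OF coboundaries_cocycle_subspace]
  by (simp add: cohomology_def cohomology_class_alt image_def)

lemma cohomology_class_hom:
  "cohomology_class C n \<in> LinearCombinations.module_hom K (cocycle_space n) (cohomology C n)"
  using quotient_proj_hom[OF coboundaries_cocycle_subspace]
  by (simp add: cohomology_def cohomology_class_alt[abs_def])

lemma cohomology_class_eq_iff:
  assumes "f \<in> cocycles C n" "g \<in> cocycles C n"
  shows "cohomology_class C n f = cohomology_class C n g \<longleftrightarrow>
    f \<ominus>\<^bsub>cochains C n\<^esub> g \<in> coboundaries C n"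
  unfolding cohomology_class_def
  using assms by (intro coset_eq_iff[OF coboundaries_subspace] cocycles_carrier)

lemma mem_cohomology_class_iff:
  assumes "f \<in> cocycles C n"
  shows "g \<in> cohomology_class C n f \<longleftrightarrow>
    g \<in> cocycles C n \<and> cohomology_class C n g = cohomology_class C n f"
  using mem_coset_iff[OF coboundaries_cocycle_subspace, of f n g] assms
  by (simp add: cohomology_class_alt)

lemma cohomology_class_eq_zero_iff:
  assumes "f \<in> cocycles C n"
  shows "cohomology_class C n f = \<zero>\<^bsub>cohomology C n\<^esub> \<longleftrightarrow> f \<in> coboundaries C n"
proof -
  have z: "\<zero>\<^bsub>cochains C n\<^esub> \<in> cocycles C n"
    by (simp add: cocycles_def cobd_zero)
  have "cohomology_class C n \<zero>\<^bsub>cochains C n\<^esub> = \<zero>\<^bsub>cohomology C n\<^esub>"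
    using module_hom_zero[OF cocycle_vectorspace cohomology_vectorspace cohomology_class_hom] by simp
  then show ?thesis
    using cohomology_class_eq_iff[OF assms z] assms by (simp add: cocycles_carrier)
qed

lemma hom_from_cohomology:
  assumes "\<phi> \<in> LinearCombinations.module_hom K (cocycle_space n) W"
    and "\<And>f. f \<in> cocycles C n \<Longrightarrow> \<Phi> (cohomology_class C n f) = \<phi> f"
  shows "\<Phi> \<in> LinearCombinations.module_hom K (cohomology C n) W"
proof -
  interpret Z: vectorspace K "cocycle_space n" by (rule cocycle_vectorspace)
  note Zc = Z.M.add.m_closed[simplified] Z.smult_closed[simplified]
  note hom = LinearCombinations.module_hom_add[OF cohomology_class_hom, symmetric]
    LinearCombinations.module_hom_smult[OF cohomology_class_hom, symmetric]
    LinearCombinations.module_hom_add[OF assms(1)] LinearCombinations.module_hom_smult[OF assms(1)]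
    module_hom_carrier[OF assms(1)]
  show ?thesis
    by (rule module_homI, unfold cohomology_carrier) (auto simp: hom[simplified] assms(2) Zc)
qed

end

locale cochain_map = A: cochain_complex_over K A + B: cochain_complex_over K B
  for K :: "('k, 'x) ring_scheme" and A :: "('k, 'a) cochain_complex"
    and B :: "('k, 'b) cochain_complex" +
  fixes \<phi> :: "nat \<Rightarrow> 'a \<Rightarrow> 'b"
  assumes hom: "\<phi> n \<in> LinearCombinations.module_hom K (cochains A n) (cochains B n)"
    and chain: "f \<in> carrier (cochains A n) \<Longrightarrow> \<phi> (Suc n) (cobd A n f) = cobd B n (\<phi> n f)"
begin

lemma closed: "f \<in> carrier (cochains A n) \<Longrightarrow> \<phi> n f \<in> carrier (cochains B n)"
  using hom by (rule module_hom_carrier)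

lemma map_zero: "\<phi> n \<zero>\<^bsub>cochains A n\<^esub> = \<zero>\<^bsub>cochains B n\<^esub>"
  by (rule module_hom_zero[OF A.cochains_vectorspace B.cochains_vectorspace hom])

lemma map_minus:
  "f \<in> carrier (cochains A n) \<Longrightarrow> g \<in> carrier (cochains A n) \<Longrightarrow>
    \<phi> n (f \<ominus>\<^bsub>cochains A n\<^esub> g) = \<phi> n f \<ominus>\<^bsub>cochains B n\<^esub> \<phi> n g"
  by (rule module_hom_minus[OF A.cochains_vectorspace B.cochains_vectorspace hom])

lemma cocycle: "f \<in> cocycles A n \<Longrightarrow> \<phi> n f \<in> cocycles B n"
  using chain[of f n] by (auto simp: cocycles_def closed map_zero)

lemma coboundary: "f \<in> coboundaries A n \<Longrightarrow> \<phi> n f \<in> coboundaries B n"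
  by (cases n) (auto simp: map_zero chain closed)

lemma cohomology_map_class:
  assumes f: "f \<in> cocycles A n"
  shows "cohomology_map B n (\<phi> n) (cohomology_class A n f) = cohomology_class B n (\<phi> n f)"
proof -
  have "cohomology_class B n (\<phi> n g) = cohomology_class B n (\<phi> n f)"
    if "g \<in> cohomology_class A n f" for g
  proof -
    have g: "g \<in> cocycles A n" "g \<ominus>\<^bsub>cochains A n\<^esub> f \<in> coboundaries A n"
      using that f by (auto simp: A.mem_cohomology_class_iff A.cohomology_class_eq_iff)
    then show ?thesis
      using coboundary[OF g(2)] f
      by (simp add: B.cohomology_class_eq_iff cocycle map_minus A.cocycles_carrier)
  qed
  moreover have "f \<in> cohomology_class A n f"
    using f by (simp add: A.mem_cohomology_class_iff)
  ultimately show ?thesis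
    unfolding cohomology_map_def by (intro SUP_eq_const) blast+
qed

lemma cohomology_map_hom:
  "cohomology_map B n (\<phi> n) \<in>
    LinearCombinations.module_hom K (cohomology A n) (cohomology B n)"
proof (rule A.hom_from_cohomology[where \<phi> = "\<lambda>f. cohomology_class B n (\<phi> n f)"])
  have "\<phi> n \<in> LinearCombinations.module_hom K (A.cocycle_space n) (B.cocycle_space n)"
    using hom[of n] cocycle[of _ n] A.cocycles_carrier[of _ n]
    by (auto simp: LinearCombinations.module_hom_def)
  then show "(\<lambda>f. cohomology_class B n (\<phi> n f)) \<in>
    LinearCombinations.module_hom K (A.cocycle_space n) (cohomology B n)"
    using B.cohomology_class_hom by (rule module_hom_comp)
qed (rule cohomology_map_class)

lemma cohomology_map_linear:
  "linear_map K (cohomology A n) (cohomology B n) (cohomology_map B n (\<phi> n))"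
  by (intro linear_mapI A.cohomology_vectorspace B.cohomology_vectorspace cohomology_map_hom)

end

locale short_exact_complexes =
  \<alpha>: cochain_map K A B \<alpha> + \<beta>: cochain_map K B C \<beta>
  for K :: "('k, 'x) ring_scheme" and A :: "('k, 'a) cochain_complex"
    and B :: "('k, 'b) cochain_complex" and C :: "('k, 'c) cochain_complex" and \<alpha> \<beta> +
  assumes inj: "inj_on (\<alpha> n) (carrier (cochains A n))"
    and surj: "\<beta> n ` carrier (cochains B n) = carrier (cochains C n)"
    and exact: "\<alpha> n ` carrier (cochains A n) =
      {f \<in> carrier (cochains B n). \<beta> n f = \<zero>\<^bsub>cochains C n\<^esub>}"
begin

abbreviation "c \<equiv> connecting_map A B \<alpha> \<beta>"

lemma \<beta>_\<alpha>: "a \<in> carrier (cochains A n) \<Longrightarrow> \<beta> n (\<alpha> n a) = \<zero>\<^bsub>cochains C n\<^esub>"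
  using exact[of n] by auto

lemma \<alpha>_preimage:
  assumes "f \<in> carrier (cochains B n)" "\<beta> n f = \<zero>\<^bsub>cochains C n\<^esub>"
  obtains a where "a \<in> carrier (cochains A n)" "\<alpha> n a = f"
  using exact[of n] assms by (metis (mono_tags, lifting) imageE mem_Collect_eq)

lemma \<beta>_preimage:
  assumes "h \<in> carrier (cochains C n)"
  obtains f where "f \<in> carrier (cochains B n)" "\<beta> n f = h"
  using surj[of n] assms by (metis imageE)

lemma coboundary_lift:
  assumes "h \<in> coboundaries C n"
  obtains b where "b \<in> coboundaries B n" "\<beta> n b = h"
proof (cases n)
  case 0
  then show ?thesis
    using assms \<beta>.map_zero[of 0] by (intro that[of "\<zero>\<^bsub>cochains B n\<^esub>"]) auto
next
  case (Suc m)
  then obtain k where k: "k \<in> carrier (cochains C m)" "h = cobd C m k" using assms by auto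
  obtain l where l: "l \<in> carrier (cochains B m)" "\<beta> m l = k" using \<beta>_preimage[OF k(1)] .
  show ?thesis
    using k l Suc by (intro that[of "cobd B m l"]) (auto simp: \<beta>.chain)
qed

lemma \<alpha>_cocycle_iff:
  assumes "a \<in> carrier (cochains A n)"
  shows "a \<in> cocycles A n \<longleftrightarrow> \<alpha> n a \<in> cocycles B n"
proof
  assume "\<alpha> n a \<in> cocycles B n"
  then have "\<alpha> (Suc n) (cobd A n a) = \<alpha> (Suc n) \<zero>\<^bsub>cochains A (Suc n)\<^esub>"
    using assms by (simp add: cocycles_def \<alpha>.chain \<alpha>.map_zero)
  then have "cobd A n a = \<zero>\<^bsub>cochains A (Suc n)\<^esub>"
    using inj_onD[OF inj] assms by (simp add: \<alpha>.A.cobd_closed)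
  then show "a \<in> cocycles A n" using assms by (simp add: cocycles_def)
qed (rule \<alpha>.cocycle)

text \<open>\<open>snake n h f g\<close> says that \<open>g\<close> is one of the cocycles \<open>\<alpha>\<^sup>-\<^sup>1 (\<partial> (\<beta>\<^sup>-\<^sup>1 h))\<close>, computed through the
  preimage \<open>f\<close> of \<open>h\<close>.\<close>

definition snake :: "nat \<Rightarrow> 'c \<Rightarrow> 'b \<Rightarrow> 'a \<Rightarrow> bool" where
  "snake n h f g \<longleftrightarrow> h \<in> cocycles C n \<and> f \<in> carrier (cochains B n) \<and> \<beta> n f = h \<and>
     g \<in> carrier (cochains A (Suc n)) \<and> \<alpha> (Suc n) g = cobd B n f"

lemma snake_exists:
  assumes "h \<in> cocycles C n"
  obtains f g where "snake n h f g"
proof -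
  obtain f where f: "f \<in> carrier (cochains B n)" "\<beta> n f = h"
    using \<beta>_preimage[OF \<beta>.B.cocycles_carrier[OF assms]] .
  have "\<beta> (Suc n) (cobd B n f) = \<zero>\<^bsub>cochains C (Suc n)\<^esub>"
    using f assms by (simp add: \<beta>.chain cocycles_def)
  then obtain g where "g \<in> carrier (cochains A (Suc n))" "\<alpha> (Suc n) g = cobd B n f"
    using \<alpha>_preimage[OF \<alpha>.B.cobd_closed[OF f(1)]] by blast
  then show ?thesis using f assms by (intro that[of f g]) (simp add: snake_def)
qed

lemma snake_cocycle:
  assumes "snake n h f g"
  shows "g \<in> cocycles A (Suc n)"
  using assms \<alpha>_cocycle_iff[of g "Suc n"] \<alpha>.B.coboundaries_cocycles[of "Suc n"]
  by (auto simp: snake_def)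

lemma snake_unique:
  assumes s: "snake n h f g" and s': "snake n h' f' g'"
    and eq: "cohomology_class C n h' = cohomology_class C n h"
  shows "cohomology_class A (Suc n) g' = cohomology_class A (Suc n) g"
proof -
  let ?B = "cochains B n"
  have f: "f \<in> carrier ?B" "f' \<in> carrier ?B" using s s' by (auto simp: snake_def)
  have "h' \<ominus>\<^bsub>cochains C n\<^esub> h \<in> coboundaries C n"
    using s s' eq by (simp add: snake_def \<beta>.B.cohomology_class_eq_iff)
  then obtain b where b: "b \<in> coboundaries B n" "\<beta> n b = h' \<ominus>\<^bsub>cochains C n\<^esub> h"
    using coboundary_lift by blast
  have bB: "b \<in> carrier ?B" "cobd B n b = \<zero>\<^bsub>cochains B (Suc n)\<^esub>"
    using \<alpha>.B.coboundaries_cocycles b(1) by (auto simp: cocycles_def)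
  have "\<beta> n ((f' \<ominus>\<^bsub>?B\<^esub> f) \<ominus>\<^bsub>?B\<^esub> b) = \<zero>\<^bsub>cochains C n\<^esub>"
    using s s' f b bB by (simp add: \<beta>.map_minus snake_def \<beta>.B.cocycles_carrier)
  then obtain a where a: "a \<in> carrier (cochains A n)" "\<alpha> n a = (f' \<ominus>\<^bsub>?B\<^esub> f) \<ominus>\<^bsub>?B\<^esub> b"
    using \<alpha>_preimage[of "(f' \<ominus>\<^bsub>?B\<^esub> f) \<ominus>\<^bsub>?B\<^esub> b" n] f bB by auto
  have "\<alpha> (Suc n) (cobd A n a) = cobd B n f' \<ominus>\<^bsub>cochains B (Suc n)\<^esub> cobd B n f"
    using a f bB by (simp add: \<alpha>.chain \<alpha>.B.cobd_minus \<alpha>.B.cobd_closed)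
  also have "\<dots> = \<alpha> (Suc n) (g' \<ominus>\<^bsub>cochains A (Suc n)\<^esub> g)"
    using s s' by (simp add: snake_def \<alpha>.map_minus)
  finally have "cobd A n a = g' \<ominus>\<^bsub>cochains A (Suc n)\<^esub> g"
    using inj_onD[OF inj] s s' a by (simp add: snake_def \<alpha>.A.cobd_closed)
  then have "g' \<ominus>\<^bsub>cochains A (Suc n)\<^esub> g \<in> coboundaries A (Suc n)"
    using a(1) by (simp add: image_iff) metis
  then show ?thesis
    using snake_cocycle[OF s] snake_cocycle[OF s'] by (simp add: \<alpha>.A.cohomology_class_eq_iff)
qed

lemma connecting_map_class:
  assumes s: "snake n h f g"
  shows "c n (cohomology_class C n h) = cohomology_class A (Suc n) g"
proof -
  have h: "h \<in> cocycles C n" using s by (simp add: snake_def)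
  have "{cohomology_class A (Suc n) g | g f h'. h' \<in> cohomology_class C n h \<and> snake n h' f g} =
    {cohomology_class A (Suc n) g}"
  proof (intro equalityI subsetI)
    fix x assume "x \<in> {cohomology_class A (Suc n) g | g f h'.
      h' \<in> cohomology_class C n h \<and> snake n h' f g}"
    then obtain g' f' h' where x: "x = cohomology_class A (Suc n) g'"
      "h' \<in> cohomology_class C n h" "snake n h' f' g'" by blast
    then have "cohomology_class A (Suc n) g' = cohomology_class A (Suc n) g"
      using snake_unique[OF s] h by (simp add: \<beta>.B.mem_cohomology_class_iff)
    then show "x \<in> {cohomology_class A (Suc n) g}" using x by simp
  next
    fix x assume x: "x \<in> {cohomology_class A (Suc n) g}"
    have "h \<in> cohomology_class C n h" using h by (simp add: \<beta>.B.mem_cohomology_class_iff)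
    then show "x \<in> {cohomology_class A (Suc n) g | g f h'.
      h' \<in> cohomology_class C n h \<and> snake n h' f g}"
      using s x by blast
  qed
  moreover have "h' \<in> cohomology_class C n h \<Longrightarrow> h' \<in> cocycles C n" for h'
    using h by (simp add: \<beta>.B.mem_cohomology_class_iff)
  then have "c n (cohomology_class C n h) =
    \<Union>{cohomology_class A (Suc n) g | g f h'. h' \<in> cohomology_class C n h \<and> snake n h' f g}"
    unfolding connecting_map_def snake_def by (intro arg_cong[of _ _ Union] Collect_cong) blast
  ultimately show ?thesis by simp
qed

lemma connecting_map_hom:
  "c n \<in> LinearCombinations.module_hom K (cohomology C n) (cohomology A (Suc n))"
proof -
  have "\<forall>h\<in>cocycles C n. \<exists>g f. snake n h f g" using snake_exists by blast
  from bchoice[OF this] obtain \<sigma>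
    where s: "\<And>h. h \<in> cocycles C n \<Longrightarrow> \<exists>f. snake n h f (\<sigma> h)" by blast
  interpret CZ: vectorspace K "\<beta>.B.cocycle_space n" by (rule \<beta>.B.cocycle_vectorspace)
  note [simp] = \<alpha>.A.cobd_closed \<alpha>.A.cohomology_carrier
  have add: "snake n (h \<oplus>\<^bsub>cochains C n\<^esub> h') (f \<oplus>\<^bsub>cochains B n\<^esub> f') (g \<oplus>\<^bsub>cochains A (Suc n)\<^esub> g')"
    if "snake n h f g" "snake n h' f' g'" for h h' f f' g g'
    using that CZ.M.add.m_closed[of h h']
    by (simp add: snake_def LinearCombinations.module_hom_add[OF \<alpha>.hom]
        LinearCombinations.module_hom_add[OF \<beta>.hom]
        LinearCombinations.module_hom_add[OF \<alpha>.B.cobd_hom])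
  have smult: "snake n (a \<odot>\<^bsub>cochains C n\<^esub> h) (a \<odot>\<^bsub>cochains B n\<^esub> f) (a \<odot>\<^bsub>cochains A (Suc n)\<^esub> g)"
    if "snake n h f g" "a \<in> carrier K" for h f g a
    using that CZ.smult_closed[of a h]
    by (simp add: snake_def LinearCombinations.module_hom_smult[OF \<alpha>.hom]
        LinearCombinations.module_hom_smult[OF \<beta>.hom]
        LinearCombinations.module_hom_smult[OF \<alpha>.B.cobd_hom])
  have cls: "cohomology_class A (Suc n) (\<sigma> h) = cohomology_class A (Suc n) g"
    if "snake n h f g" for h f g
  proof -
    have "h \<in> cocycles C n" using that by (simp add: snake_def)
    then obtain f' where "snake n h f' (\<sigma> h)" using s by blast
    then show ?thesis using snake_unique[OF that] by blast
  qed
  note hom = LinearCombinations.module_hom_add[OF \<alpha>.A.cohomology_class_hom]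
    LinearCombinations.module_hom_smult[OF \<alpha>.A.cohomology_class_hom]
  show ?thesis
  proof (rule \<beta>.B.hom_from_cohomology[where \<phi> = "\<lambda>h. cohomology_class A (Suc n) (\<sigma> h)"])
    show "(\<lambda>h. cohomology_class A (Suc n) (\<sigma> h)) \<in>
      LinearCombinations.module_hom K (\<beta>.B.cocycle_space n) (cohomology A (Suc n))"
    proof (rule module_homI, simp_all)
      fix h assume "h \<in> cocycles C n"
      then show "cohomology_class A (Suc n) (\<sigma> h) \<in>
        cohomology_class A (Suc n) ` cocycles A (Suc n)"
        using s snake_cocycle by blast
    next
      fix h h' assume "h \<in> cocycles C n" "h' \<in> cocycles C n"
      then obtain f f' where "snake n h f (\<sigma> h)" "snake n h' f' (\<sigma> h')" using s by blast
      then show "cohomology_class A (Suc n) (\<sigma> (h \<oplus>\<^bsub>cochains C n\<^esub> h')) =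
        cohomology_class A (Suc n) (\<sigma> h) \<oplus>\<^bsub>cohomology A (Suc n)\<^esub>
        cohomology_class A (Suc n) (\<sigma> h')"
        using cls[OF add] hom(1)[of "\<sigma> h" "Suc n" "\<sigma> h'"] by (simp add: snake_cocycle)
    next
      fix a h assume a: "a \<in> carrier K" "h \<in> cocycles C n"
      then obtain f where "snake n h f (\<sigma> h)" using s by blast
      then show "cohomology_class A (Suc n) (\<sigma> (a \<odot>\<^bsub>cochains C n\<^esub> h)) =
        a \<odot>\<^bsub>cohomology A (Suc n)\<^esub> cohomology_class A (Suc n) (\<sigma> h)"
        using a cls[OF smult] hom(2)[of a "\<sigma> h" "Suc n"] by (simp add: snake_cocycle)
    qed
    show "c n (cohomology_class C n h) = cohomology_class A (Suc n) (\<sigma> h)"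
      if "h \<in> cocycles C n" for h
      using s[OF that] connecting_map_class by blast
  qed
qed

lemma connecting_map_linear:
  "linear_map K (cohomology C n) (cohomology A (Suc n)) (c n)"
  by (intro linear_mapI \<alpha>.A.cohomology_vectorspace \<beta>.B.cohomology_vectorspace connecting_map_hom)

abbreviation "H\<alpha> n \<equiv> cohomology_map B n (\<alpha> n)"
abbreviation "H\<beta> n \<equiv> cohomology_map C n (\<beta> n)"

lemma inj_H\<alpha>_0: "inj_on (H\<alpha> 0) (carrier (cohomology A 0))"
proof (rule inj_onI)
  fix P Q assume PQ: "P \<in> carrier (cohomology A 0)" "Q \<in> carrier (cohomology A 0)"
    and eq: "H\<alpha> 0 P = H\<alpha> 0 Q"
  obtain f g where fg: "f \<in> cocycles A 0" "g \<in> cocycles A 0"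
    and cls: "P = cohomology_class A 0 f" "Q = cohomology_class A 0 g"
    using PQ by (auto simp: \<alpha>.A.cohomology_carrier)
  have "\<alpha> 0 f \<ominus>\<^bsub>cochains B 0\<^esub> \<alpha> 0 g = \<zero>\<^bsub>cochains B 0\<^esub>"
    using eq fg by (simp add: cls \<alpha>.cohomology_map_class \<alpha>.B.cohomology_class_eq_iff \<alpha>.cocycle)
  then have "\<alpha> 0 f = \<alpha> 0 g"
    using fg by (simp add: \<alpha>.B.cochains.M.minus_eq_zero_iff \<alpha>.closed \<alpha>.A.cocycles_carrier)
  then show "P = Q"
    using inj_onD[OF inj] fg unfolding cls by (metis \<alpha>.A.cocycles_carrier)
qed

lemma exact_at_B: "exact_at K (cohomology A n) (H\<alpha> n) (cohomology B n) (H\<beta> n) (cohomology C n)"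
  unfolding exact_at_def
proof (intro conjI \<alpha>.cohomology_map_linear \<beta>.cohomology_map_linear equalityI subsetI)
  fix P assume "P \<in> H\<alpha> n ` carrier (cohomology A n)"
  then obtain a where a: "a \<in> cocycles A n" "P = cohomology_class B n (\<alpha> n a)"
    by (auto simp: \<alpha>.A.cohomology_carrier \<alpha>.cohomology_map_class)
  have "H\<beta> n P = cohomology_class C n \<zero>\<^bsub>cochains C n\<^esub>"
    using a by (simp add: \<beta>.cohomology_map_class \<alpha>.cocycle \<beta>_\<alpha> \<alpha>.A.cocycles_carrier)
  moreover have "\<zero>\<^bsub>cochains C n\<^esub> \<in> coboundaries C n"
    using \<beta>.B.coboundaries_subspace
    by (auto simp: subspace_def LinearCombinations.submodule_def)
  ultimately have "H\<beta> n P = \<zero>\<^bsub>cohomology C n\<^esub>"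
    using \<beta>.B.coboundaries_cocycles by (simp add: \<beta>.B.cohomology_class_eq_zero_iff subset_iff)
  then show "P \<in> {P \<in> carrier (cohomology B n). H\<beta> n P = \<zero>\<^bsub>cohomology C n\<^esub>}"
    using a by (auto simp: \<alpha>.B.cohomology_carrier \<alpha>.cocycle)
next
  fix P assume "P \<in> {P \<in> carrier (cohomology B n). H\<beta> n P = \<zero>\<^bsub>cohomology C n\<^esub>}"
  then obtain f where f: "f \<in> cocycles B n" "P = cohomology_class B n f"
    and \<beta>f: "\<beta> n f \<in> coboundaries C n"
    by (auto simp: \<alpha>.B.cohomology_carrier \<beta>.cohomology_map_class
        \<beta>.B.cohomology_class_eq_zero_iff \<beta>.cocycle)
  let ?B = "cochains B n"
  obtain b where b: "b \<in> coboundaries B n" "\<beta> n b = \<beta> n f" using coboundary_lift[OF \<beta>f] .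
  have bB: "b \<in> carrier ?B" "cobd B n b = \<zero>\<^bsub>cochains B (Suc n)\<^esub>"
    using \<alpha>.B.coboundaries_cocycles b(1) by (auto simp: cocycles_def)
  have fB: "f \<in> carrier ?B" using f by (simp add: cocycles_def)
  have "\<beta> n (f \<ominus>\<^bsub>?B\<^esub> b) = \<zero>\<^bsub>cochains C n\<^esub>"
    using fB bB b by (simp add: \<beta>.map_minus \<beta>.closed)
  then obtain a where a: "a \<in> carrier (cochains A n)" "\<alpha> n a = f \<ominus>\<^bsub>?B\<^esub> b"
    using \<alpha>_preimage[of "f \<ominus>\<^bsub>?B\<^esub> b" n] fB bB by auto
  have "\<alpha> n a \<in> cocycles B n"
    using f fB bB by (simp add: a cocycles_def \<alpha>.B.cobd_minus)
  moreover have "f \<ominus>\<^bsub>?B\<^esub> \<alpha> n a \<in> coboundaries B n"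
    using fB bB b by (simp add: a)
  ultimately have "P = H\<alpha> n (cohomology_class A n a)" "a \<in> cocycles A n"
    using f a by (simp_all add: \<alpha>_cocycle_iff \<alpha>.cohomology_map_class \<alpha>.B.cohomology_class_eq_iff)
  then show "P \<in> H\<alpha> n ` carrier (cohomology A n)"
    by (simp add: \<alpha>.A.cohomology_carrier)
qed

lemma exact_at_C: "exact_at K (cohomology B n) (H\<beta> n) (cohomology C n) (c n) (cohomology A (Suc n))"
  unfolding exact_at_def
proof (intro conjI \<beta>.cohomology_map_linear connecting_map_linear equalityI subsetI)
  fix P assume "P \<in> H\<beta> n ` carrier (cohomology B n)"
  then obtain f where f: "f \<in> cocycles B n" "P = cohomology_class C n (\<beta> n f)"
    by (auto simp: \<alpha>.B.cohomology_carrier \<beta>.cohomology_map_class)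
  have s: "snake n (\<beta> n f) f \<zero>\<^bsub>cochains A (Suc n)\<^esub>"
    using f \<beta>.cocycle[OF f(1)] by (simp add: snake_def cocycles_def \<alpha>.map_zero)
  have "\<zero>\<^bsub>cochains A (Suc n)\<^esub> \<in> coboundaries A (Suc n)"
    using \<alpha>.A.coboundaries_subspace[of "Suc n"]
    by (auto simp: subspace_def LinearCombinations.submodule_def)
  then have "c n P = \<zero>\<^bsub>cohomology A (Suc n)\<^esub>"
    using f connecting_map_class[OF s] snake_cocycle[OF s]
      \<alpha>.A.cohomology_class_eq_zero_iff[OF snake_cocycle[OF s]] by simp
  then show "P \<in> {P \<in> carrier (cohomology C n). c n P = \<zero>\<^bsub>cohomology A (Suc n)\<^esub>}"
    using f by (auto simp: \<beta>.B.cohomology_carrier \<beta>.cocycle)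
next
  fix P assume "P \<in> {P \<in> carrier (cohomology C n). c n P = \<zero>\<^bsub>cohomology A (Suc n)\<^esub>}"
  then obtain h where h: "h \<in> cocycles C n" "P = cohomology_class C n h"
    and c: "c n P = \<zero>\<^bsub>cohomology A (Suc n)\<^esub>"
    by (auto simp: \<beta>.B.cohomology_carrier)
  obtain f g where s: "snake n h f g" using snake_exists[OF h(1)] .
  have "g \<in> coboundaries A (Suc n)"
    using c h connecting_map_class[OF s] \<alpha>.A.cohomology_class_eq_zero_iff[OF snake_cocycle[OF s]]
    by simp
  then obtain a where a: "a \<in> carrier (cochains A n)" "g = cobd A n a" by auto
  let ?f = "f \<ominus>\<^bsub>cochains B n\<^esub> \<alpha> n a"
  have f: "f \<in> carrier (cochains B n)" "\<beta> n f = h" using s by (auto simp: snake_def)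
  have "cobd B n ?f = \<zero>\<^bsub>cochains B (Suc n)\<^esub>"
    using s a f by (simp add: snake_def \<alpha>.B.cobd_minus \<alpha>.closed \<alpha>.chain \<alpha>.B.cobd_closed)
  then have "?f \<in> cocycles B n" using a f by (simp add: cocycles_def \<alpha>.closed)
  moreover have "\<beta> n ?f = h"
    using a f h by (simp add: \<beta>.map_minus \<alpha>.closed \<beta>_\<alpha> \<beta>.B.cocycles_carrier)
  ultimately show "P \<in> H\<beta> n ` carrier (cohomology B n)"
    using h by (auto simp: \<alpha>.B.cohomology_carrier \<beta>.cohomology_map_class image_iff intro!: bexI[of _ ?f])
qed

lemma exact_at_A:
  "exact_at K (cohomology C n) (c n) (cohomology A (Suc n)) (H\<alpha> (Suc n)) (cohomology B (Suc n))"
  unfolding exact_at_def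
proof (intro conjI \<alpha>.cohomology_map_linear connecting_map_linear equalityI subsetI)
  fix P assume "P \<in> c n ` carrier (cohomology C n)"
  then obtain h where h: "h \<in> cocycles C n" "P = c n (cohomology_class C n h)"
    by (auto simp: \<beta>.B.cohomology_carrier)
  obtain f g where s: "snake n h f g" using snake_exists[OF h(1)] .
  then have P: "P = cohomology_class A (Suc n) g" "g \<in> cocycles A (Suc n)"
    using h by (auto simp: connecting_map_class snake_cocycle)
  have "\<alpha> (Suc n) g \<in> coboundaries B (Suc n)" using s by (auto simp: snake_def)
  then have "H\<alpha> (Suc n) P = \<zero>\<^bsub>cohomology B (Suc n)\<^esub>"
    using P \<alpha>.B.cohomology_class_eq_zero_iff[OF \<alpha>.cocycle[OF P(2)]]
    by (simp add: \<alpha>.cohomology_map_class)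
  then show "P \<in> {P \<in> carrier (cohomology A (Suc n)). H\<alpha> (Suc n) P = \<zero>\<^bsub>cohomology B (Suc n)\<^esub>}"
    using P by (auto simp: \<alpha>.A.cohomology_carrier)
next
  fix P assume "P \<in> {P \<in> carrier (cohomology A (Suc n)). H\<alpha> (Suc n) P = \<zero>\<^bsub>cohomology B (Suc n)\<^esub>}"
  then obtain g where g: "g \<in> cocycles A (Suc n)" "P = cohomology_class A (Suc n) g"
    and z: "H\<alpha> (Suc n) P = \<zero>\<^bsub>cohomology B (Suc n)\<^esub>"
    by (auto simp: \<alpha>.A.cohomology_carrier)
  have "\<alpha> (Suc n) g \<in> coboundaries B (Suc n)"
    using g z \<alpha>.B.cohomology_class_eq_zero_iff[OF \<alpha>.cocycle[OF g(1)]]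
    by (simp add: \<alpha>.cohomology_map_class)
  then obtain f where f: "f \<in> carrier (cochains B n)" "\<alpha> (Suc n) g = cobd B n f" by auto
  have "cobd C n (\<beta> n f) = \<zero>\<^bsub>cochains C (Suc n)\<^esub>"
    using f g \<beta>_\<alpha>[of g "Suc n"] by (simp add: \<beta>.chain[symmetric] \<alpha>.A.cocycles_carrier)
  then have h: "\<beta> n f \<in> cocycles C n" using f by (simp add: cocycles_def \<beta>.closed)
  then have "snake n (\<beta> n f) f g"
    using f g by (simp add: snake_def \<alpha>.A.cocycles_carrier)
  then have "P = c n (cohomology_class C n (\<beta> n f))"
    using g by (simp add: connecting_map_class)
  then show "P \<in> c n ` carrier (cohomology C n)"
    using h by (simp add: \<beta>.B.cohomology_carrier)
qed

end

section \<open>The Loday-Pirashvili complex in recursive form\<close>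

lemma (in abelian_monoid) finsum_lessThan_Suc_shift:
  assumes "f \<in> {..<Suc n} \<rightarrow> carrier G"
  shows "finsum G f {..<Suc n} = f 0 \<oplus> finsum G (\<lambda>i. f (Suc i)) {..<n}"
proof -
  have "{..<Suc n} = insert 0 (Suc ` {..<n})" by (auto simp: less_Suc_eq_0_disj)
  moreover have "finsum G f (Suc ` {..<n}) = finsum G (\<lambda>i. f (Suc i)) {..<n}"
    using assms by (intro finsum_reindex) auto
  ultimately show ?thesis
    using assms by (simp add: finsum_insert Pi_iff)
qed

lemma (in abelian_group) finsum_neg:
  assumes "f \<in> I \<rightarrow> carrier G"
  shows "finsum G (\<lambda>i. \<ominus> f i) I = \<ominus> finsum G f I"
  using assms
proof (induction I rule: infinite_finite_induct)
  case (insert i I)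
  then show ?case by (simp add: finsum_insert Pi_iff minus_add)
qed (use add.inv_one in \<open>simp_all add: a_inv_def\<close>)

lemma module_hom_minus_fun:
  assumes "vectorspace K M" "vectorspace K N"
    and f: "f \<in> LinearCombinations.module_hom K M N" and g: "g \<in> LinearCombinations.module_hom K M N"
  shows "(\<lambda>x. f x \<ominus>\<^bsub>N\<^esub> g x) \<in> LinearCombinations.module_hom K M N"
proof -
  interpret N: vectorspace K N by fact
  note [simp] = module_hom_carrier[OF f] module_hom_carrier[OF g]
    LinearCombinations.module_hom_add[OF f] LinearCombinations.module_hom_add[OF g]
    LinearCombinations.module_hom_smult[OF f] LinearCombinations.module_hom_smult[OF g]
  show ?thesis
    by (rule module_homI)
      (simp_all add: a_minus_def N.M.minus_add N.M.a_ac N.smult_r_distr N.smult_r_minus)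
qed

lemma module_hom_uminus_fun:
  assumes "vectorspace K M" "vectorspace K N"
    and f: "f \<in> LinearCombinations.module_hom K M N"
  shows "(\<lambda>x. \<ominus>\<^bsub>N\<^esub> f x) \<in> LinearCombinations.module_hom K M N"
proof -
  interpret N: vectorspace K N by fact
  note [simp] = module_hom_carrier[OF f]
    LinearCombinations.module_hom_add[OF f] LinearCombinations.module_hom_smult[OF f]
  show ?thesis
    by (rule module_homI) (simp_all add: N.M.minus_add N.M.a_ac N.smult_r_minus)
qed

lemma tuples_Nil [simp]: "[] \<in> tuples A n \<longleftrightarrow> n = 0"
  by (auto simp: tuples_def)

lemma tuples_0: "tuples A 0 = {[]}"
  by (auto simp: tuples_def)

lemma tuples_Cons [simp]: "x # xs \<in> tuples A (Suc n) \<longleftrightarrow> x \<in> carrier A \<and> xs \<in> tuples A n"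
  by (auto simp: tuples_def)

lemma tuples_SucE:
  assumes "xs \<in> tuples A (Suc n)"
  obtains y ys where "xs = y # ys" "y \<in> carrier A" "ys \<in> tuples A n"
  using assms by (cases xs) (auto simp: tuples_def)

primrec multilinear ::
  "('k, 'x) ring_scheme \<Rightarrow> ('k, 'a, 'p) module_scheme \<Rightarrow> ('k, 'm, 'q) module_scheme
    \<Rightarrow> nat \<Rightarrow> ('a list \<Rightarrow> 'm) \<Rightarrow> bool" where
  "multilinear K A M 0 f \<longleftrightarrow> f [] \<in> carrier M"
| "multilinear K A M (Suc n) f \<longleftrightarrow>
     (\<forall>x\<in>carrier A. multilinear K A M n (\<lambda>xs. f (x # xs))) \<and>
     (\<forall>xs\<in>tuples A n. (\<lambda>x. f (x # xs)) \<in> LinearCombinations.module_hom K A M)"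

lemma multilinear_carrier:
  "multilinear K A M n f \<Longrightarrow> xs \<in> tuples A n \<Longrightarrow> f xs \<in> carrier M"
proof (induction n arbitrary: f xs)
  case (Suc n)
  obtain y ys where y: "xs = y # ys" "y \<in> carrier A" "ys \<in> tuples A n"
    using Suc.prems(2) by (rule tuples_SucE)
  then show ?case
    using Suc.IH[of "\<lambda>xs. f (y # xs)" ys] Suc.prems(1) by simp
qed (simp add: tuples_0)

lemma multilinear_cong:
  assumes "\<And>xs. xs \<in> tuples A n \<Longrightarrow> g xs = f xs" "multilinear K A M n f" "module K A"
  shows "multilinear K A M n g"
  using assms(1,2)
proof (induction n arbitrary: f g)
  case (Suc n)
  have "multilinear K A M n (\<lambda>xs. g (x # xs))" if "x \<in> carrier A" for x
  proof (rule Suc.IH)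
    show "g (x # xs) = f (x # xs)" if "xs \<in> tuples A n" for xs
      using Suc.prems(1) that \<open>x \<in> carrier A\<close> by simp
    show "multilinear K A M n (\<lambda>xs. f (x # xs))" using Suc.prems(2) that by simp
  qed
  moreover have "(\<lambda>x. g (x # xs)) \<in> LinearCombinations.module_hom K A M" if "xs \<in> tuples A n" for xs
    using Suc.prems that assms(3) by - (rule module_hom_cong[of "\<lambda>x. f (x # xs)"], auto)
  ultimately show ?case by simp
qed auto

lemma multilinear_comp:
  assumes "\<phi> \<in> LinearCombinations.module_hom K M L" "multilinear K A M n f"
  shows "multilinear K A L n (\<lambda>xs. \<phi> (f xs))"
  using assms(2)
proof (induction n arbitrary: f)
  case 0
  then show ?case using module_hom_carrier[OF assms(1)] by simp
next
  case (Suc n)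
  have "(\<lambda>x. \<phi> (f (x # xs))) \<in> LinearCombinations.module_hom K A L" if "xs \<in> tuples A n" for xs
  proof -
    have "(\<lambda>x. f (x # xs)) \<in> LinearCombinations.module_hom K A M" using Suc.prems that by simp
    then show ?thesis using assms(1) by (rule module_hom_comp)
  qed
  then show ?case using Suc by simp
qed

lemma multilinear_minus:
  assumes "vectorspace K A" "vectorspace K M" "multilinear K A M n f" "multilinear K A M n g"
  shows "multilinear K A M n (\<lambda>xs. f xs \<ominus>\<^bsub>M\<^esub> g xs)"
  using assms(3,4)
proof (induction n arbitrary: f g)
  case 0
  interpret M: vectorspace K M by fact
  show ?case using 0 by simp
next
  case (Suc n)
  then show ?case using module_hom_minus_fun[OF assms(1,2)] by simp
qed

lemma multilinear_iff_multilinear_maps: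
  assumes "module K A"
  shows "f \<in> multilinear_maps K A M n \<longleftrightarrow>
    multilinear K A M n f \<and> f \<in> extensional (tuples A n)"
proof -
  interpret A: module K A by fact
  have "multilinear K A M n f \<longleftrightarrow> f \<in> tuples A n \<rightarrow> carrier M \<and>
    (\<forall>xs\<in>tuples A n. \<forall>i<n. (\<lambda>v. f (xs[i := v])) \<in> LinearCombinations.module_hom K A M)"
  proof (induction n arbitrary: f)
    case 0
    then show ?case by (simp add: tuples_0)
  next
    case (Suc n)
    let ?H = "LinearCombinations.module_hom K A M"
    show ?case
    proof (intro iffI conjI ballI allI impI funcsetI)
      assume f: "multilinear K A M (Suc n) f"
      fix xs assume xs: "xs \<in> tuples A (Suc n)"
      show "f xs \<in> carrier M" using f xs by (rule multilinear_carrier)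
      fix i assume i: "i < Suc n"
      obtain y ys where y: "xs = y # ys" "y \<in> carrier A" "ys \<in> tuples A n"
        using xs by (rule tuples_SucE)
      show "(\<lambda>v. f (xs[i := v])) \<in> ?H"
      proof (cases i)
        case 0
        then show ?thesis using f y by simp
      next
        case (Suc j)
        have "multilinear K A M n (\<lambda>zs. f (y # zs))" using f y by simp
        then have "(\<lambda>v. f (y # ys[j := v])) \<in> ?H"
          using Suc.IH[of "\<lambda>zs. f (y # zs)"] y i Suc by auto
        then show ?thesis using y Suc by simp
      qed
    next
      assume f: "f \<in> tuples A (Suc n) \<rightarrow> carrier M \<and>
        (\<forall>xs\<in>tuples A (Suc n). \<forall>i<Suc n. (\<lambda>v. f (xs[i := v])) \<in> ?H)"
      have "multilinear K A M n (\<lambda>xs. f (x # xs))" if x: "x \<in> carrier A" for x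
        unfolding Suc.IH
      proof (intro conjI ballI allI impI funcsetI)
        fix xs assume xs: "xs \<in> tuples A n"
        then show "f (x # xs) \<in> carrier M" using f x by auto
        fix i assume "i < n"
        moreover have "x # xs \<in> tuples A (Suc n)" using x xs by simp
        ultimately have "(\<lambda>v. f ((x # xs)[Suc i := v])) \<in> ?H" using f by blast
        then show "(\<lambda>v. f (x # xs[i := v])) \<in> ?H" by simp
      qed
      moreover have "(\<lambda>x. f (x # xs)) \<in> ?H" if xs: "xs \<in> tuples A n" for xs
      proof -
        have "\<zero>\<^bsub>A\<^esub> # xs \<in> tuples A (Suc n)" using xs by simp
        then have "(\<lambda>v. f ((\<zero>\<^bsub>A\<^esub> # xs)[0 := v])) \<in> ?H" using f by blast
        then show ?thesis by simp
      qed
      ultimately show "multilinear K A M (Suc n) f" by simp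
    qed
  qed
  then show ?thesis by (auto simp: multilinear_maps_def PiE_def)
qed

text \<open>The Lie derivative along \<open>x\<close> and a Cartan-style recursion for the coboundary: with
  \<open>(\<iota>\<^sub>x f) xs = f (x # xs)\<close>, one has \<open>\<iota>\<^sub>x (\<partial> f) = L\<^sub>x f - \<partial> (\<iota>\<^sub>x f)\<close> in positive degrees.\<close>

fun lie_derivative ::
  "('a \<Rightarrow> 'a \<Rightarrow> 'a) \<Rightarrow> ('k, 'm, 'q) module_scheme \<Rightarrow> ('a \<Rightarrow> 'm \<Rightarrow> 'm)
    \<Rightarrow> 'a \<Rightarrow> ('a list \<Rightarrow> 'm) \<Rightarrow> 'a list \<Rightarrow> 'm" where
  "lie_derivative br M rL x f [] = rL x (f [])"
| "lie_derivative br M rL x f (y # ys) =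
     lie_derivative br M rL x (\<lambda>zs. f (y # zs)) ys \<ominus>\<^bsub>M\<^esub> f (br x y # ys)"

primrec cartan_coboundary ::
  "('a \<Rightarrow> 'a \<Rightarrow> 'a) \<Rightarrow> ('k, 'm, 'q) module_scheme \<Rightarrow> ('a \<Rightarrow> 'm \<Rightarrow> 'm) \<Rightarrow> ('a \<Rightarrow> 'm \<Rightarrow> 'm)
    \<Rightarrow> nat \<Rightarrow> ('a list \<Rightarrow> 'm) \<Rightarrow> 'a list \<Rightarrow> 'm" where
  "cartan_coboundary br M rL rR 0 f xs = \<ominus>\<^bsub>M\<^esub> rR (hd xs) (f [])"
| "cartan_coboundary br M rL rR (Suc n) f xs =
     lie_derivative br M rL (hd xs) f (tl xs)
     \<ominus>\<^bsub>M\<^esub> cartan_coboundary br M rL rR n (\<lambda>zs. f (hd xs # zs)) (tl xs)"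

lemma lie_derivative_cong:
  assumes "\<And>xs. xs \<in> tuples A n \<Longrightarrow> f xs = g xs" "xs \<in> tuples A n"
    and "\<And>y. y \<in> carrier A \<Longrightarrow> br x y \<in> carrier A"
  shows "lie_derivative br M rL x f xs = lie_derivative br M rL x g xs"
  using assms(1,2)
proof (induction n arbitrary: f g xs)
  case 0
  then show ?case by (simp add: tuples_0)
next
  case (Suc n)
  obtain y ys where y: "xs = y # ys" "y \<in> carrier A" "ys \<in> tuples A n"
    using Suc.prems(2) by (rule tuples_SucE)
  have "lie_derivative br M rL x (\<lambda>zs. f (y # zs)) ys = lie_derivative br M rL x (\<lambda>zs. g (y # zs)) ys"
    using Suc.prems y by (intro Suc.IH) auto
  then show ?case using Suc.prems y assms(3) by simp
qed

lemma cartan_coboundary_cong: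
  assumes "\<And>xs. xs \<in> tuples A n \<Longrightarrow> f xs = g xs" "xs \<in> tuples A (Suc n)"
    and "\<And>x y. x \<in> carrier A \<Longrightarrow> y \<in> carrier A \<Longrightarrow> br x y \<in> carrier A"
  shows "cartan_coboundary br M rL rR n f xs = cartan_coboundary br M rL rR n g xs"
  using assms(1,2)
proof (induction n arbitrary: f g xs)
  case 0
  then show ?case by (simp add: tuples_0)
next
  case (Suc n)
  obtain y ys where y: "xs = y # ys" "y \<in> carrier A" "ys \<in> tuples A (Suc n)"
    using Suc.prems(2) by (rule tuples_SucE)
  have "cartan_coboundary br M rL rR n (\<lambda>zs. f (y # zs)) ys =
      cartan_coboundary br M rL rR n (\<lambda>zs. g (y # zs)) ys"
    using Suc.prems y by (intro Suc.IH) auto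
  moreover have "lie_derivative br M rL y f ys = lie_derivative br M rL y g ys"
    using Suc.prems y assms(3) by (intro lie_derivative_cong) auto
  ultimately show ?case using y by simp
qed

locale bilinear_actions = A: vectorspace K A + M: vectorspace K M
  for K :: "('k, 'x) ring_scheme" and A :: "('k, 'a, 'p) module_scheme"
    and M :: "('k, 'm, 'q) module_scheme" +
  fixes br :: "'a \<Rightarrow> 'a \<Rightarrow> 'a" and rL rR :: "'a \<Rightarrow> 'm \<Rightarrow> 'm"
  assumes br_bilinear: "bilinear_map K A A A br"
    and rL_bilinear: "bilinear_map K A M M rL"
    and rR_bilinear: "bilinear_map K A M M rR"
begin

abbreviation "L \<equiv> lie_derivative br M rL"
abbreviation "D \<equiv> cartan_coboundary br M rL rR"
abbreviation "ml \<equiv> multilinear K A M"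

lemma br_hom1: "y \<in> carrier A \<Longrightarrow> (\<lambda>x. br x y) \<in> LinearCombinations.module_hom K A A"
  and br_hom2: "x \<in> carrier A \<Longrightarrow> br x \<in> LinearCombinations.module_hom K A A"
  and rL_hom1: "m \<in> carrier M \<Longrightarrow> (\<lambda>x. rL x m) \<in> LinearCombinations.module_hom K A M"
  and rL_hom2: "x \<in> carrier A \<Longrightarrow> rL x \<in> LinearCombinations.module_hom K M M"
  and rR_hom1: "m \<in> carrier M \<Longrightarrow> (\<lambda>x. rR x m) \<in> LinearCombinations.module_hom K A M"
  and rR_hom2: "x \<in> carrier A \<Longrightarrow> rR x \<in> LinearCombinations.module_hom K M M"
  using br_bilinear rL_bilinear rR_bilinear by (auto simp: bilinear_map_def)

lemma br_closed [simp]: "x \<in> carrier A \<Longrightarrow> y \<in> carrier A \<Longrightarrow> br x y \<in> carrier A"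
  using module_hom_carrier[OF br_hom2] .

lemma rL_closed [simp]: "x \<in> carrier A \<Longrightarrow> m \<in> carrier M \<Longrightarrow> rL x m \<in> carrier M"
  using module_hom_carrier[OF rL_hom2] .

lemma rR_closed [simp]: "x \<in> carrier A \<Longrightarrow> m \<in> carrier M \<Longrightarrow> rR x m \<in> carrier M"
  using module_hom_carrier[OF rR_hom2] .

lemma rL_minus: "x \<in> carrier A \<Longrightarrow> m \<in> carrier M \<Longrightarrow> m' \<in> carrier M \<Longrightarrow>
    rL x (m \<ominus>\<^bsub>M\<^esub> m') = rL x m \<ominus>\<^bsub>M\<^esub> rL x m'"
  using module_hom_minus[OF M.vectorspace_axioms M.vectorspace_axioms rL_hom2] .

lemma lie_derivative_family:
  assumes "vectorspace K B" "x \<in> carrier A" "\<And>y. y \<in> carrier B \<Longrightarrow> ml n (F y)"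
    and "\<And>xs. xs \<in> tuples A n \<Longrightarrow> (\<lambda>y. F y xs) \<in> LinearCombinations.module_hom K B M"
    and "xs \<in> tuples A n"
  shows "(\<lambda>y. L x (F y) xs) \<in> LinearCombinations.module_hom K B M"
  using assms(3-5)
proof (induction n arbitrary: F xs)
  case 0
  then show ?case using module_hom_comp[OF _ rL_hom2[OF assms(2)]] by (simp add: tuples_0)
next
  case (Suc n)
  obtain z zs where z: "xs = z # zs" "z \<in> carrier A" "zs \<in> tuples A n"
    using Suc.prems(3) by (rule tuples_SucE)
  have "(\<lambda>y. L x (\<lambda>ws. F y (z # ws)) zs) \<in> LinearCombinations.module_hom K B M"
    using Suc.prems z by (intro Suc.IH) auto
  moreover have "(\<lambda>y. F y (br x z # zs)) \<in> LinearCombinations.module_hom K B M"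
    using Suc.prems z assms(2) by auto
  ultimately show ?case
    using z module_hom_minus_fun[OF assms(1) M.vectorspace_axioms] by simp
qed

lemma lie_derivative_multilinear:
  assumes x: "x \<in> carrier A" and f: "ml n f"
  shows "ml n (L x f)"
  using f
proof (induction n arbitrary: f)
  case 0
  then show ?case using x by simp
next
  case (Suc n)
  have "ml n (\<lambda>xs. L x f (y # xs))" if y: "y \<in> carrier A" for y
    using Suc.prems Suc.IH[of "\<lambda>zs. f (y # zs)"] y x
    by (simp add: multilinear_minus[OF A.vectorspace_axioms M.vectorspace_axioms])
  moreover have "(\<lambda>y. L x f (y # xs)) \<in> LinearCombinations.module_hom K A M"
    if xs: "xs \<in> tuples A n" for xs
  proof -
    have "(\<lambda>y. L x (\<lambda>zs. f (y # zs)) xs) \<in> LinearCombinations.module_hom K A M"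
      using Suc.prems xs x by (intro lie_derivative_family[OF A.vectorspace_axioms]) auto
    moreover have "(\<lambda>y. f (br x y # xs)) \<in> LinearCombinations.module_hom K A M"
      using Suc.prems xs module_hom_comp[OF br_hom2[OF x], of "\<lambda>y. f (y # xs)" M] by simp
    ultimately show ?thesis
      using module_hom_minus_fun[OF A.vectorspace_axioms M.vectorspace_axioms] by simp
  qed
  ultimately show ?case by simp
qed

lemma lie_derivative_closed:
  "x \<in> carrier A \<Longrightarrow> ml n f \<Longrightarrow> xs \<in> tuples A n \<Longrightarrow> L x f xs \<in> carrier M"
  by (rule multilinear_carrier[OF lie_derivative_multilinear])

lemma lie_derivative_hom:
  assumes "ml n f" "xs \<in> tuples A n"
  shows "(\<lambda>x. L x f xs) \<in> LinearCombinations.module_hom K A M"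
  using assms
proof (induction n arbitrary: f xs)
  case 0
  then show ?case using rL_hom1 by (simp add: tuples_0)
next
  case (Suc n)
  obtain z zs where z: "xs = z # zs" "z \<in> carrier A" "zs \<in> tuples A n"
    using Suc.prems(2) by (rule tuples_SucE)
  have "(\<lambda>x. L x (\<lambda>ws. f (z # ws)) zs) \<in> LinearCombinations.module_hom K A M"
    using Suc.prems z by (intro Suc.IH) auto
  moreover have "(\<lambda>x. f (br x z # zs)) \<in> LinearCombinations.module_hom K A M"
    using Suc.prems z module_hom_comp[OF br_hom1[OF z(2)], of "\<lambda>y. f (y # zs)" M] by simp
  ultimately show ?case
    using z module_hom_minus_fun[OF A.vectorspace_axioms M.vectorspace_axioms] by simp
qed

lemma coboundary_family:
  assumes "vectorspace K B" "\<And>y. y \<in> carrier B \<Longrightarrow> ml n (F y)"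
    and "\<And>xs. xs \<in> tuples A n \<Longrightarrow> (\<lambda>y. F y xs) \<in> LinearCombinations.module_hom K B M"
    and "xs \<in> tuples A (Suc n)"
  shows "(\<lambda>y. D n (F y) xs) \<in> LinearCombinations.module_hom K B M"
  using assms(2-4)
proof (induction n arbitrary: F xs)
  case 0
  then obtain x where x: "xs = [x]" "x \<in> carrier A" by (auto elim!: tuples_SucE simp: tuples_0)
  then show ?case
    using 0 module_hom_comp[OF _ rR_hom2[OF x(2)], of "\<lambda>y. F y []" B]
      module_hom_uminus_fun[OF assms(1) M.vectorspace_axioms, of "\<lambda>y. rR x (F y [])"]
    by (simp add: tuples_0)
next
  case (Suc n)
  obtain z zs where z: "xs = z # zs" "z \<in> carrier A" "zs \<in> tuples A (Suc n)"
    using Suc.prems(3) by (rule tuples_SucE)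
  have "(\<lambda>y. L z (F y) zs) \<in> LinearCombinations.module_hom K B M"
    using Suc.prems z by (intro lie_derivative_family[OF assms(1)]) auto
  moreover have "(\<lambda>y. D n (\<lambda>ws. F y (z # ws)) zs) \<in> LinearCombinations.module_hom K B M"
    using Suc.prems z by (intro Suc.IH) auto
  ultimately show ?case
    using z module_hom_minus_fun[OF assms(1) M.vectorspace_axioms] by simp
qed

lemma coboundary_multilinear: "ml n f \<Longrightarrow> ml (Suc n) (D n f)"
proof (induction n arbitrary: f)
  case 0
  then show ?case
    using module_hom_uminus_fun[OF A.vectorspace_axioms M.vectorspace_axioms rR_hom1]
    by (simp add: tuples_0)
next
  case (Suc n)
  have "ml (Suc n) (\<lambda>xs. D (Suc n) f (x # xs))" if x: "x \<in> carrier A" for x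
    using multilinear_minus[OF A.vectorspace_axioms M.vectorspace_axioms
        lie_derivative_multilinear[OF x Suc.prems] Suc.IH[of "\<lambda>zs. f (x # zs)"]] Suc.prems x
    by simp
  moreover have "(\<lambda>x. D (Suc n) f (x # xs)) \<in> LinearCombinations.module_hom K A M"
    if xs: "xs \<in> tuples A (Suc n)" for xs
  proof -
    have "(\<lambda>x. D n (\<lambda>zs. f (x # zs)) xs) \<in> LinearCombinations.module_hom K A M"
      using Suc.prems xs by (intro coboundary_family[OF A.vectorspace_axioms]) auto
    then show ?thesis
      using lie_derivative_hom[OF Suc.prems xs]
        module_hom_minus_fun[OF A.vectorspace_axioms M.vectorspace_axioms] by simp
  qed
  ultimately show ?case
    by (simp del: cartan_coboundary.simps multilinear.simps
        add: multilinear.simps(2)[of _ _ _ "Suc n"])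
qed

lemma coboundary_closed:
  "ml n f \<Longrightarrow> xs \<in> tuples A (Suc n) \<Longrightarrow> D n f xs \<in> carrier M"
  by (rule multilinear_carrier[OF coboundary_multilinear])

lemma minus_diff_diff:
  "\<lbrakk>a \<in> carrier M; b \<in> carrier M; c \<in> carrier M; d \<in> carrier M\<rbrakk> \<Longrightarrow>
    (a \<ominus>\<^bsub>M\<^esub> b) \<ominus>\<^bsub>M\<^esub> (c \<ominus>\<^bsub>M\<^esub> d) = (a \<ominus>\<^bsub>M\<^esub> c) \<ominus>\<^bsub>M\<^esub> (b \<ominus>\<^bsub>M\<^esub> d)"
  by (simp add: a_minus_def M.M.minus_add M.M.a_ac)

lemma lie_derivative_minus:
  assumes "x \<in> carrier A" "ml n f" "ml n g" "xs \<in> tuples A n"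
  shows "L x (\<lambda>xs. f xs \<ominus>\<^bsub>M\<^esub> g xs) xs = L x f xs \<ominus>\<^bsub>M\<^esub> L x g xs"
  using assms(2-4)
proof (induction n arbitrary: f g xs)
  case 0
  then show ?case using assms(1) by (simp add: tuples_0 rL_minus)
next
  case (Suc n)
  obtain z zs where z: "xs = z # zs" "z \<in> carrier A" "zs \<in> tuples A n"
    using Suc.prems(3) by (rule tuples_SucE)
  have fg: "ml n (\<lambda>ws. f (z # ws))" "ml n (\<lambda>ws. g (z # ws))"
    using Suc.prems z by auto
  show ?case
    using Suc.IH[OF fg z(3)] z assms(1) lie_derivative_closed[OF assms(1) fg(1) z(3)]
      lie_derivative_closed[OF assms(1) fg(2) z(3)]
      multilinear_carrier[OF Suc.prems(1), of "br x z # zs"]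
      multilinear_carrier[OF Suc.prems(2), of "br x z # zs"]
    by (simp add: minus_diff_diff)
qed

lemma coboundary_minus:
  assumes "ml n f" "ml n g" "xs \<in> tuples A (Suc n)"
  shows "D n (\<lambda>xs. f xs \<ominus>\<^bsub>M\<^esub> g xs) xs = D n f xs \<ominus>\<^bsub>M\<^esub> D n g xs"
  using assms
proof (induction n arbitrary: f g xs)
  case 0
  then obtain x where x: "xs = [x]" "x \<in> carrier A" by (auto elim!: tuples_SucE simp: tuples_0)
  then show ?case
    using 0 module_hom_minus[OF M.vectorspace_axioms M.vectorspace_axioms rR_hom2[OF x(2)]]
    by (simp add: a_minus_def M.M.minus_add)
next
  case (Suc n)
  obtain z zs where z: "xs = z # zs" "z \<in> carrier A" "zs \<in> tuples A (Suc n)"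
    using Suc.prems(3) by (rule tuples_SucE)
  have fg: "ml n (\<lambda>ws. f (z # ws))" "ml n (\<lambda>ws. g (z # ws))"
    using Suc.prems z by auto
  show ?case
    using Suc.IH[OF fg z(3)] z lie_derivative_minus[OF z(2) Suc.prems(1,2) z(3)]
      coboundary_closed[OF fg(1) z(3)] coboundary_closed[OF fg(2) z(3)]
      lie_derivative_closed[OF z(2) Suc.prems(1) z(3)]
      lie_derivative_closed[OF z(2) Suc.prems(2) z(3)]
    by (simp add: minus_diff_diff)
qed

end

locale leibniz_actions = bilinear_actions +
  assumes leibniz: "\<lbrakk>x \<in> carrier A; y \<in> carrier A; z \<in> carrier A\<rbrakk>
      \<Longrightarrow> br x (br y z) = br (br x y) z \<oplus>\<^bsub>A\<^esub> br y (br x z)"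
    and rL_bracket: "\<lbrakk>x \<in> carrier A; y \<in> carrier A; v \<in> carrier M\<rbrakk>
      \<Longrightarrow> rL (br x y) v = rL x (rL y v) \<ominus>\<^bsub>M\<^esub> rL y (rL x v)"
    and rR_bracket: "\<lbrakk>x \<in> carrier A; y \<in> carrier A; v \<in> carrier M\<rbrakk>
      \<Longrightarrow> rR (br x y) v = rL x (rR y v) \<ominus>\<^bsub>M\<^esub> rR y (rL x v)"
    and rR_rL: "\<lbrakk>x \<in> carrier A; y \<in> carrier A; v \<in> carrier M\<rbrakk>
      \<Longrightarrow> rR y (rL x v) = \<ominus>\<^bsub>M\<^esub> (rR y (rR x v))"
begin

lemma lie_derivative_bracket:
  assumes "x \<in> carrier A" "y \<in> carrier A" "ml n f" "xs \<in> tuples A n"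
  shows "L x (L y f) xs = L y (L x f) xs \<oplus>\<^bsub>M\<^esub> L (br x y) f xs"
  using assms(3,4)
proof (induction n arbitrary: f xs)
  case 0
  then show ?case
    using assms(1,2)
    by (simp add: tuples_0 rL_bracket a_minus_def M.M.a_ac M.M.r_neg2 M.M.r_neg1 M.M.r_neg)
next
  case (Suc n)
  obtain z zs where z: "xs = z # zs" "z \<in> carrier A" "zs \<in> tuples A n"
    using Suc.prems(2) by (rule tuples_SucE)
  let ?f = "\<lambda>z zs. f (z # zs)"
  have f: "ml n (?f u)" if "u \<in> carrier A" for u using Suc.prems(1) that by simp
  have unfold: "L u (L v f) xs =
      (L u (L v (?f z)) zs \<ominus>\<^bsub>M\<^esub> L u (?f (br v z)) zs) \<ominus>\<^bsub>M\<^esub>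
      (L v (?f (br u z)) zs \<ominus>\<^bsub>M\<^esub> f (br v (br u z) # zs))"
    if "u \<in> carrier A" "v \<in> carrier A" for u v
    using that z f lie_derivative_minus[of u n "L v (?f z)" "?f (br v z)" zs]
    by (simp add: lie_derivative_multilinear)
  have hom: "(\<lambda>w. f (w # zs)) \<in> LinearCombinations.module_hom K A M"
    using Suc.prems(1) z by simp
  have add: "f (br x (br y z) # zs) =
      f (br (br x y) z # zs) \<oplus>\<^bsub>M\<^esub> f (br y (br x z) # zs)"
    unfolding leibniz[OF assms(1,2) z(2)]
    using LinearCombinations.module_hom_add[OF hom, of "br (br x y) z" "br y (br x z)"]
      z assms(1,2) by simp
  define p q r s t w e where "p = L y (L x (?f z)) zs" and "q = L x (?f (br y z)) zs"
    and "r = L y (?f (br x z)) zs" and "s = f (br y (br x z) # zs)"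
    and "t = L (br x y) (?f z) zs" and "w = f (br (br x y) z # zs)" and "e = t \<ominus>\<^bsub>M\<^esub> w"
  have c: "p \<in> carrier M" "q \<in> carrier M" "r \<in> carrier M" "s \<in> carrier M" "t \<in> carrier M"
    "w \<in> carrier M" "e \<in> carrier M"
    using f z assms(1,2) multilinear_carrier[OF Suc.prems(1), of "_ # zs"]
      lie_derivative_closed[where n = n]
    by (auto simp: p_def q_def r_def s_def t_def w_def e_def lie_derivative_multilinear)
  have t: "t = e \<oplus>\<^bsub>M\<^esub> w" using c by (simp add: e_def a_minus_def M.M.a_assoc M.M.l_neg)
  have "L x (L y f) xs = ((p \<oplus>\<^bsub>M\<^esub> t) \<ominus>\<^bsub>M\<^esub> q) \<ominus>\<^bsub>M\<^esub> (r \<ominus>\<^bsub>M\<^esub> s)"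
    using unfold[OF assms(1,2)] Suc.IH[OF f z(3), of z] z
    by (simp add: p_def q_def r_def s_def t_def)
  also have "\<dots> = ((p \<ominus>\<^bsub>M\<^esub> r) \<ominus>\<^bsub>M\<^esub> (q \<ominus>\<^bsub>M\<^esub> (w \<oplus>\<^bsub>M\<^esub> s))) \<oplus>\<^bsub>M\<^esub> e"
    unfolding t using c(1-4,6,7) by (simp add: a_minus_def M.M.minus_add M.M.a_ac)
  also have "\<dots> = L y (L x f) xs \<oplus>\<^bsub>M\<^esub> L (br x y) f xs"
    using unfold[OF assms(2,1)] add z
    by (simp add: p_def q_def r_def s_def t_def w_def e_def)
  finally show ?case .
qed

lemma lie_derivative_coboundary:
  assumes "x \<in> carrier A" "ml n f" "xs \<in> tuples A (Suc n)"
  shows "L x (D n f) xs = D n (L x f) xs"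
  using assms(2,3)
proof (induction n arbitrary: f xs)
  case 0
  then obtain y where y: "xs = [y]" "y \<in> carrier A" by (auto elim!: tuples_SucE simp: tuples_0)
  define u v where "u = rL x (rR y (f []))" and "v = rR y (rL x (f []))"
  have uv: "u \<in> carrier M" "v \<in> carrier M" using 0 y assms(1) by (auto simp: u_def v_def)
  have "rL x (\<ominus>\<^bsub>M\<^esub> rR y (f [])) = \<ominus>\<^bsub>M\<^esub> u"
    using rL_minus[of x "\<zero>\<^bsub>M\<^esub>" "rR y (f [])"] 0 y assms(1)
      module_hom_zero[OF M.vectorspace_axioms M.vectorspace_axioms rL_hom2[OF assms(1)]]
    by (simp add: u_def a_minus_def)
  moreover have "rR (br x y) (f []) = u \<ominus>\<^bsub>M\<^esub> v"
    using 0 y assms(1) by (simp add: rR_bracket u_def v_def)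
  ultimately show ?case
    using y uv by (simp add: v_def[symmetric] a_minus_def M.M.minus_add M.M.r_neg1)
next
  case (Suc n)
  obtain y ys where y: "xs = y # ys" "y \<in> carrier A" "ys \<in> tuples A (Suc n)"
    using Suc.prems(2) by (rule tuples_SucE)
  let ?f = "\<lambda>z zs. f (z # zs)"
  have f: "ml n (?f u)" if "u \<in> carrier A" for u using Suc.prems(1) that by simp
  note ml = lie_derivative_multilinear coboundary_multilinear
  define p q r s where "p = L y (L x f) ys" and "q = D n (L x (?f y)) ys"
    and "r = L (br x y) f ys" and "s = D n (?f (br x y)) ys"
  have c: "p \<in> carrier M" "q \<in> carrier M" "r \<in> carrier M" "s \<in> carrier M"
    unfolding p_def q_def r_def s_def
    using f y assms(1) Suc.prems(1) ml
    by (auto simp del: multilinear.simps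
        intro: lie_derivative_closed[where n = "Suc n"] coboundary_closed[where n = n])
  have "L x (D (Suc n) f) xs = L x (\<lambda>zs. L y f zs \<ominus>\<^bsub>M\<^esub> D n (?f y) zs) ys \<ominus>\<^bsub>M\<^esub> (r \<ominus>\<^bsub>M\<^esub> s)"
    using y by (simp add: r_def s_def)
  also have "L x (\<lambda>zs. L y f zs \<ominus>\<^bsub>M\<^esub> D n (?f y) zs) ys = L x (L y f) ys \<ominus>\<^bsub>M\<^esub> L x (D n (?f y)) ys"
    by (rule lie_derivative_minus[OF assms(1) lie_derivative_multilinear[OF y(2) Suc.prems(1)]
          coboundary_multilinear[OF f[OF y(2)]] y(3)])
  also have "L x (L y f) ys = p \<oplus>\<^bsub>M\<^esub> r"
    using lie_derivative_bracket[OF assms(1) y(2) Suc.prems(1) y(3)] by (simp add: p_def r_def)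
  also have "L x (D n (?f y)) ys = q"
    using Suc.IH[OF f[OF y(2)] y(3)] by (simp add: q_def)
  also have "((p \<oplus>\<^bsub>M\<^esub> r) \<ominus>\<^bsub>M\<^esub> q) \<ominus>\<^bsub>M\<^esub> (r \<ominus>\<^bsub>M\<^esub> s) = (r \<oplus>\<^bsub>M\<^esub> (p \<ominus>\<^bsub>M\<^esub> (q \<ominus>\<^bsub>M\<^esub> s))) \<ominus>\<^bsub>M\<^esub> r"
    using c by (simp add: a_minus_def M.M.minus_add M.M.a_ac)
  also have "\<dots> = p \<ominus>\<^bsub>M\<^esub> (q \<ominus>\<^bsub>M\<^esub> s)"
    using c by (simp add: a_minus_def[of M "_ \<oplus>\<^bsub>M\<^esub> _"] M.M.a_comm[of r] M.M.a_assoc M.M.r_neg)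
  also have "q \<ominus>\<^bsub>M\<^esub> s = D n (\<lambda>zs. L x f (y # zs)) ys"
    using coboundary_minus[of n "L x (?f y)" "?f (br x y)" ys] f y assms(1) ml
    by (simp add: q_def s_def)
  finally show ?case using y by (simp add: p_def)
qed

lemma coboundary_coboundary:
  assumes "ml n f" "xs \<in> tuples A (Suc (Suc n))"
  shows "D (Suc n) (D n f) xs = \<zero>\<^bsub>M\<^esub>"
  using assms
proof (induction n arbitrary: f xs)
  case 0
  then obtain x y where x: "xs = [x, y]" "x \<in> carrier A" "y \<in> carrier A"
    by (auto elim!: tuples_SucE simp: tuples_0)
  have "L x (D 0 f) [y] = D 0 (L x f) [y]"
    using 0 x by (intro lie_derivative_coboundary) auto
  moreover have "rR y (\<ominus>\<^bsub>M\<^esub> rR x (f [])) = \<ominus>\<^bsub>M\<^esub> rR y (rR x (f []))"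
    using module_hom_minus[OF M.vectorspace_axioms M.vectorspace_axioms rR_hom2[OF x(3)],
        of "\<zero>\<^bsub>M\<^esub>" "rR x (f [])"] 0 x
      module_hom_zero[OF M.vectorspace_axioms M.vectorspace_axioms rR_hom2[OF x(3)]]
    by (simp add: a_minus_def)
  ultimately show ?case
    using 0 x by (simp add: rR_rL)
next
  case (Suc n)
  obtain x ys where x: "xs = x # ys" "x \<in> carrier A" "ys \<in> tuples A (Suc (Suc n))"
    using Suc.prems(2) by (rule tuples_SucE)
  have f: "ml n (\<lambda>zs. f (x # zs))" using Suc.prems(1) x(2) by simp
  have "D (Suc (Suc n)) (D (Suc n) f) xs = L x (D (Suc n) f) ys \<ominus>\<^bsub>M\<^esub>
      D (Suc n) (\<lambda>zs. L x f zs \<ominus>\<^bsub>M\<^esub> D n (\<lambda>zs. f (x # zs)) zs) ys"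
    unfolding cartan_coboundary.simps(2)[of _ _ _ _ "Suc n"] using x by simp
  also have "D (Suc n) (\<lambda>zs. L x f zs \<ominus>\<^bsub>M\<^esub> D n (\<lambda>zs. f (x # zs)) zs) ys =
      D (Suc n) (L x f) ys \<ominus>\<^bsub>M\<^esub> D (Suc n) (D n (\<lambda>zs. f (x # zs))) ys"
    using lie_derivative_multilinear[OF x(2) Suc.prems(1)] coboundary_multilinear[OF f] x(3)
    by (rule coboundary_minus)
  also have "D (Suc n) (D n (\<lambda>zs. f (x # zs))) ys = \<zero>\<^bsub>M\<^esub>"
    using f x(3) by (rule Suc.IH)
  also have "D (Suc n) (L x f) ys = L x (D (Suc n) f) ys"
    using lie_derivative_coboundary[OF x(2) Suc.prems(1) x(3)] by simp
  finally show ?case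
    using lie_derivative_closed[OF x(2) coboundary_multilinear[OF Suc.prems(1)] x(3)]
    by (simp del: cartan_coboundary.simps lie_derivative.simps)
qed

end

lemma omit_Cons_Suc [simp]: "omit (Suc i) (x # xs) = x # omit i xs"
  by (simp add: omit_def)

lemma omit_0_Cons [simp]: "omit 0 (x # xs) = xs"
  by (simp add: omit_def)

lemma omit_tuples:
  assumes "xs \<in> tuples A (Suc n)" "i \<le> n"
  shows "omit i xs \<in> tuples A n"
  using assms set_take_subset[of i xs] set_drop_subset[of "Suc i" xs]
  by (auto simp: tuples_def omit_def)

lemma update_tuples: "xs \<in> tuples A n \<Longrightarrow> v \<in> carrier A \<Longrightarrow> xs[i := v] \<in> tuples A n"
  using set_update_subset_insert[of xs i v] by (auto simp: tuples_def)

lemma nth_tuples: "xs \<in> tuples A n \<Longrightarrow> i < n \<Longrightarrow> xs ! i \<in> carrier A"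
  by (auto simp: tuples_def)

lemma take_tuples: "xs \<in> tuples A (Suc n) \<Longrightarrow> take n xs \<in> tuples A n"
  using set_take_subset[of n xs] by (auto simp: tuples_def)

context bilinear_actions
begin

lemma signed_closed [simp]: "m \<in> carrier M \<Longrightarrow> signed M i m \<in> carrier M"
  by (simp add: signed_def)

lemma signed_Suc: "m \<in> carrier M \<Longrightarrow> signed M (Suc i) m = \<ominus>\<^bsub>M\<^esub> signed M i m"
  by (simp add: signed_def)

lemma lie_derivative_sum:
  assumes "x \<in> carrier A" "ml n f" "ys \<in> tuples A n"
  shows "L x f ys = rL x (f ys) \<oplus>\<^bsub>M\<^esub> (\<Oplus>\<^bsub>M\<^esub>j\<in>{..<n}. \<ominus>\<^bsub>M\<^esub> f (ys[j := br x (ys ! j)]))"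
  using assms(2,3)
proof (induction n arbitrary: f ys)
  case 0
  then show ?case using assms(1) by (simp add: tuples_0)
next
  case (Suc n)
  obtain z zs where z: "ys = z # zs" "z \<in> carrier A" "zs \<in> tuples A n"
    using Suc.prems(2) by (rule tuples_SucE)
  have f: "ml n (\<lambda>ws. f (z # ws))" using Suc.prems(1) z by simp
  note fc = multilinear_carrier[OF Suc.prems(1)]
  have t: "ys[j := br x (ys ! j)] \<in> tuples A (Suc n)" if "j < Suc n" for j
    using that Suc.prems(2) assms(1) by (intro update_tuples br_closed nth_tuples)
  have c: "(\<lambda>j. \<ominus>\<^bsub>M\<^esub> f (ys[j := br x (ys ! j)])) \<in> {..<Suc n} \<rightarrow> carrier M"
    using fc[OF t] by auto
  let ?S = "\<Oplus>\<^bsub>M\<^esub>j\<in>{..<n}. \<ominus>\<^bsub>M\<^esub> f (z # zs[j := br x (zs ! j)])"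
  have S: "?S \<in> carrier M"
    using c z by (intro M.M.finsum_closed) (auto dest: funcset_mem[of _ _ _ "Suc _"])
  have "(\<Oplus>\<^bsub>M\<^esub>j\<in>{..<Suc n}. \<ominus>\<^bsub>M\<^esub> f (ys[j := br x (ys ! j)])) =
      \<ominus>\<^bsub>M\<^esub> f (br x z # zs) \<oplus>\<^bsub>M\<^esub> ?S"
    unfolding M.M.finsum_lessThan_Suc_shift[OF c] using z by simp
  moreover have "L x f ys = (rL x (f ys) \<oplus>\<^bsub>M\<^esub> ?S) \<ominus>\<^bsub>M\<^esub> f (br x z # zs)"
    using Suc.IH[OF f z(3)] z by simp
  ultimately show ?case
    using fc[of "br x z # zs"] fc[of ys] S z assms(1)
    by (simp add: a_minus_def M.M.a_ac)
qed

lemma lp_sum_eq: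
  assumes "ml k f" "xs \<in> tuples A (Suc k)"
  shows "(\<Oplus>\<^bsub>M\<^esub>i\<in>{..<k}. signed M i (rL (xs ! i) (f (omit i xs))))
     \<oplus>\<^bsub>M\<^esub> signed M (Suc k) (rR (xs ! k) (f (take k xs)))
     \<oplus>\<^bsub>M\<^esub> (\<Oplus>\<^bsub>M\<^esub>i\<in>{..<Suc k}. \<Oplus>\<^bsub>M\<^esub>j\<in>{i<..k}.
           signed M (Suc i) (f (omit i (xs[j := br (xs ! i) (xs ! j)])))) = D k f xs"
  using assms
proof (induction k arbitrary: f xs)
  case 0
  then obtain x where x: "xs = [x]" "x \<in> carrier A" by (auto elim!: tuples_SucE simp: tuples_0)
  then show ?case using 0 by (simp add: signed_def)
next
  case (Suc k)
  obtain x ys where x: "xs = x # ys" "x \<in> carrier A" "ys \<in> tuples A (Suc k)"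
    using Suc.prems(2) by (rule tuples_SucE)
  let ?g = "\<lambda>zs. f (x # zs)"
  have g: "ml k ?g" using Suc.prems(1) x by simp
  note fc = multilinear_carrier[OF Suc.prems(1)] and gc = multilinear_carrier[OF g]
  let ?P = "\<Oplus>\<^bsub>M\<^esub>i\<in>{..<k}. signed M i (rL (ys ! i) (?g (omit i ys)))"
  let ?Q = "signed M (Suc k) (rR (ys ! k) (?g (take k ys)))"
  let ?r = "\<lambda>i j. signed M (Suc i) (?g (omit i (ys[j := br (ys ! i) (ys ! j)])))"
  let ?R = "\<Oplus>\<^bsub>M\<^esub>i\<in>{..<Suc k}. \<Oplus>\<^bsub>M\<^esub>j\<in>{i<..k}. ?r i j"
  have p: "signed M i (rL (ys ! i) (?g (omit i ys))) \<in> carrier M" if "i < k" for i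
    using that x gc[OF omit_tuples[OF x(3)]] nth_tuples[OF x(3)] by simp
  have q: "?Q \<in> carrier M"
    using x gc[OF take_tuples[OF x(3)]] nth_tuples[OF x(3)] by simp
  have upd: "ys[j := br (ys ! i) (ys ! j)] \<in> tuples A (Suc k)" if "i \<le> k" "j \<le> k" for i j
    using that x(3) by (intro update_tuples br_closed nth_tuples) auto
  have r: "?r i j \<in> carrier M" if "i \<le> k" "j \<le> k" for i j
    using that gc[OF omit_tuples[OF upd]] by simp
  have rs: "(\<Oplus>\<^bsub>M\<^esub>j\<in>{i<..k}. ?r i j) \<in> carrier M" if "i \<le> k" for i
    using r that by (intro M.M.finsum_closed) auto
  have P: "?P \<in> carrier M" and R: "?R \<in> carrier M"
    using p rs by (auto intro!: M.M.finsum_closed)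
  have "(\<Oplus>\<^bsub>M\<^esub>i\<in>{..<Suc k}. signed M i (rL (xs ! i) (f (omit i xs)))) =
      rL x (f ys) \<oplus>\<^bsub>M\<^esub> (\<Oplus>\<^bsub>M\<^esub>i\<in>{..<k}. \<ominus>\<^bsub>M\<^esub> signed M i (rL (ys ! i) (?g (omit i ys))))"
  proof -
    have eq: "signed M (Suc i) (rL (xs ! Suc i) (f (omit (Suc i) xs))) =
        \<ominus>\<^bsub>M\<^esub> signed M i (rL (ys ! i) (?g (omit i ys)))" if "i < k" for i
      using that x gc[OF omit_tuples[OF x(3)]] nth_tuples[OF x(3)] by (simp add: signed_Suc)
    have c0: "signed M 0 (rL (xs ! 0) (f (omit 0 xs))) = rL x (f ys)"
      using x by (simp add: signed_def)
    have "(\<lambda>i. signed M i (rL (xs ! i) (f (omit i xs)))) \<in> {..<Suc k} \<rightarrow> carrier M"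
    proof
      fix i assume "i \<in> {..<Suc k}"
      then show "signed M i (rL (xs ! i) (f (omit i xs))) \<in> carrier M"
        using c0 eq p x fc[OF x(3)] by (cases i) auto
    qed
    moreover have "(\<Oplus>\<^bsub>M\<^esub>i\<in>{..<k}. signed M (Suc i) (rL (xs ! Suc i) (f (omit (Suc i) xs)))) =
        (\<Oplus>\<^bsub>M\<^esub>i\<in>{..<k}. \<ominus>\<^bsub>M\<^esub> signed M i (rL (ys ! i) (?g (omit i ys))))"
      using eq p by (intro M.M.finsum_cong') auto
    ultimately show ?thesis
      unfolding c0[symmetric] by (simp only: M.M.finsum_lessThan_Suc_shift)
  qed
  also have "\<dots> = rL x (f ys) \<ominus>\<^bsub>M\<^esub> ?P"
    using p by (subst M.M.finsum_neg) (auto simp: a_minus_def)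
  finally have 1: "(\<Oplus>\<^bsub>M\<^esub>i\<in>{..<Suc k}. signed M i (rL (xs ! i) (f (omit i xs)))) =
      rL x (f ys) \<ominus>\<^bsub>M\<^esub> ?P" .
  have 2: "signed M (Suc (Suc k)) (rR (xs ! Suc k) (f (take (Suc k) xs))) = \<ominus>\<^bsub>M\<^esub> ?Q"
    using x gc[OF take_tuples[OF x(3)]] nth_tuples[OF x(3)] by (simp add: signed_Suc)
  have shift: "(\<Oplus>\<^bsub>M\<^esub>j\<in>{Suc i<..Suc k}. F j) = (\<Oplus>\<^bsub>M\<^esub>j\<in>{i<..k}. F (Suc j))"
    if "\<And>j. i < j \<Longrightarrow> j \<le> k \<Longrightarrow> F (Suc j) \<in> carrier M" for F i
  proof -
    have "{Suc i<..Suc k} = Suc ` {i<..k}" by (auto simp: image_iff gr0_conv_Suc Suc_less_eq2)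
    then show ?thesis using that by (simp add: M.M.finsum_reindex Pi_iff)
  qed
  let ?T = "\<Oplus>\<^bsub>M\<^esub>j\<in>{..<Suc k}. \<ominus>\<^bsub>M\<^esub> f (ys[j := br x (ys ! j)])"
  have t: "f (ys[j := br x (ys ! j)]) \<in> carrier M" if "j < Suc k" for j
    using that x by (intro fc update_tuples br_closed nth_tuples)
  then have T: "?T \<in> carrier M" by (auto intro!: M.M.finsum_closed)
  let ?s = "\<lambda>i j. signed M (Suc i) (f (omit i (xs[j := br (xs ! i) (xs ! j)])))"
  have s0: "(\<Oplus>\<^bsub>M\<^esub>j\<in>{0<..Suc k}. ?s 0 j) = ?T"
  proof -
    have "{0<..Suc k} = Suc ` {..<Suc k}" by (auto simp: image_iff gr0_conv_Suc less_Suc_eq_le)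
    moreover have "?s 0 (Suc j) = \<ominus>\<^bsub>M\<^esub> f (ys[j := br x (ys ! j)])" for j
      using x by (simp add: signed_def)
    ultimately show ?thesis
      using t by (simp add: M.M.finsum_reindex Pi_iff)
  qed
  have sS: "(\<Oplus>\<^bsub>M\<^esub>j\<in>{Suc i<..Suc k}. ?s (Suc i) j) = \<ominus>\<^bsub>M\<^esub> (\<Oplus>\<^bsub>M\<^esub>j\<in>{i<..k}. ?r i j)"
    if i: "i \<le> k" for i
  proof -
    have eq: "?s (Suc i) (Suc j) = \<ominus>\<^bsub>M\<^esub> ?r i j" if "j \<le> k" for j
      using that i x gc[OF omit_tuples[OF upd]] by (simp add: signed_Suc)
    have "(\<Oplus>\<^bsub>M\<^esub>j\<in>{Suc i<..Suc k}. ?s (Suc i) j) = (\<Oplus>\<^bsub>M\<^esub>j\<in>{i<..k}. ?s (Suc i) (Suc j))"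
      using eq r i by (intro shift) auto
    also have "\<dots> = (\<Oplus>\<^bsub>M\<^esub>j\<in>{i<..k}. \<ominus>\<^bsub>M\<^esub> ?r i j)"
      using eq r i by (intro M.M.finsum_cong') auto
    also have "\<dots> = \<ominus>\<^bsub>M\<^esub> (\<Oplus>\<^bsub>M\<^esub>j\<in>{i<..k}. ?r i j)"
      using r i by (intro M.M.finsum_neg) auto
    finally show ?thesis .
  qed
  have 3: "(\<Oplus>\<^bsub>M\<^esub>i\<in>{..<Suc (Suc k)}. \<Oplus>\<^bsub>M\<^esub>j\<in>{i<..Suc k}. ?s i j) = ?T \<ominus>\<^bsub>M\<^esub> ?R"
  proof -
    have "(\<lambda>i. \<Oplus>\<^bsub>M\<^esub>j\<in>{i<..Suc k}. ?s i j) \<in> {..<Suc (Suc k)} \<rightarrow> carrier M"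
    proof
      fix i assume i: "i \<in> {..<Suc (Suc k)}"
      show "(\<Oplus>\<^bsub>M\<^esub>j\<in>{i<..Suc k}. ?s i j) \<in> carrier M"
      proof (cases i)
        case 0
        then show ?thesis using s0 T by simp
      next
        case (Suc i')
        then show ?thesis using sS[of i'] rs[of i'] i by simp
      qed
    qed
    then have "(\<Oplus>\<^bsub>M\<^esub>i\<in>{..<Suc (Suc k)}. \<Oplus>\<^bsub>M\<^esub>j\<in>{i<..Suc k}. ?s i j) =
        ?T \<oplus>\<^bsub>M\<^esub> (\<Oplus>\<^bsub>M\<^esub>i\<in>{..<Suc k}. \<Oplus>\<^bsub>M\<^esub>j\<in>{Suc i<..Suc k}. ?s (Suc i) j)"
      by (subst M.M.finsum_lessThan_Suc_shift) (simp_all only: s0)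
    also have "(\<Oplus>\<^bsub>M\<^esub>i\<in>{..<Suc k}. \<Oplus>\<^bsub>M\<^esub>j\<in>{Suc i<..Suc k}. ?s (Suc i) j) =
        (\<Oplus>\<^bsub>M\<^esub>i\<in>{..<Suc k}. \<ominus>\<^bsub>M\<^esub> (\<Oplus>\<^bsub>M\<^esub>j\<in>{i<..k}. ?r i j))"
    proof (rule M.M.finsum_cong')
      show "(\<lambda>i. \<ominus>\<^bsub>M\<^esub> (\<Oplus>\<^bsub>M\<^esub>j\<in>{i<..k}. ?r i j)) \<in> {..<Suc k} \<rightarrow> carrier M"
        using rs by (intro funcsetI M.M.a_inv_closed) simp
    qed (use sS in \<open>simp_all only: lessThan_iff less_Suc_eq_le\<close>)
    also have "\<dots> = \<ominus>\<^bsub>M\<^esub> ?R"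
      using rs by (intro M.M.finsum_neg funcsetI) simp
    finally show ?thesis by (simp only: a_minus_def)
  qed
  have L: "L x f ys = rL x (f ys) \<oplus>\<^bsub>M\<^esub> ?T"
    by (rule lie_derivative_sum[OF x(2) Suc.prems(1) x(3)])
  define a p' q' r' t' where "a = rL x (f ys)" and "p' = ?P" and "q' = ?Q" and "r' = ?R" and "t' = ?T"
  have c: "a \<in> carrier M" "p' \<in> carrier M" "q' \<in> carrier M" "r' \<in> carrier M" "t' \<in> carrier M"
    unfolding a_def p'_def q'_def r'_def t'_def using P q R T x fc[OF x(3)] by simp_all
  have "D (Suc k) f xs = (a \<oplus>\<^bsub>M\<^esub> t') \<ominus>\<^bsub>M\<^esub> (p' \<oplus>\<^bsub>M\<^esub> q' \<oplus>\<^bsub>M\<^esub> r')"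
    unfolding a_def p'_def q'_def r'_def t'_def Suc.IH[OF g x(3)] L[symmetric] by (simp add: x)
  also have "\<dots> = (a \<ominus>\<^bsub>M\<^esub> p') \<oplus>\<^bsub>M\<^esub> (\<ominus>\<^bsub>M\<^esub> q') \<oplus>\<^bsub>M\<^esub> (t' \<ominus>\<^bsub>M\<^esub> r')"
    using c by (simp add: a_minus_def M.M.minus_add M.M.a_ac)
  finally show ?case
    unfolding 1 2 3 a_def p'_def q'_def r'_def t'_def by (rule sym)
qed

lemma lp_coboundary_eq:
  assumes "ml k f"
  shows "lp_coboundary A br M rL rR k f = (\<lambda>xs\<in>tuples A (Suc k). D k f xs)"
  unfolding lp_coboundary_def
  using lp_sum_eq[OF assms]
  by (intro restrict_ext) (simp add: lessThan_Suc_atMost)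

end

section \<open>The cochain spaces\<close>

lemma multilinear_space_carrier:
  assumes "module K A"
  shows "f \<in> carrier (multilinear_space K A M n) \<longleftrightarrow>
    multilinear K A M n f \<and> f \<in> extensional (tuples A n)"
  using multilinear_iff_multilinear_maps[OF assms] by (simp add: multilinear_space_def)

lemma restrict_multilinear_space:
  assumes "module K A" "multilinear K A M n f"
  shows "(\<lambda>xs\<in>tuples A n. f xs) \<in> carrier (multilinear_space K A M n)"
  using assms multilinear_cong[of A n "\<lambda>xs\<in>tuples A n. f xs" f K M]
  by (simp add: multilinear_space_carrier)

lemma multilinear_add:
  assumes "vectorspace K A" "vectorspace K M" "multilinear K A M n f" "multilinear K A M n g"
  shows "multilinear K A M n (\<lambda>xs. f xs \<oplus>\<^bsub>M\<^esub> g xs)"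
proof -
  interpret A: vectorspace K A by fact
  interpret M: vectorspace K M by fact
  have "(\<lambda>m. \<ominus>\<^bsub>M\<^esub> m) \<in> LinearCombinations.module_hom K M M"
    by (rule module_homI) (simp_all add: M.M.minus_add M.M.a_comm M.smult_r_minus)
  then have ml: "multilinear K A M n (\<lambda>xs. f xs \<ominus>\<^bsub>M\<^esub> (\<ominus>\<^bsub>M\<^esub> g xs))"
    using multilinear_minus[OF assms(1-3) multilinear_comp[OF _ assms(4)]] by blast
  have eq: "f xs \<oplus>\<^bsub>M\<^esub> g xs = f xs \<ominus>\<^bsub>M\<^esub> (\<ominus>\<^bsub>M\<^esub> g xs)" if "xs \<in> tuples A n" for xs
    using multilinear_carrier[OF assms(4) that] by (simp add: a_minus_def)
  show ?thesis
    by (rule multilinear_cong[OF eq ml A.module_axioms])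
qed

lemma multilinear_zero:
  assumes "vectorspace K A" "vectorspace K M"
  shows "multilinear K A M n (\<lambda>xs. \<zero>\<^bsub>M\<^esub>)"
proof -
  interpret M: vectorspace K M by fact
  have "(\<lambda>x. \<zero>\<^bsub>M\<^esub>) \<in> LinearCombinations.module_hom K A M"
    by (rule module_homI) simp_all
  then show ?thesis by (induction n) simp_all
qed

lemma smult_hom:
  assumes "vectorspace K M" "a \<in> carrier K"
  shows "(\<lambda>m. a \<odot>\<^bsub>M\<^esub> m) \<in> LinearCombinations.module_hom K M M"
proof -
  interpret M: vectorspace K M by fact
  show ?thesis
    using assms(2)
    by (intro module_homI) (simp_all add: M.smult_r_distr M.smult_assoc1[symmetric] M.R.m_comm)
qed

lemma multilinear_space_vectorspace:
  assumes "vectorspace K A" "vectorspace K M"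
  shows "vectorspace K (multilinear_space K A M n)" (is "vectorspace K ?S")
proof -
  interpret A: vectorspace K A by fact
  interpret M: vectorspace K M by fact
  let ?T = "tuples A n"
  note carrier = multilinear_space_carrier[OF A.module_axioms]
  note mem = restrict_multilinear_space[OF A.module_axioms]
  have fields: "f \<oplus>\<^bsub>?S\<^esub> g = (\<lambda>xs\<in>?T. f xs \<oplus>\<^bsub>M\<^esub> g xs)" "a \<odot>\<^bsub>?S\<^esub> f = (\<lambda>xs\<in>?T. a \<odot>\<^bsub>M\<^esub> f xs)"
    "\<zero>\<^bsub>?S\<^esub> = (\<lambda>xs\<in>?T. \<zero>\<^bsub>M\<^esub>)" for f g a
    by (simp_all add: multilinear_space_def)
  have val: "f xs \<in> carrier M" if "f \<in> carrier ?S" "xs \<in> ?T" for f xs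
    using that multilinear_carrier by (auto simp: carrier)
  have eqI: "f = g" if "f \<in> carrier ?S" "g \<in> carrier ?S" "\<And>xs. xs \<in> ?T \<Longrightarrow> f xs = g xs" for f g
    using that by (auto simp: carrier intro: extensionalityI)
  have add: "f \<oplus>\<^bsub>?S\<^esub> g \<in> carrier ?S" if "f \<in> carrier ?S" "g \<in> carrier ?S" for f g
    unfolding fields using that by (intro mem multilinear_add assms) (simp_all add: carrier)
  have smult: "a \<odot>\<^bsub>?S\<^esub> f \<in> carrier ?S" if "a \<in> carrier K" "f \<in> carrier ?S" for f a
    unfolding fields
    using that
    by (intro mem multilinear_comp[OF smult_hom[OF assms(2), of a], of A n f]) (simp_all add: carrier)
  have zero: "\<zero>\<^bsub>?S\<^esub> \<in> carrier ?S"
    unfolding fields by (intro mem multilinear_zero assms)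
  have neg: "\<exists>g\<in>carrier ?S. f \<oplus>\<^bsub>?S\<^esub> g = \<zero>\<^bsub>?S\<^esub>" if "f \<in> carrier ?S" for f
  proof
    show g: "(\<ominus>\<^bsub>K\<^esub> \<one>\<^bsub>K\<^esub>) \<odot>\<^bsub>?S\<^esub> f \<in> carrier ?S" using that by (intro smult) simp_all
    show "f \<oplus>\<^bsub>?S\<^esub> (\<ominus>\<^bsub>K\<^esub> \<one>\<^bsub>K\<^esub>) \<odot>\<^bsub>?S\<^esub> f = \<zero>\<^bsub>?S\<^esub>"
      using that by (intro eqI add zero g) (simp_all add: fields val M.smult_l_minus M.M.r_neg)
  qed
  have eval: "(f \<oplus>\<^bsub>?S\<^esub> g) xs = f xs \<oplus>\<^bsub>M\<^esub> g xs" "(a \<odot>\<^bsub>?S\<^esub> f) xs = a \<odot>\<^bsub>M\<^esub> f xs"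
    "\<zero>\<^bsub>?S\<^esub> xs = \<zero>\<^bsub>M\<^esub>" if "xs \<in> ?T" for xs f g a
    using that by (simp_all add: fields)
  note [simp] = add smult zero
  show ?thesis
  proof (rule vs_criteria, safe)
    show "field K" ..
  qed (use neg in \<open>auto intro!: eqI simp: eval val M.M.a_ac M.smult_assoc1
        M.smult_l_distr M.smult_r_distr\<close>)
qed

lemma multilinear_space_eval_hom:
  assumes "module K A" "xs \<in> tuples A n"
  shows "(\<lambda>f. f xs) \<in> LinearCombinations.module_hom K (multilinear_space K A M n) M"
proof (rule module_homI)
  fix f assume "f \<in> carrier (multilinear_space K A M n)"
  then show "f xs \<in> carrier M"
    using assms(2) by (auto simp: multilinear_space_carrier[OF assms(1)] intro: multilinear_carrier)
qed (use assms(2) in \<open>simp_all add: multilinear_space_def\<close>)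

lemma multilinear_space_homI:
  assumes "module K A" "module K B" "\<And>f. f \<in> carrier B \<Longrightarrow> \<Phi> f \<in> carrier (multilinear_space K A M n)"
    and "\<And>xs. xs \<in> tuples A n \<Longrightarrow> (\<lambda>f. \<Phi> f xs) \<in> LinearCombinations.module_hom K B M"
  shows "\<Phi> \<in> LinearCombinations.module_hom K B (multilinear_space K A M n)"
proof -
  interpret B: module K B by fact
  let ?S = "multilinear_space K A M n"
  have ext: "\<Phi> f \<in> extensional (tuples A n)" if "f \<in> carrier B" for f
    using assms(3)[OF that] by (simp add: multilinear_space_carrier[OF assms(1)])
  show ?thesis
  proof (rule module_homI)
    fix f g assume "f \<in> carrier B" "g \<in> carrier B"
    then show "\<Phi> (f \<oplus>\<^bsub>B\<^esub> g) = \<Phi> f \<oplus>\<^bsub>?S\<^esub> \<Phi> g"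
      using LinearCombinations.module_hom_add[OF assms(4)] ext
      by (intro extensionalityI[of _ "tuples A n"]) (auto simp: multilinear_space_def)
  next
    fix a f assume "a \<in> carrier K" "f \<in> carrier B"
    then show "\<Phi> (a \<odot>\<^bsub>B\<^esub> f) = a \<odot>\<^bsub>?S\<^esub> \<Phi> f"
      using LinearCombinations.module_hom_smult[OF assms(4)] ext
      by (intro extensionalityI[of _ "tuples A n"]) (auto simp: multilinear_space_def)
  qed (rule assms(3))
qed

lemma pushforward_closed:
  assumes "module K A" "\<phi> \<in> LinearCombinations.module_hom K M L"
    and "f \<in> carrier (multilinear_space K A M n)"
  shows "pushforward A \<phi> n f \<in> carrier (multilinear_space K A L n)"
  unfolding pushforward_def using assms
  by (intro restrict_multilinear_space multilinear_comp[of \<phi> K M L A n f])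
    (simp_all add: multilinear_space_carrier)

lemma pushforward_hom:
  assumes "vectorspace K A" "vectorspace K M" "\<phi> \<in> LinearCombinations.module_hom K M L"
  shows "pushforward A \<phi> n \<in>
    LinearCombinations.module_hom K (multilinear_space K A M n) (multilinear_space K A L n)"
proof (rule multilinear_space_homI)
  show "module K A" using assms(1) by (simp add: vectorspace_def)
  then show "pushforward A \<phi> n f \<in> carrier (multilinear_space K A L n)"
    if "f \<in> carrier (multilinear_space K A M n)" for f
    using assms(3) that by (rule pushforward_closed)
  show "module K (multilinear_space K A M n)"
    using multilinear_space_vectorspace[OF assms(1,2)] by (simp add: vectorspace_def)
  fix xs assume "xs \<in> tuples A n"
  then show "(\<lambda>f. pushforward A \<phi> n f xs) \<in>
      LinearCombinations.module_hom K (multilinear_space K A M n) L"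
    using module_hom_comp[OF multilinear_space_eval_hom assms(3)] \<open>module K A\<close>
    by (simp add: pushforward_def)
qed

context bilinear_actions
begin

lemma lp_coboundary_closed:
  assumes "f \<in> carrier (multilinear_space K A M n)"
  shows "lp_coboundary A br M rL rR n f \<in> carrier (multilinear_space K A M (Suc n))"
proof -
  have "ml n f" using assms by (simp add: multilinear_space_carrier[OF A.module_axioms])
  then show ?thesis
    using restrict_multilinear_space[OF A.module_axioms coboundary_multilinear]
    by (simp add: lp_coboundary_eq)
qed

lemma lp_coboundary_hom:
  "lp_coboundary A br M rL rR n \<in>
    LinearCombinations.module_hom K (multilinear_space K A M n) (multilinear_space K A M (Suc n))"
proof (rule multilinear_space_homI[OF A.module_axioms _ lp_coboundary_closed])
  interpret S: vectorspace K "multilinear_space K A M n"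
    by (intro multilinear_space_vectorspace A.vectorspace_axioms M.vectorspace_axioms)
  show "module K (multilinear_space K A M n)" ..
  note ml = multilinear_space_carrier[OF A.module_axioms, of _ M n]
  fix xs assume xs: "xs \<in> tuples A (Suc n)"
  have "(\<lambda>f. D n f xs) \<in> LinearCombinations.module_hom K (multilinear_space K A M n) M"
    using xs by (intro coboundary_family[OF S.vectorspace_axioms])
      (auto simp: ml intro: multilinear_space_eval_hom[OF A.module_axioms])
  then show "(\<lambda>f. lp_coboundary A br M rL rR n f xs) \<in>
      LinearCombinations.module_hom K (multilinear_space K A M n) M"
    using S.module_axioms
    by (rule module_hom_cong) (simp add: ml lp_coboundary_eq xs)
qed simp_all

lemma lp_coboundary_natural:
  assumes "bilinear_actions K A M' br' rL' rR'"
    and \<phi>: "\<phi> \<in> LinearCombinations.module_hom K M M'"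
    and br': "\<And>x y. x \<in> carrier A \<Longrightarrow> y \<in> carrier A \<Longrightarrow> br' x y = br x y"
    and rL': "\<And>x m. x \<in> carrier A \<Longrightarrow> m \<in> carrier M \<Longrightarrow> rL' x (\<phi> m) = \<phi> (rL x m)"
    and rR': "\<And>x m. x \<in> carrier A \<Longrightarrow> m \<in> carrier M \<Longrightarrow> rR' x (\<phi> m) = \<phi> (rR x m)"
    and f: "f \<in> carrier (multilinear_space K A M n)"
  shows "pushforward A \<phi> (Suc n) (lp_coboundary A br M rL rR n f) =
    lp_coboundary A br' M' rL' rR' n (pushforward A \<phi> n f)"
proof -
  interpret M': bilinear_actions K A M' br' rL' rR' by fact
  note \<phi>_minus = module_hom_minus[OF M.vectorspace_axioms M'.M.vectorspace_axioms \<phi>]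
  have \<phi>_neg: "\<phi> (\<ominus>\<^bsub>M\<^esub> m) = \<ominus>\<^bsub>M'\<^esub> \<phi> m" if "m \<in> carrier M" for m
    using \<phi>_minus[of "\<zero>\<^bsub>M\<^esub>" m] that module_hom_carrier[OF \<phi>]
      module_hom_zero[OF M.vectorspace_axioms M'.M.vectorspace_axioms \<phi>]
    by (simp add: a_minus_def)
  have L: "\<phi> (L x g xs) = M'.L x (\<lambda>xs. \<phi> (g xs)) xs"
    if "x \<in> carrier A" "ml k g" "xs \<in> tuples A k" for x k g xs
    using that(2,3)
  proof (induction k arbitrary: g xs)
    case 0
    then show ?case using that(1) by (simp add: tuples_0 rL')
  next
    case (Suc k)
    obtain y ys where y: "xs = y # ys" "y \<in> carrier A" "ys \<in> tuples A k"
      using Suc.prems(2) by (rule tuples_SucE)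
    have g: "ml k (\<lambda>zs. g (y # zs))" using Suc.prems(1) y by simp
    show ?case
      using Suc.IH[OF g y(3)] y that(1) lie_derivative_closed[OF that(1) g y(3)]
        multilinear_carrier[OF Suc.prems(1), of "br x y # ys"]
      by (simp add: \<phi>_minus br')
  qed
  have D: "\<phi> (D k g xs) = M'.D k (\<lambda>xs. \<phi> (g xs)) xs"
    if "ml k g" "xs \<in> tuples A (Suc k)" for k g xs
    using that
  proof (induction k arbitrary: g xs)
    case 0
    then show ?case by (auto elim!: tuples_SucE simp: tuples_0 \<phi>_neg rR')
  next
    case (Suc k)
    obtain y ys where y: "xs = y # ys" "y \<in> carrier A" "ys \<in> tuples A (Suc k)"
      using Suc.prems(2) by (rule tuples_SucE)
    have g: "ml k (\<lambda>zs. g (y # zs))" using Suc.prems(1) y by simp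
    show ?case
      using Suc.IH[OF g y(3)] y L[OF y(2) Suc.prems(1) y(3)] coboundary_closed[OF g y(3)]
        lie_derivative_closed[OF y(2) Suc.prems(1) y(3)]
      by (simp add: \<phi>_minus)
  qed
  have ml: "ml n f" using f by (simp add: multilinear_space_carrier[OF A.module_axioms])
  have "M'.ml n (pushforward A \<phi> n f)"
    using pushforward_closed[OF A.module_axioms \<phi> f]
    by (simp add: multilinear_space_carrier[OF A.module_axioms])
  then show ?thesis
    unfolding M'.lp_coboundary_eq lp_coboundary_eq[OF ml]
    by (simp only: M'.lp_coboundary_eq) (auto simp: pushforward_def D[OF ml] fun_eq_iff restrict_def
        intro!: M'.lp_coboundary_eq cartan_coboundary_cong[of A n])
qed

end

lemma (in leibniz_actions) lp_cochain_complex: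
  "cochain_complex_over K (lp_complex K A br M rL rR)"
proof (rule cochain_complex_over.intro)
  fix n f assume "f \<in> carrier (cochains (lp_complex K A br M rL rR) n)"
  then have f: "f \<in> carrier (multilinear_space K A M n)" by (simp add: lp_complex_def)
  then have ml: "ml n f" "ml (Suc n) (lp_coboundary A br M rL rR n f)"
    using lp_coboundary_closed[OF f] by (simp_all add: multilinear_space_carrier[OF A.module_axioms])
  have "D (Suc n) (lp_coboundary A br M rL rR n f) xs = \<zero>\<^bsub>M\<^esub>" if "xs \<in> tuples A (Suc (Suc n))" for xs
    using coboundary_coboundary[OF ml(1) that] that
      cartan_coboundary_cong[of A "Suc n" "lp_coboundary A br M rL rR n f" "D n f" xs br M rL rR]
    by (simp add: lp_coboundary_eq[OF ml(1)])
  then show "cobd (lp_complex K A br M rL rR) (Suc n) (cobd (lp_complex K A br M rL rR) n f) =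
      \<zero>\<^bsub>cochains (lp_complex K A br M rL rR) (Suc (Suc n))\<^esub>"
    by (simp add: lp_complex_def lp_coboundary_eq[OF ml(2)] multilinear_space_def restrict_def fun_eq_iff)
qed (simp_all add: lp_complex_def lp_coboundary_hom
      multilinear_space_vectorspace A.vectorspace_axioms M.vectorspace_axioms)

lemma cochain_complex_over_injective:
  assumes "cochain_complex_over K B"
    and "\<And>n. vectorspace K (cochains A n)"
    and "\<And>n. cobd A n \<in> LinearCombinations.module_hom K (cochains A n) (cochains A (Suc n))"
    and hom: "\<And>n. \<phi> n \<in> LinearCombinations.module_hom K (cochains A n) (cochains B n)"
    and chain: "\<And>n f. f \<in> carrier (cochains A n) \<Longrightarrow> \<phi> (Suc n) (cobd A n f) = cobd B n (\<phi> n f)"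
    and inj: "\<And>n. inj_on (\<phi> n) (carrier (cochains A n))"
  shows "cochain_complex_over K A"
proof (rule cochain_complex_over.intro)
  interpret B: cochain_complex_over K B by fact
  fix n f assume f: "f \<in> carrier (cochains A n)"
  interpret A: vectorspace K "cochains A m" for m by fact
  note closed = module_hom_carrier[OF assms(3)]
  have "\<phi> (Suc (Suc n)) (cobd A (Suc n) (cobd A n f)) =
      \<phi> (Suc (Suc n)) \<zero>\<^bsub>cochains A (Suc (Suc n))\<^esub>"
    using module_hom_zero[OF A.vectorspace_axioms B.cochains_vectorspace hom]
      B.cobd_cobd[OF module_hom_carrier[OF hom f]]
    by (simp add: chain f closed)
  then show "cobd A (Suc n) (cobd A n f) = \<zero>\<^bsub>cochains A (Suc (Suc n))\<^esub>"
    using inj_onD[OF inj] closed[OF closed[OF f]] by blast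
qed fact+

lemma cochain_complex_over_surjective:
  assumes "cochain_complex_over K B"
    and "\<And>n. vectorspace K (cochains C n)"
    and "\<And>n. cobd C n \<in> LinearCombinations.module_hom K (cochains C n) (cochains C (Suc n))"
    and hom: "\<And>n. \<phi> n \<in> LinearCombinations.module_hom K (cochains B n) (cochains C n)"
    and chain: "\<And>n f. f \<in> carrier (cochains B n) \<Longrightarrow> \<phi> (Suc n) (cobd B n f) = cobd C n (\<phi> n f)"
    and surj: "\<And>n. \<phi> n ` carrier (cochains B n) = carrier (cochains C n)"
  shows "cochain_complex_over K C"
proof (rule cochain_complex_over.intro)
  interpret B: cochain_complex_over K B by fact
  fix n f assume "f \<in> carrier (cochains C n)"
  then obtain g where g: "g \<in> carrier (cochains B n)" "f = \<phi> n g" using surj[of n] by blast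
  then show "cobd C (Suc n) (cobd C n f) = \<zero>\<^bsub>cochains C (Suc (Suc n))\<^esub>"
    using module_hom_zero[OF B.cochains_vectorspace assms(2) hom, of "Suc (Suc n)"]
    by (simp add: chain[symmetric] B.cobd_cobd B.cobd_closed)
qed fact+

section \<open>The complexes of a relative Rota-Baxter operator\<close>

lemma bilinear_map_cong:
  assumes "bilinear_map K A B C f" "module K A" "module K B"
    and "\<And>x y. x \<in> carrier A \<Longrightarrow> y \<in> carrier B \<Longrightarrow> g x y = f x y"
  shows "bilinear_map K A B C g"
  unfolding bilinear_map_def
proof (intro conjI ballI)
  fix x assume "x \<in> carrier A"
  then show "g x \<in> LinearCombinations.module_hom K B C"
    using assms by - (rule module_hom_cong[of "f x"], simp_all add: bilinear_map_def)
next
  fix y assume "y \<in> carrier B"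
  then show "(\<lambda>x. g x y) \<in> LinearCombinations.module_hom K A C"
    using assms by - (rule module_hom_cong[of "\<lambda>x. f x y"], simp_all add: bilinear_map_def)
qed

lemma bilinear_map_surj_image:
  assumes r: "bilinear_map K A M M r" and A: "module K A" and M: "vectorspace K M"
    and \<phi>: "\<phi> \<in> LinearCombinations.module_hom K M L" "\<phi> ` carrier M = carrier L"
    and r': "\<And>x m. x \<in> carrier A \<Longrightarrow> m \<in> carrier M \<Longrightarrow> r' x (\<phi> m) = \<phi> (r x m)"
  shows "bilinear_map K A L L r'"
  unfolding bilinear_map_def
proof (intro conjI ballI)
  interpret M: vectorspace K M by fact
  note add = LinearCombinations.module_hom_add and smult = LinearCombinations.module_hom_smult
  fix x assume x: "x \<in> carrier A"
  then have rx: "r x \<in> LinearCombinations.module_hom K M M" using r by (simp add: bilinear_map_def)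
  show "r' x \<in> LinearCombinations.module_hom K L L"
  proof (rule module_homI)
    fix l assume "l \<in> carrier L"
    then obtain m where m: "m \<in> carrier M" "l = \<phi> m" using \<phi>(2) by blast
    then show "r' x l \<in> carrier L"
      using r' x module_hom_carrier[OF \<phi>(1)] module_hom_carrier[OF rx] by simp
    fix l' assume "l' \<in> carrier L"
    then obtain m' where m': "m' \<in> carrier M" "l' = \<phi> m'" using \<phi>(2) by blast
    have "r' x (l \<oplus>\<^bsub>L\<^esub> l') = r' x (\<phi> (m \<oplus>\<^bsub>M\<^esub> m'))"
      using m m' by (simp add: add[OF \<phi>(1)])
    also have "\<dots> = \<phi> (r x (m \<oplus>\<^bsub>M\<^esub> m'))"
      using m m' x by (intro r') simp_all
    also have "\<dots> = r' x l \<oplus>\<^bsub>L\<^esub> r' x l'"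
      using m m' x module_hom_carrier[OF rx] by (simp add: r' add[OF rx] add[OF \<phi>(1)])
    finally show "r' x (l \<oplus>\<^bsub>L\<^esub> l') = r' x l \<oplus>\<^bsub>L\<^esub> r' x l'" .
  next
    fix a l assume a: "a \<in> carrier K" and "l \<in> carrier L"
    then obtain m where m: "m \<in> carrier M" "l = \<phi> m" using \<phi>(2) by blast
    have "r' x (a \<odot>\<^bsub>L\<^esub> l) = r' x (\<phi> (a \<odot>\<^bsub>M\<^esub> m))"
      using m a by (simp add: smult[OF \<phi>(1)])
    also have "\<dots> = \<phi> (r x (a \<odot>\<^bsub>M\<^esub> m))"
      using m a x by (intro r') simp_all
    also have "\<dots> = a \<odot>\<^bsub>L\<^esub> r' x l"
      using m a x module_hom_carrier[OF rx] by (simp add: r' smult[OF rx] smult[OF \<phi>(1)])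
    finally show "r' x (a \<odot>\<^bsub>L\<^esub> l) = a \<odot>\<^bsub>L\<^esub> r' x l" .
  qed
next
  fix l assume "l \<in> carrier L"
  then obtain m where m: "m \<in> carrier M" "l = \<phi> m" using \<phi>(2) by blast
  then have rm: "(\<lambda>x. r x m) \<in> LinearCombinations.module_hom K A M"
    using r by (simp add: bilinear_map_def)
  have "(\<lambda>x. \<phi> (r x m)) \<in> LinearCombinations.module_hom K A L"
    using rm \<phi>(1) by (rule module_hom_comp)
  then show "(\<lambda>x. r' x l) \<in> LinearCombinations.module_hom K A L"
    using A by (rule module_hom_cong) (simp add: m r')
qed

lemma bilinear_map_restrict_codomain:
  assumes "bilinear_map K A M M r" "N \<subseteq> carrier M"
    and "\<And>x m. x \<in> carrier A \<Longrightarrow> m \<in> N \<Longrightarrow> r x m \<in> N"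
  shows "bilinear_map K A (M\<lparr>carrier := N\<rparr>) (M\<lparr>carrier := N\<rparr>) r"
  using assms by (auto simp: bilinear_map_def LinearCombinations.module_hom_def subset_iff)

lemma coset_eq_zero_iff:
  assumes "subspace K N M" "x \<in> carrier M"
  shows "N +>\<^bsub>M\<^esub> x = \<zero>\<^bsub>quotient_space M N\<^esub> \<longleftrightarrow> x \<in> N"
proof -
  interpret M: vectorspace K M using assms(1) by (simp add: subspace_def)
  show ?thesis
    using coset_eq_iff[OF assms M.M.zero_closed] assms(2) by (simp add: quotient_zero[OF assms(1)])
qed

context
  fixes K :: "('k, 'x) ring_scheme" and G :: "('k, 'g, 'p) module_scheme" and br
  assumes algebra: "leibniz_algebra K G br"
begin

interpretation G: vectorspace K G
  using algebra by (simp add: leibniz_algebra_def)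

lemma bracket_hom:
  shows "x \<in> carrier G \<Longrightarrow> br x \<in> LinearCombinations.module_hom K G G"
    and "y \<in> carrier G \<Longrightarrow> (\<lambda>x. br x y) \<in> LinearCombinations.module_hom K G G"
  using leibniz_algebra.br_bilinear[OF algebra] by (simp_all add: bilinear_map_def)

lemma bracket_closed: "x \<in> carrier G \<Longrightarrow> y \<in> carrier G \<Longrightarrow> br x y \<in> carrier G"
  by (rule module_hom_carrier[OF bracket_hom(1)])

lemma Leib_subset:
  assumes "subspace K P G" "\<And>x. x \<in> carrier G \<Longrightarrow> br x x \<in> P"
  shows "Leib K G br \<subseteq> P"
  unfolding Leib_def using assms
  by (intro G.span_is_subset) (auto simp: subspace_def)

lemma Leib_subspace: "subspace K (Leib K G br) G"
  unfolding Leib_def subspace_def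
  by (intro conjI G.vectorspace_axioms G.span_is_submodule) (auto simp: bracket_closed)

lemma Leib_carrier: "l \<in> Leib K G br \<Longrightarrow> l \<in> carrier G"
  using Leib_subspace by (auto simp: subspace_def LinearCombinations.submodule_def)

lemma square_mem_Leib: "x \<in> carrier G \<Longrightarrow> br x x \<in> Leib K G br"
  unfolding Leib_def by (rule subsetD[OF G.in_own_span]) (auto simp: bracket_closed)

lemma Leib_kernel:
  assumes "vectorspace K W" "f \<in> LinearCombinations.module_hom K G W"
    and "\<And>x. x \<in> carrier G \<Longrightarrow> f (br x x) = \<zero>\<^bsub>W\<^esub>" "l \<in> Leib K G br"
  shows "f l = \<zero>\<^bsub>W\<^esub>"
proof -
  interpret f: linear_map K G W f
    by (rule linear_mapI[OF G.vectorspace_axioms assms(1,2)])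
  have "Leib K G br \<subseteq> {x \<in> carrier G. f x = \<zero>\<^bsub>W\<^esub>}"
    using f.kerT_is_subspace assms(3) unfolding f.ker_def
    by (intro Leib_subset) (simp_all add: bracket_closed)
  then show ?thesis using assms(4) by blast
qed

lemma bracket_add_swap_mem_Leib:
  assumes "x \<in> carrier G" "y \<in> carrier G"
  shows "br x y \<oplus>\<^bsub>G\<^esub> br y x \<in> Leib K G br"
proof -
  interpret N: LinearCombinations.submodule K "Leib K G br" G
    using Leib_subspace by (simp add: subspace_def)
  note c = bracket_closed
  let ?s = "br (x \<oplus>\<^bsub>G\<^esub> y) (x \<oplus>\<^bsub>G\<^esub> y)"
  have s: "?s = (br x y \<oplus>\<^bsub>G\<^esub> br y x) \<oplus>\<^bsub>G\<^esub> (br x x \<oplus>\<^bsub>G\<^esub> br y y)"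
    using assms LinearCombinations.module_hom_add[OF bracket_hom(1)]
      LinearCombinations.module_hom_add[OF bracket_hom(2)]
    by (simp add: c G.M.a_ac)
  have "?s \<oplus>\<^bsub>G\<^esub> \<ominus>\<^bsub>G\<^esub> (br x x \<oplus>\<^bsub>G\<^esub> br y y) \<in> Leib K G br"
    using assms by (intro N.m_closed subspace_a_inv[OF Leib_subspace] square_mem_Leib) simp_all
  then show ?thesis
    unfolding s using assms by (simp add: c G.M.a_assoc G.M.r_neg)
qed

lemma bracket_Leib_left:
  assumes "l \<in> Leib K G br" "y \<in> carrier G"
  shows "br l y = \<zero>\<^bsub>G\<^esub>"
proof (rule Leib_kernel[OF G.vectorspace_axioms bracket_hom(2)[OF assms(2)] _ assms(1)])
  fix x assume x: "x \<in> carrier G"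
  have "br x (br x y) = br (br x x) y \<oplus>\<^bsub>G\<^esub> br x (br x y)"
    using leibniz_algebra.leibniz[OF algebra x x assms(2)] .
  then show "br (br x x) y = \<zero>\<^bsub>G\<^esub>"
    using x assms(2) by (simp add: bracket_closed)
qed

lemma bracket_Leib_right:
  assumes x: "x \<in> carrier G" and l: "l \<in> Leib K G br"
  shows "br x l \<in> Leib K G br"
proof -
  have quot: "vectorspace K (quotient_space G (Leib K G br))"
    by (rule quotient_vectorspace[OF Leib_subspace])
  have "(Leib K G br) +>\<^bsub>G\<^esub> br x l = \<zero>\<^bsub>quotient_space G (Leib K G br)\<^esub>"
  proof (rule Leib_kernel[OF quot _ _ l])
    show "(\<lambda>l. (Leib K G br) +>\<^bsub>G\<^esub> br x l) \<in>
        LinearCombinations.module_hom K G (quotient_space G (Leib K G br))"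
      by (rule module_hom_comp[OF bracket_hom(1)[OF x] quotient_proj_hom[OF Leib_subspace]])
    fix y assume y: "y \<in> carrier G"
    have "br x (br y y) = br (br x y) y \<oplus>\<^bsub>G\<^esub> br y (br x y)"
      by (rule leibniz_algebra.leibniz[OF algebra x y y])
    then show "(Leib K G br) +>\<^bsub>G\<^esub> br x (br y y) = \<zero>\<^bsub>quotient_space G (Leib K G br)\<^esub>"
      using bracket_add_swap_mem_Leib[of "br x y" y] x y
      by (simp add: coset_eq_zero_iff[OF Leib_subspace] bracket_closed)
  qed
  then show ?thesis
    using x l by (simp add: coset_eq_zero_iff[OF Leib_subspace] bracket_closed Leib_carrier)
qed

lemma Lie_proj_eq_iff: "x \<in> carrier G \<Longrightarrow> y \<in> carrier G \<Longrightarrow>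
    Lie_proj K G br x = Lie_proj K G br y \<longleftrightarrow> x \<ominus>\<^bsub>G\<^esub> y \<in> Leib K G br"
  unfolding Lie_proj_def by (rule coset_eq_iff[OF Leib_subspace])

lemma mem_Lie_proj_iff: "x \<in> carrier G \<Longrightarrow>
    y \<in> Lie_proj K G br x \<longleftrightarrow> y \<in> carrier G \<and> Lie_proj K G br y = Lie_proj K G br x"
  unfolding Lie_proj_def by (rule mem_coset_iff[OF Leib_subspace])

lemma Lie_proj_hom: "Lie_proj K G br \<in> LinearCombinations.module_hom K G (Lie_space K G br)"
  using quotient_proj_hom[OF Leib_subspace] by (simp add: Lie_proj_def[abs_def] Lie_space_def)

lemma Lie_proj_eq_zero_iff: "x \<in> carrier G \<Longrightarrow>
    Lie_proj K G br x = \<zero>\<^bsub>Lie_space K G br\<^esub> \<longleftrightarrow> x \<in> Leib K G br"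
  unfolding Lie_proj_def Lie_space_def by (rule coset_eq_zero_iff[OF Leib_subspace])

lemma Lie_space_carrier: "Lie_proj K G br ` carrier G = carrier (Lie_space K G br)"
  using quotient_carrier[OF Leib_subspace] by (simp add: Lie_proj_def[abs_def] Lie_space_def)

lemma Lie_space_vectorspace: "vectorspace K (Lie_space K G br)"
  unfolding Lie_space_def by (rule quotient_vectorspace[OF Leib_subspace])

lemma Lie_bracket_proj:
  assumes x: "x \<in> carrier G" and y: "y \<in> carrier G"
  shows "Lie_bracket K G br (Lie_proj K G br x) (Lie_proj K G br y) = Lie_proj K G br (br x y)"
proof -
  have eq: "Lie_proj K G br (br x' y') = Lie_proj K G br (br x y)"
    if "x' \<in> Lie_proj K G br x" "y' \<in> Lie_proj K G br y" for x' y'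
  proof -
    have x': "x' \<in> carrier G" "x' \<ominus>\<^bsub>G\<^esub> x \<in> Leib K G br"
      and y': "y' \<in> carrier G" "y' \<ominus>\<^bsub>G\<^esub> y \<in> Leib K G br"
      using that x y by (auto simp: mem_Lie_proj_iff Lie_proj_eq_iff)
    note minus = module_hom_minus[OF G.vectorspace_axioms G.vectorspace_axioms]
    have "br x' y' \<ominus>\<^bsub>G\<^esub> br x' y \<in> Leib K G br"
      using bracket_Leib_right[OF x'(1) y'(2)] minus[OF bracket_hom(1)[OF x'(1)] y'(1) y] by simp
    moreover have "br x' y \<ominus>\<^bsub>G\<^esub> br x y \<in> Leib K G br"
      using bracket_Leib_left[OF x'(2) y] minus[OF bracket_hom(2)[OF y] x'(1) x]
        Leib_subspace by (simp add: subspace_def LinearCombinations.submodule_def)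
    ultimately show ?thesis
      using x y x' y' by (simp add: bracket_closed Lie_proj_eq_iff[symmetric])
  qed
  have ne: "Lie_proj K G br x \<noteq> {}" "Lie_proj K G br y \<noteq> {}"
    using x y mem_Lie_proj_iff by blast+
  have "(\<Union>y'\<in>Lie_proj K G br y. Lie_proj K G br (br x' y')) = Lie_proj K G br (br x y)"
    if "x' \<in> Lie_proj K G br x" for x'
    by (rule SUP_eq_const[OF ne(2) eq[OF that]])
  then show ?thesis
    unfolding Lie_bracket_def by (rule SUP_eq_const[OF ne(1)])
qed

lemma Lie_proj_section:
  obtains s where "s \<in> LinearCombinations.module_hom K (Lie_space K G br) G"
    "\<And>P. P \<in> carrier (Lie_space K G br) \<Longrightarrow> Lie_proj K G br (s P) = P"
  using quotient_section[OF Leib_subspace leibniz_algebra.fin_dim_algebra[OF algebra]]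
  unfolding Lie_space_def Lie_proj_def by blast

end

context
  fixes K :: "('k, 'x) ring_scheme" and G :: "('k, 'g, 'p) module_scheme"
    and V :: "('k, 'v, 'q) module_scheme" and br rL rR T
  assumes rb: "relative_rota_baxter K G br V rL rR T"
    and antisymmetric: "antisymmetric_rep G V rR"
begin

private lemma rep: "leibniz_representation K G br V rL rR"
  using rb by (simp add: relative_rota_baxter_def)

private lemma alg: "leibniz_algebra K G br"
  using rep by (simp add: leibniz_representation_def)

interpretation G: vectorspace K G
  using alg by (simp add: leibniz_algebra_def)

interpretation V: vectorspace K V
  using rep by (simp add: leibniz_representation_def)

private abbreviation (input) "N \<equiv> Leib K G br"
private abbreviation (input) "pr \<equiv> Lie_proj K G br"
private abbreviation (input) "Q \<equiv> Lie_space K G br"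
private abbreviation (input) "\<theta> \<equiv> Lie_action rL"
private abbreviation (input) "bV \<equiv> induced_bracket V rL rR T"
private abbreviation (input) "l\<^sub>G \<equiv> induced_left G br rR T"
private abbreviation (input) "r\<^sub>G \<equiv> induced_right G br rL T"
private abbreviation (input) "bV' \<equiv> induced_bracket V \<theta> (\<lambda>_ _. \<zero>\<^bsub>V\<^esub>) (pr \<circ> T)"
private abbreviation (input) "l\<^sub>Q \<equiv> induced_left Q (Lie_bracket K G br) (\<lambda>_ _. \<zero>\<^bsub>V\<^esub>) (pr \<circ> T)"
private abbreviation (input) "r\<^sub>Q \<equiv> induced_right Q (Lie_bracket K G br) \<theta> (pr \<circ> T)"

private lemma T_hom: "T \<in> LinearCombinations.module_hom K V G"
  using rb by (simp add: relative_rota_baxter_def linear_map_def mod_hom_def mod_hom_axioms_def)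

private lemma T_closed [simp]: "v \<in> carrier V \<Longrightarrow> T v \<in> carrier G"
  by (rule module_hom_carrier[OF T_hom])

private lemma T_zero [simp]: "T \<zero>\<^bsub>V\<^esub> = \<zero>\<^bsub>G\<^esub>"
  by (rule module_hom_zero[OF V.vectorspace_axioms G.vectorspace_axioms T_hom])

private lemma rR_zero [simp]: "x \<in> carrier G \<Longrightarrow> v \<in> carrier V \<Longrightarrow> rR x v = \<zero>\<^bsub>V\<^esub>"
  using antisymmetric by (simp add: antisymmetric_rep_def)

private lemma rL_hom:
  shows "x \<in> carrier G \<Longrightarrow> rL x \<in> LinearCombinations.module_hom K V V"
    and "v \<in> carrier V \<Longrightarrow> (\<lambda>x. rL x v) \<in> LinearCombinations.module_hom K G V"
  using leibniz_representation.rL_bilinear[OF rep] by (simp_all add: bilinear_map_def)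

private lemma rL_closed [simp]: "x \<in> carrier G \<Longrightarrow> v \<in> carrier V \<Longrightarrow> rL x v \<in> carrier V"
  by (rule module_hom_carrier[OF rL_hom(1)])

private lemmas br_hom = bracket_hom[OF alg]
private lemmas br_closed [simp] = bracket_closed[OF alg]

private lemma rL_br:
  assumes "x \<in> carrier G" "y \<in> carrier G" "v \<in> carrier V"
  shows "rL (br x y) v = rL x (rL y v) \<ominus>\<^bsub>V\<^esub> rL y (rL x v)"
  using leibniz_representation.rL_bracket[OF rep assms] .

private lemma rota: "u \<in> carrier V \<Longrightarrow> v \<in> carrier V \<Longrightarrow> br (T u) (T v) = T (rL (T u) v)"
  using relative_rota_baxter.rota_baxter[OF rb] by simp

private lemma bV_eq: "u \<in> carrier V \<Longrightarrow> v \<in> carrier V \<Longrightarrow> bV u v = rL (T u) v"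
  by (simp add: induced_bracket_def)

private lemma l_eq: "u \<in> carrier V \<Longrightarrow> x \<in> carrier G \<Longrightarrow> l\<^sub>G u x = br (T u) x"
  by (simp add: induced_left_def)

private lemma r_eq: "u \<in> carrier V \<Longrightarrow> x \<in> carrier G \<Longrightarrow> r\<^sub>G u x = br x (T u) \<ominus>\<^bsub>G\<^esub> T (rL x u)"
  by (simp add: induced_right_def)

private lemma rL_Leib: "l \<in> N \<Longrightarrow> v \<in> carrier V \<Longrightarrow> rL l v = \<zero>\<^bsub>V\<^esub>"
  by (rule Leib_kernel[OF alg V.vectorspace_axioms rL_hom(2)]) (simp_all add: rL_br)

private lemma Lie_action_proj:
  assumes x: "x \<in> carrier G" and v: "v \<in> carrier V"
  shows "\<theta> (pr x) v = rL x v"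
proof -
  have "rL y v = rL x v" if "y \<in> pr x" for y
  proof -
    have y: "y \<in> carrier G" "y \<ominus>\<^bsub>G\<^esub> x \<in> N"
      using that x by (auto simp: mem_Lie_proj_iff[OF alg] Lie_proj_eq_iff[OF alg])
    then have "rL y v \<ominus>\<^bsub>V\<^esub> rL x v = \<zero>\<^bsub>V\<^esub>"
      using rL_Leib[OF y(2) v] x v
        module_hom_minus[OF G.vectorspace_axioms V.vectorspace_axioms rL_hom(2)[OF v] y(1) x]
      by simp
    then show ?thesis using x y v by (simp add: V.M.minus_eq_zero_iff)
  qed
  moreover have "x \<in> pr x" using x by (simp add: mem_Lie_proj_iff[OF alg])
  ultimately have "(\<lambda>y. rL y v) ` pr x = {rL x v}" by blast
  then show ?thesis by (simp add: Lie_action_def)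
qed

private lemma bV_bilinear: "bilinear_map K V V V bV"
proof (rule bilinear_map_cong[OF _ V.module_axioms V.module_axioms bV_eq])
  show "bilinear_map K V V V (\<lambda>u. rL (T u))"
    using rL_hom module_hom_comp[OF T_hom] by (auto simp: bilinear_map_def)
qed

private lemma l_bilinear: "bilinear_map K V G G l\<^sub>G"
proof (rule bilinear_map_cong[OF _ V.module_axioms G.module_axioms l_eq])
  show "bilinear_map K V G G (\<lambda>u. br (T u))"
    using br_hom module_hom_comp[OF T_hom] by (auto simp: bilinear_map_def)
qed

private lemma r_bilinear: "bilinear_map K V G G r\<^sub>G"
proof (rule bilinear_map_cong[OF _ V.module_axioms G.module_axioms r_eq])
  show "bilinear_map K V G G (\<lambda>u x. br x (T u) \<ominus>\<^bsub>G\<^esub> T (rL x u))"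
    unfolding bilinear_map_def
  proof (intro conjI ballI)
    fix u assume u: "u \<in> carrier V"
    show "(\<lambda>x. br x (T u) \<ominus>\<^bsub>G\<^esub> T (rL x u)) \<in> LinearCombinations.module_hom K G G"
      using br_hom(2)[of "T u"] module_hom_comp[OF rL_hom(2)[OF u] T_hom] u
      by (intro module_hom_minus_fun G.vectorspace_axioms) simp_all
  next
    fix x assume x: "x \<in> carrier G"
    show "(\<lambda>u. br x (T u) \<ominus>\<^bsub>G\<^esub> T (rL x u)) \<in> LinearCombinations.module_hom K V G"
      using module_hom_comp[OF T_hom br_hom(1)[OF x]] module_hom_comp[OF rL_hom(1)[OF x] T_hom] x
      by (intro module_hom_minus_fun G.vectorspace_axioms V.vectorspace_axioms) simp_all
  qed
qed

text \<open>The identities below use the Rota-Baxter identity together with the fact that the elements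
  \<open>[x,y] + [y,x]\<close> of \<open>Leib\<close> act trivially from the left.\<close>

private lemma rb_actions: "leibniz_actions K V G bV l\<^sub>G r\<^sub>G"
proof (intro leibniz_actions.intro bilinear_actions.intro bilinear_actions_axioms.intro
    leibniz_actions_axioms.intro bV_bilinear l_bilinear r_bilinear
    V.vectorspace_axioms G.vectorspace_axioms)
  note leib = leibniz_algebra.leibniz[OF alg]
  note T_minus = module_hom_minus[OF V.vectorspace_axioms G.vectorspace_axioms T_hom]
  note br_minus2 = module_hom_minus[OF G.vectorspace_axioms G.vectorspace_axioms br_hom(1)]
  note br_minus1 = module_hom_minus[OF G.vectorspace_axioms G.vectorspace_axioms br_hom(2)]
  note rL_minus1 = module_hom_minus[OF G.vectorspace_axioms V.vectorspace_axioms rL_hom(2)]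
  fix u v assume u: "u \<in> carrier V" and v: "v \<in> carrier V"
  {
    fix w assume w: "w \<in> carrier V"
    have "rL (T u) (rL (T v) w) =
        (rL (T u) (rL (T v) w) \<ominus>\<^bsub>V\<^esub> rL (T v) (rL (T u) w)) \<oplus>\<^bsub>V\<^esub> rL (T v) (rL (T u) w)"
      using u v w by (simp add: a_minus_def V.M.a_assoc V.M.l_neg)
    then show "bV u (bV v w) = bV (bV u v) w \<oplus>\<^bsub>V\<^esub> bV v (bV u w)"
      using u v w by (simp add: bV_eq rota[symmetric] rL_br)
  }
  fix x assume x: "x \<in> carrier G"
  have "br (T u) (br (T v) x) = br (br (T u) (T v)) x \<oplus>\<^bsub>G\<^esub> br (T v) (br (T u) x)"
    using u v x by (intro leib) simp_all
  then show "l\<^sub>G (bV u v) x = l\<^sub>G u (l\<^sub>G v x) \<ominus>\<^bsub>G\<^esub> l\<^sub>G v (l\<^sub>G u x)"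
    using u v x by (simp add: bV_eq l_eq rota[symmetric] a_minus_def G.M.a_assoc G.M.r_neg)
  show "r\<^sub>G (bV u v) x = l\<^sub>G u (r\<^sub>G v x) \<ominus>\<^bsub>G\<^esub> r\<^sub>G v (l\<^sub>G u x)"
  proof -
    define p q s where "p = br (br (T u) x) (T v)" and "q = br x (br (T u) (T v))"
      and "s = T (rL x (rL (T u) v))"
    define t where "t = T (rL (T u) (rL x v))"
    have c: "p \<in> carrier G" "q \<in> carrier G" "s \<in> carrier G" "t \<in> carrier G"
      using u v x by (simp_all add: p_def q_def s_def t_def)
    have "br (T u) (br x (T v)) = p \<oplus>\<^bsub>G\<^esub> q"
      unfolding p_def q_def using u v x by (intro leib) simp_all
    then have "l\<^sub>G u (r\<^sub>G v x) = (p \<oplus>\<^bsub>G\<^esub> q) \<ominus>\<^bsub>G\<^esub> t"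
      using u v x by (simp add: l_eq r_eq br_minus2 rota t_def)
    moreover have "r\<^sub>G v (l\<^sub>G u x) = p \<ominus>\<^bsub>G\<^esub> (t \<ominus>\<^bsub>G\<^esub> s)"
      using u v x by (simp add: l_eq r_eq rL_br T_minus p_def t_def s_def)
    moreover have "r\<^sub>G (bV u v) x = q \<ominus>\<^bsub>G\<^esub> s"
      using u v x by (simp add: r_eq bV_eq rota q_def s_def)
    moreover have "((p \<oplus>\<^bsub>G\<^esub> q) \<ominus>\<^bsub>G\<^esub> t) \<ominus>\<^bsub>G\<^esub> (p \<ominus>\<^bsub>G\<^esub> (t \<ominus>\<^bsub>G\<^esub> s)) =
        (p \<ominus>\<^bsub>G\<^esub> t) \<oplus>\<^bsub>G\<^esub> ((q \<ominus>\<^bsub>G\<^esub> s) \<ominus>\<^bsub>G\<^esub> (p \<ominus>\<^bsub>G\<^esub> t))"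
      using c by (simp add: a_minus_def G.M.minus_add G.M.a_ac)
    moreover have "\<dots> = q \<ominus>\<^bsub>G\<^esub> s"
      using c by (simp add: a_minus_def[of G "q \<ominus>\<^bsub>G\<^esub> s"] G.M.a_comm[of "q \<ominus>\<^bsub>G\<^esub> s"] G.M.r_neg2)
    ultimately show ?thesis by simp
  qed
  show "r\<^sub>G v (l\<^sub>G u x) = \<ominus>\<^bsub>G\<^esub> r\<^sub>G v (r\<^sub>G u x)"
  proof -
    let ?a = "br (T u) x" and ?b = "br x (T u)" and ?t = "T (rL x u)"
    have ab: "?a \<oplus>\<^bsub>G\<^esub> ?b \<in> N"
      using u x by (intro bracket_add_swap_mem_Leib[OF alg]) simp_all
    have r_add: "r\<^sub>G v (y \<oplus>\<^bsub>G\<^esub> z) = r\<^sub>G v y \<oplus>\<^bsub>G\<^esub> r\<^sub>G v z"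
      if "y \<in> carrier G" "z \<in> carrier G" for y z
      using r_bilinear v that
      by (simp add: bilinear_map_def LinearCombinations.module_hom_add[of _ K G G])
    have r_minus: "r\<^sub>G v (y \<ominus>\<^bsub>G\<^esub> z) = r\<^sub>G v y \<ominus>\<^bsub>G\<^esub> r\<^sub>G v z"
      if "y \<in> carrier G" "z \<in> carrier G" for y z
      using r_bilinear v that module_hom_minus[OF G.vectorspace_axioms G.vectorspace_axioms]
      by (simp add: bilinear_map_def)
    have r_closed: "r\<^sub>G v y \<in> carrier G" if "y \<in> carrier G" for y
      using that v by (simp add: r_eq)
    have "r\<^sub>G v (?a \<oplus>\<^bsub>G\<^esub> ?b) = \<zero>\<^bsub>G\<^esub>"
      using ab u v x by (simp add: r_eq bracket_Leib_left[OF alg] rL_Leib)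
    then have "r\<^sub>G v ?a \<oplus>\<^bsub>G\<^esub> r\<^sub>G v ?b = \<zero>\<^bsub>G\<^esub>"
      using u x by (simp add: r_add)
    moreover have "r\<^sub>G v ?t = \<zero>\<^bsub>G\<^esub>"
      using u v x by (simp add: r_eq rota)
    moreover have "r\<^sub>G v (r\<^sub>G u x) = r\<^sub>G v ?b \<ominus>\<^bsub>G\<^esub> r\<^sub>G v ?t"
      using u v x by (simp add: r_eq[OF u] r_minus)
    ultimately show ?thesis
      using u x r_closed G.M.minus_equality[of "r\<^sub>G v ?a" "r\<^sub>G v ?b"] by (simp add: l_eq)
  qed
qed

interpretation B: leibniz_actions K V G bV l\<^sub>G r\<^sub>G
  by (rule rb_actions)

private lemma Leib_actions: "bilinear_actions K V (G\<lparr>carrier := N\<rparr>) bV l\<^sub>G r\<^sub>G"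
proof (intro bilinear_actions.intro bilinear_actions_axioms.intro bV_bilinear
    V.vectorspace_axioms bilinear_map_restrict_codomain l_bilinear r_bilinear)
  show "vectorspace K (G\<lparr>carrier := N\<rparr>)"
    by (rule G.subspace_is_vs[OF Leib_subspace[OF alg]])
  show "N \<subseteq> carrier G" "N \<subseteq> carrier G" using Leib_carrier[OF alg] by blast+
  fix u l assume u: "u \<in> carrier V" and l: "l \<in> N"
  show "l\<^sub>G u l \<in> N"
    using u l by (simp add: l_eq Leib_carrier[OF alg] bracket_Leib_right[OF alg])
  show "r\<^sub>G u l \<in> N"
    using u l Leib_subspace[OF alg]
    by (simp add: r_eq Leib_carrier[OF alg] bracket_Leib_left[OF alg] rL_Leib
        subspace_def LinearCombinations.submodule_def)
qed

interpretation Q: vectorspace K Q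
  by (rule Lie_space_vectorspace[OF alg])

private lemmas pr_hom = Lie_proj_hom[OF alg]
private lemmas pr_closed = module_hom_carrier[OF pr_hom]
private lemmas pr_minus = module_hom_minus[OF G.vectorspace_axioms Q.vectorspace_axioms pr_hom]

private lemma bV'_eq: "u \<in> carrier V \<Longrightarrow> v \<in> carrier V \<Longrightarrow> bV' u v = bV u v"
  by (simp add: induced_bracket_def Lie_action_proj)

private lemma l_proj: "u \<in> carrier V \<Longrightarrow> x \<in> carrier G \<Longrightarrow> l\<^sub>Q u (pr x) = pr (l\<^sub>G u x)"
  using module_hom_zero[OF G.vectorspace_axioms Q.vectorspace_axioms pr_hom]
  by (simp add: l_eq induced_left_def Lie_bracket_proj[OF alg] pr_closed)

private lemma r_proj: "u \<in> carrier V \<Longrightarrow> x \<in> carrier G \<Longrightarrow> r\<^sub>Q u (pr x) = pr (r\<^sub>G u x)"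
  by (simp add: r_eq induced_right_def Lie_bracket_proj[OF alg] Lie_action_proj pr_minus)

private lemma Lie_actions: "bilinear_actions K V Q bV' l\<^sub>Q r\<^sub>Q"
proof (intro bilinear_actions.intro bilinear_actions_axioms.intro
    V.vectorspace_axioms Q.vectorspace_axioms)
  show "bilinear_map K V V V bV'"
    by (rule bilinear_map_cong[OF bV_bilinear V.module_axioms V.module_axioms bV'_eq])
  show "bilinear_map K V Q Q l\<^sub>Q"
    by (rule bilinear_map_surj_image[OF l_bilinear V.module_axioms G.vectorspace_axioms pr_hom
          Lie_space_carrier[OF alg]]) (rule l_proj)
  show "bilinear_map K V Q Q r\<^sub>Q"
    by (rule bilinear_map_surj_image[OF r_bilinear V.module_axioms G.vectorspace_axioms pr_hom
          Lie_space_carrier[OF alg]]) (rule r_proj)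
qed

interpretation A: bilinear_actions K V "G\<lparr>carrier := N\<rparr>" bV l\<^sub>G r\<^sub>G
  by (rule Leib_actions)

interpretation C: bilinear_actions K V Q bV' l\<^sub>Q r\<^sub>Q
  by (rule Lie_actions)

private abbreviation (input) "CL \<equiv> rb_Leib_complex K G br V rL rR T"
private abbreviation (input) "CG \<equiv> rb_complex K G br V rL rR T"
private abbreviation (input) "CA \<equiv> ao_complex K Q (Lie_bracket K G br) V \<theta> (pr \<circ> T)"

private lemmas complex_defs = rb_Leib_complex_def rb_complex_def ao_complex_def lp_complex_def

private lemma incl_hom: "(\<lambda>x. x) \<in> LinearCombinations.module_hom K (G\<lparr>carrier := N\<rparr>) G"
  using Leib_carrier[OF alg] by (intro module_homI) simp_all

private lemma ms_carrier:
  "f \<in> carrier (multilinear_space K V M n) \<longleftrightarrow> multilinear K V M n f \<and> f \<in> extensional (tuples V n)"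
  by (rule multilinear_space_carrier[OF V.module_axioms])

private lemma pushforward_id:
  "f \<in> extensional (tuples V n) \<Longrightarrow> pushforward V (\<lambda>x. x) n f = f"
  by (auto simp: pushforward_def extensional_def)

private lemma \<alpha>_id:
  "f \<in> carrier (multilinear_space K V (G\<lparr>carrier := N\<rparr>) n) \<Longrightarrow> pushforward V (\<lambda>x. x) n f = f"
  by (simp add: ms_carrier pushforward_id)

private lemma \<beta>_surj:
  "pushforward V pr n ` carrier (multilinear_space K V G n) = carrier (multilinear_space K V Q n)"
proof (intro equalityI subsetI)
  fix h assume h: "h \<in> carrier (multilinear_space K V Q n)"
  obtain s where s: "s \<in> LinearCombinations.module_hom K Q G" "\<And>P. P \<in> carrier Q \<Longrightarrow> pr (s P) = P"
    using Lie_proj_section[OF alg] by blast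
  have "pushforward V pr n (pushforward V s n h) xs = h xs" for xs
    using h s(2) multilinear_carrier[of K V Q n h]
    by (auto simp: ms_carrier pushforward_def extensional_def)
  then show "h \<in> pushforward V pr n ` carrier (multilinear_space K V G n)"
    using pushforward_closed[OF V.module_axioms s(1) h] by (metis ext image_eqI)
qed (auto intro: pushforward_closed[OF V.module_axioms pr_hom])

private lemma exact:
  "pushforward V (\<lambda>x. x) n ` carrier (multilinear_space K V (G\<lparr>carrier := N\<rparr>) n) =
    {f \<in> carrier (multilinear_space K V G n).
      pushforward V pr n f = \<zero>\<^bsub>multilinear_space K V Q n\<^esub>}" (is "?L = ?R")
proof -
  have "?L = carrier (multilinear_space K V (G\<lparr>carrier := N\<rparr>) n)"
    using \<alpha>_id by (simp add: image_def)
  also have "\<dots> = {f \<in> carrier (multilinear_space K V G n). \<forall>xs\<in>tuples V n. f xs \<in> N}"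
    using Leib_carrier[OF alg]
    by (auto simp: multilinear_space_def multilinear_maps_def LinearCombinations.module_hom_def
        PiE_iff update_tuples)
  also have "\<dots> = ?R"
  proof (intro Collect_cong conj_cong refl)
    fix f assume f: "f \<in> carrier (multilinear_space K V G n)"
    then have fc: "f xs \<in> carrier G" if "xs \<in> tuples V n" for xs
      using that multilinear_carrier by (auto simp: ms_carrier)
    have "pushforward V pr n f = \<zero>\<^bsub>multilinear_space K V Q n\<^esub> \<longleftrightarrow>
        (\<forall>xs\<in>tuples V n. pr (f xs) = \<zero>\<^bsub>Q\<^esub>)"
      by (simp add: pushforward_def multilinear_space_def fun_eq_iff restrict_def) metis
    then show "(\<forall>xs\<in>tuples V n. f xs \<in> N) \<longleftrightarrow>
        pushforward V pr n f = \<zero>\<^bsub>multilinear_space K V Q n\<^esub>"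
      using fc by (simp add: Lie_proj_eq_zero_iff[OF alg])
  qed
  finally show ?thesis .
qed

lemma rota_baxter_short_exact:
  "short_exact_complexes K CL CG CA (pushforward V (\<lambda>x. x)) (pushforward V pr)"
proof -
  have chain\<alpha>: "pushforward V (\<lambda>x. x) (Suc n) (cobd CL n f) = cobd CG n (pushforward V (\<lambda>x. x) n f)"
    if "f \<in> carrier (cochains CL n)" for n f
    using A.lp_coboundary_natural[OF B.bilinear_actions_axioms incl_hom] that
    by (simp add: complex_defs)
  have chain\<beta>: "pushforward V pr (Suc n) (cobd CG n f) = cobd CA n (pushforward V pr n f)"
    if "f \<in> carrier (cochains CG n)" for n f
    using B.lp_coboundary_natural[OF C.bilinear_actions_axioms pr_hom bV'_eq l_proj r_proj] that
    by (simp add: complex_defs comp_def)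
  have inj: "inj_on (pushforward V (\<lambda>x. x) n) (carrier (cochains CL n))" for n
    using \<alpha>_id by (auto simp: complex_defs inj_on_def)
  have surj: "pushforward V pr n ` carrier (cochains CG n) = carrier (cochains CA n)" for n
    using \<beta>_surj by (simp add: complex_defs)
  have ex: "pushforward V (\<lambda>x. x) n ` carrier (cochains CL n) =
      {f \<in> carrier (cochains CG n). pushforward V pr n f = \<zero>\<^bsub>cochains CA n\<^esub>}" for n
    using exact[of n] by (simp add: complex_defs)
  have hom\<alpha>: "pushforward V (\<lambda>x. x) n \<in>
      LinearCombinations.module_hom K (cochains CL n) (cochains CG n)" for n
    using pushforward_hom[OF V.vectorspace_axioms A.M.vectorspace_axioms incl_hom]
    by (simp add: complex_defs)
  have hom\<beta>: "pushforward V pr n \<in>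
      LinearCombinations.module_hom K (cochains CG n) (cochains CA n)" for n
    using pushforward_hom[OF V.vectorspace_axioms G.vectorspace_axioms pr_hom]
    by (simp add: complex_defs)
  have CG: "cochain_complex_over K CG"
    using B.lp_cochain_complex by (simp add: rb_complex_def)
  have CL: "cochain_complex_over K CL"
    using CG _ _ hom\<alpha> chain\<alpha> inj
    by (rule cochain_complex_over_injective)
      (simp_all add: complex_defs multilinear_space_vectorspace V.vectorspace_axioms
        A.M.vectorspace_axioms A.lp_coboundary_hom)
  have CA: "cochain_complex_over K CA"
    using CG _ _ hom\<beta> chain\<beta> surj
    by (rule cochain_complex_over_surjective)
      (simp_all add: complex_defs multilinear_space_vectorspace V.vectorspace_axioms
        Q.vectorspace_axioms C.lp_coboundary_hom)
  show ?thesis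
    by (intro short_exact_complexes.intro cochain_map.intro cochain_map_axioms.intro
        short_exact_complexes_axioms.intro CL CG CA hom\<alpha> hom\<beta> chain\<alpha> chain\<beta> inj surj ex)
qed

end

theorem theorem4p16:
  fixes K :: "'k ring" and G :: "('k, 'g) module" and V :: "('k, 'v) module"
    and br :: "'g \<Rightarrow> 'g \<Rightarrow> 'g" and rL rR :: "'g \<Rightarrow> 'v \<Rightarrow> 'v" and T :: "'v \<Rightarrow> 'g"
  assumes "algebraically_closed K" and "char_zero K"
    and "leibniz_algebra K G br"
    and "leibniz_representation K G br V rL rR"
    and "antisymmetric_rep G V rR"
    and "relative_rota_baxter K G br V rL rR T"
  shows "let pr = Lie_proj K G br;
             CL = rb_Leib_complex K G br V rL rR T;
             CG = rb_complex K G br V rL rR T;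
             CA = ao_complex K (Lie_space K G br) (Lie_bracket K G br) V (Lie_action rL) (pr \<circ> T);
             \<alpha> = pushforward V (\<lambda>x. x);
             \<beta> = pushforward V pr;
             H\<alpha> = (\<lambda>n. cohomology_map CG n (\<alpha> n));
             H\<beta> = (\<lambda>n. cohomology_map CA n (\<beta> n));
             c = connecting_map CL CG \<alpha> \<beta>
         in inj_on (H\<alpha> 0) (carrier (cohomology CL 0)) \<and>
            (\<forall>n. exact_at K (cohomology CL n) (H\<alpha> n) (cohomology CG n) (H\<beta> n) (cohomology CA n) \<and>
                 exact_at K (cohomology CG n) (H\<beta> n) (cohomology CA n) (c n) (cohomology CL (Suc n)) \<and>
                 exact_at K (cohomology CA n) (c n) (cohomology CL (Suc n))
                   (H\<alpha> (Suc n)) (cohomology CG (Suc n)))"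
proof -
  interpret short_exact_complexes K "rb_Leib_complex K G br V rL rR T" "rb_complex K G br V rL rR T"
    "ao_complex K (Lie_space K G br) (Lie_bracket K G br) V (Lie_action rL) (Lie_proj K G br \<circ> T)"
    "pushforward V (\<lambda>x. x)" "pushforward V (Lie_proj K G br)"
    using assms(6,5) by (rule rota_baxter_short_exact)
  show ?thesis
    unfolding Let_def using inj_H\<alpha>_0 exact_at_B exact_at_C exact_at_A by blast
qed

end
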